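(* Let $\nu<\frac16$ be a real number. For any $s\ge 1$ and any given $u_0\in H^s(\mathbb{R})$, there exist a time $T=T(\|u_0\|_{H^s})>0$ and a unique function $u\in C([0,T];H^s(\mathbb{R}))$ which is a solution of the initial value problem $$u_t+u_x+\tfrac32\,u u_x+\nu\, u_{xxx}-\left(\tfrac16-\nu\right)u_{xxt}=0,\qquad u(x,0)=u_0(x),\qquad x\in\mathbb{R}.$$ The solution depends continuously on $u_0$ in $H^s(\mathbb{R})$.
   Context: Functions are real-valued and $H^s(\mathbb{R})$ is the usual $L^2$-based Sobolev space. The Fourier transform in $x$ is $\widehat f(\xi)=\frac1{\sqrt{2\pi}}\int_{\mathbb{R}}f(x)e^{-i\xi x}\,dx$. Since $\nu<\frac16$, the initial value problem is rewritten as $$i u_t=\phi(\partial_x)u+\psi(\partial_x)u^2,\qquad u(x,0)=u_0(x),$$ where $\phi(\partial_x),\psi(\partial_x)$ are the Fourier multipliers $\widehat{\phi(\partial_x)f}(\xi)=\phi(\xi)\widehat f(\xi)$, $\widehat{\psi(\partial_x)f}(\xi)=\psi(\xi)\widehat f(\xi)$ with symbols $$\phi(\xi)=\frac{\xi(1-\nu\xi^2)}{(\frac16-\nu)\xi^2+1},\qquad \psi(\xi)=\frac{3\xi}{4\left[(\frac16-\nu)\xi^2+1\right]}.$$ A solution in $C([0,T];H^s(\mathbb{R}))$ is understood as a solution of the integral (Duhamel) form $$u(x,t)=S(t)u_0-i\int_0^tS(t-\tau)\psi(\partial_x)u^2(x,\tau)\,d\tau,\qquad \widehat{S(t)u_0}=e^{-i\phi(\xi)t}\widehat{u_0}.$$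 *)

theory Defs
  imports "HOL-Analysis.Analysis"
begin

text \<open>
  Elements of $L^2(\mathbb{R})$ and $H^s(\mathbb{R})$ are represented by Borel functions; two functions
  are the same element iff they agree almost everywhere. All notions below are invariant under
  changing representatives.
\<close>

definition square_integrable :: "(real \<Rightarrow> complex) \<Rightarrow> bool" where
  "square_integrable f \<longleftrightarrow>
     f \<in> borel_measurable lborel \<and> integrable lborel (\<lambda>x. (cmod (f x))\<^sup>2)"

text \<open>
  On $L^2$ the Fourier integral is the limit in $L^2$ of the integrals over $[-R,R]$ as
  $R \to \infty$. For $f$ in $L^1 \cap L^2$ this is the absolutely convergent integral
  $(2\pi)^{-1/2} \int f(x) e^{-i\xi x} dx$, up to a null set.
\<close>

definition truncated_fourier :: "real \<Rightarrow> (real \<Rightarrow> complex) \<Rightarrow> real \<Rightarrow> complex" where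
  "truncated_fourier R f \<xi> =
     complex_of_real (1 / sqrt (2 * pi)) *
       (LINT x:{-R..R}|lborel. f x * exp (- (\<i> * complex_of_real (\<xi> * x))))"

definition is_fourier :: "(real \<Rightarrow> complex) \<Rightarrow> (real \<Rightarrow> complex) \<Rightarrow> bool" where
  "is_fourier f F \<longleftrightarrow> square_integrable F \<and>
     ((\<lambda>R. \<integral>\<^sup>+\<xi>. ennreal ((cmod (truncated_fourier R f \<xi> - F \<xi>))\<^sup>2) \<partial>lborel) \<longlongrightarrow> 0) at_top"

definition fourier :: "(real \<Rightarrow> complex) \<Rightarrow> real \<Rightarrow> complex" where
  "fourier f = (SOME F. is_fourier f F)"

text \<open>The Sobolev space $H^s$ for $s \ge 0$; \<open>sobolev_norm s f\<close> is meaningful only if \<open>f \<in> sobolev s\<close>.\<close>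

definition sobolev :: "real \<Rightarrow> (real \<Rightarrow> complex) set" where
  "sobolev s = {f. square_integrable f \<and>
     integrable lborel (\<lambda>\<xi>. (1 + \<xi>\<^sup>2) powr s * (cmod (fourier f \<xi>))\<^sup>2)}"

definition sobolev_norm :: "real \<Rightarrow> (real \<Rightarrow> complex) \<Rightarrow> real" where
  "sobolev_norm s f = sqrt (LINT \<xi>|lborel. (1 + \<xi>\<^sup>2) powr s * (cmod (fourier f \<xi>))\<^sup>2)"

definition fourier_multiplier :: "(real \<Rightarrow> complex) \<Rightarrow> (real \<Rightarrow> complex) \<Rightarrow> real \<Rightarrow> complex" where
  "fourier_multiplier m f =
     (SOME g. square_integrable g \<and> (AE \<xi> in lborel. fourier g \<xi> = m \<xi> * fourier f \<xi>))"

text \<open>The Riemann integral over $[a,b]$ of an $H^s$-valued function, as a limit in the $H^s$ norm.\<close>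

definition has_sobolev_integral ::
    "real \<Rightarrow> (real \<Rightarrow> real \<Rightarrow> complex) \<Rightarrow> (real \<Rightarrow> complex) \<Rightarrow> real \<Rightarrow> real \<Rightarrow> bool" where
  "has_sobolev_integral s f I a b \<longleftrightarrow>
     (\<forall>\<tau>\<in>{a..b}. f \<tau> \<in> sobolev s) \<and> I \<in> sobolev s \<and>
     (\<forall>\<epsilon>>0. \<exists>\<delta>>0. \<forall>p. p tagged_division_of {a..b} \<and> (\<lambda>\<tau>. ball \<tau> \<delta>) fine p \<longrightarrow>
        sobolev_norm s (\<lambda>x. (\<Sum>(\<tau>, k)\<in>p. measure lborel k *\<^sub>R f \<tau> x) - I x) < \<epsilon>)"

text \<open>
  Taking the Fourier transform in $x$ of
  $u_t + u_x + \frac32 u u_x + \nu u_{xxx} - (\frac16 - \nu) u_{xxt} = 0$ and dividing by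
  $(\frac16 - \nu)\xi^2 + 1 > 0$ gives
  $i \hat u_t = \phi(\xi) \hat u + \psi(\xi) \widehat{u^2}$.
\<close>

definition phi :: "real \<Rightarrow> real \<Rightarrow> real" where
  "phi \<nu> \<xi> = \<xi> * (1 - \<nu> * \<xi>\<^sup>2) / ((1/6 - \<nu>) * \<xi>\<^sup>2 + 1)"

definition psi :: "real \<Rightarrow> real \<Rightarrow> real" where
  "psi \<nu> \<xi> = 3 * \<xi> / (4 * ((1/6 - \<nu>) * \<xi>\<^sup>2 + 1))"

definition propagator :: "real \<Rightarrow> real \<Rightarrow> (real \<Rightarrow> complex) \<Rightarrow> real \<Rightarrow> complex" where
  "propagator \<nu> t = fourier_multiplier (\<lambda>\<xi>. exp (- (\<i> * complex_of_real (phi \<nu> \<xi> * t))))"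

definition psi_op :: "real \<Rightarrow> (real \<Rightarrow> complex) \<Rightarrow> real \<Rightarrow> complex" where
  "psi_op \<nu> = fourier_multiplier (\<lambda>\<xi>. complex_of_real (psi \<nu> \<xi>))"

abbreviation cplx :: "(real \<Rightarrow> real) \<Rightarrow> real \<Rightarrow> complex" where
  "cplx f \<equiv> (\<lambda>x. complex_of_real (f x))"

text \<open>
  A curve in $C([0,T];H^s)$ of real-valued functions is \<open>u :: real \<Rightarrow> real \<Rightarrow> real\<close>, with \<open>u t\<close> the
  function of $x$ at time $t$; only its values for $t \in [0,T]$ matter.
\<close>

definition sobolev_curve :: "real \<Rightarrow> real \<Rightarrow> (real \<Rightarrow> real \<Rightarrow> real) \<Rightarrow> bool" where
  "sobolev_curve s T u \<longleftrightarrow>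
     (\<forall>t\<in>{0..T}. cplx (u t) \<in> sobolev s) \<and>
     (\<forall>t\<in>{0..T}. ((\<lambda>\<tau>. sobolev_norm s (cplx (\<lambda>x. u \<tau> x - u t x))) \<longlongrightarrow> 0) (at t within {0..T}))"

text \<open>Solutions of the initial value problem, in the sense of Duhamel's formula.\<close>

definition ivp_solution ::
    "real \<Rightarrow> real \<Rightarrow> real \<Rightarrow> (real \<Rightarrow> real) \<Rightarrow> (real \<Rightarrow> real \<Rightarrow> real) \<Rightarrow> bool" where
  "ivp_solution \<nu> s T u0 u \<longleftrightarrow> sobolev_curve s T u \<and>
     (\<forall>t\<in>{0..T}. \<exists>I.
        has_sobolev_integral s (\<lambda>\<tau>. propagator \<nu> (t - \<tau>) (psi_op \<nu> (cplx (\<lambda>x. (u \<tau> x)\<^sup>2)))) I 0 t \<and>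
        (AE x in lborel. complex_of_real (u t x) = propagator \<nu> t (cplx u0) x - \<i> * I x))"

end

theory Submission
  imports Defs "HOL-Probability.Characteristic_Functions" "HOL-Probability.Sinc_Integral"
begin

text \<open>
  Local well-posedness holds because, seen in $H^s$, the equation is an ordinary differential equation
  with a locally Lipschitz right-hand side. The dispersion symbol \<open>phi\<close> is real, so the linear
  evolution $S(t)$ consists of isometries of $H^s$, and the symbol \<open>psi\<close> is bounded since
  $(\frac16-\nu)\xi^2 + 1$ grows quadratically. As $H^s$ is an algebra for $s \ge 1$
  (\<open>sobolev_algebra\<close>), the quadratic term $N(u) = \psi(\partial_x)u^2$ satisfies
  $\|N(u)-N(v)\| \le K(\|u\|+\|v\|)\|u-v\|$. In the interaction picture $w(t) = S(-t)u(t)$ Duhamel's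
  formula reads $w(t) = u_0 + \int_0^t f(\tau,w(\tau))\,d\tau$ with a field $f$ that obeys the same
  estimate. Banach's fixed point theorem gives a solution on a time interval of length
  $1/(8K\rho)$ for all data of norm at most $\rho$; Gronwall's inequality gives uniqueness among all
  continuous curves and Lipschitz dependence on the data. Choosing $\rho = \|u_0\| + 1$ makes the
  lifespan common to all data in the unit ball around $u_0$.

  To run this argument in a Banach space, $f \in H^s$ is identified with the class of
  $(1+\xi^2)^{s/2}\hat f(\xi)$ in the Hilbert space \<open>l2\<close> of square integrable functions modulo
  null sets (\<open>sobolev_l2\<close>). That this is an isometric bijection is Plancherel's theorem. For bounded
  integrable $f$ the energy of $\hat f$ against a Gaussian equals an average of the autocorrelation
  of $f$ against the dual Gaussian (\<open>Gauss_weighted_energy\<close>), and letting the Gaussian spread out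
  turns the average into the value at $0$, which is $\|f\|^2$ (\<open>Plancherel_bounded\<close>). Truncation extends
  the isometry to all of $L^2$. Surjectivity comes for free: the adjoint of the transform is the
  conjugate transform, which is an isometry too, and an isometry with isometric adjoint is
  onto (\<open>fourier_ifourier\<close>).

  The algebra property follows on the Fourier side. A product is transformed into a convolution, the
  weight $\langle\xi\rangle^s = (1+\xi^2)^{s/2}$ satisfies
  $\langle\zeta\rangle^s \le 2^s(\langle\zeta-\eta\rangle^s + \langle\eta\rangle^s)$,
  and Young's inequality $L^2 * L^1 \subseteq L^2$ applies because $\hat f \in L^1$ for $f \in H^s$.

  Solutions have to be real-valued. Complex conjugation of functions becomes
  $U(\xi) \mapsto \overline{U(-\xi)}$, and this operation maps solutions to solutions; so by uniqueness
  the solution with real data is fixed by it.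
\<close>

section \<open>Square integrable functions modulo null sets\<close>

lemma square_integrableI_bound:
  assumes "f \<in> borel_measurable lborel" "integrable lborel g"
    "\<And>x. (cmod (f x))\<^sup>2 \<le> g x"
  shows "square_integrable f"
  unfolding square_integrable_def
proof
  show "integrable lborel (\<lambda>x. (cmod (f x))\<^sup>2)"
    using assms(1) by (intro Bochner_Integration.integrable_bound[OF assms(2)])
      (auto intro!: AE_I2 order_trans[OF assms(3)])
qed (fact assms(1))

lemma square_integrableD [measurable_dest]:
  "square_integrable f \<Longrightarrow> f \<in> borel_measurable borel"
  by (simp add: square_integrable_def)

lemma square_integrable_integrable:
  "square_integrable f \<Longrightarrow> integrable lborel (\<lambda>x. (cmod (f x))\<^sup>2)"
  by (simp add: square_integrable_def)

lemma square_integrable_iff_nn: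
  "square_integrable f \<longleftrightarrow>
     f \<in> borel_measurable borel \<and> (\<integral>\<^sup>+x. ennreal ((cmod (f x))\<^sup>2) \<partial>lborel) < \<infinity>"
  unfolding square_integrable_def by (auto simp: integrable_iff_bounded)

lemma square_integrable_zero [simp]: "square_integrable (\<lambda>x. 0)"
  by (simp add: square_integrable_def)

lemma square_integrable_add:
  assumes "square_integrable f" "square_integrable g"
  shows "square_integrable (\<lambda>x. f x + g x)"
proof (rule square_integrableI_bound)
  show "integrable lborel (\<lambda>x. 2 * (cmod (f x))\<^sup>2 + 2 * (cmod (g x))\<^sup>2)"
    using assms by (auto simp: square_integrable_def)
  show "(cmod (f x + g x))\<^sup>2 \<le> 2 * (cmod (f x))\<^sup>2 + 2 * (cmod (g x))\<^sup>2" for x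
  proof -
    have "(cmod (f x + g x))\<^sup>2 \<le> (cmod (f x) + cmod (g x))\<^sup>2"
      by (intro power_mono norm_triangle_ineq) auto
    also have "\<dots> \<le> 2 * (cmod (f x))\<^sup>2 + 2 * (cmod (g x))\<^sup>2"
      using zero_le_power2[of "cmod (f x) - cmod (g x)"] by (simp add: power2_eq_square algebra_simps)
    finally show ?thesis .
  qed
qed (use assms in measurable)

lemma square_integrable_mult_bounded:
  assumes "square_integrable f" "m \<in> borel_measurable borel" "\<And>x. cmod (m x) \<le> C"
  shows "square_integrable (\<lambda>x. m x * f x)"
proof (rule square_integrableI_bound)
  show "integrable lborel (\<lambda>x. C\<^sup>2 * (cmod (f x))\<^sup>2)"
    using assms by (auto simp: square_integrable_def)
  show "(cmod (m x * f x))\<^sup>2 \<le> C\<^sup>2 * (cmod (f x))\<^sup>2" for x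
    using assms(3)[of x] by (auto simp: norm_mult power_mult_distrib intro!: mult_right_mono power_mono)
qed (use assms in measurable)

lemma square_integrable_cmult:
  "square_integrable f \<Longrightarrow> square_integrable (\<lambda>x. c * f x)" for c :: complex
  by (rule square_integrable_mult_bounded[where C = "cmod c"]) auto

lemma square_integrable_scaleR:
  "square_integrable f \<Longrightarrow> square_integrable (\<lambda>x. c *\<^sub>R f x)"
  using square_integrable_cmult[of f "complex_of_real c"] by (simp add: scaleR_conv_of_real)

lemma square_integrable_uminus:
  "square_integrable f \<Longrightarrow> square_integrable (\<lambda>x. - f x)"
  using square_integrable_cmult[of f "-1"] by simp

lemma square_integrable_diff:
  "square_integrable f \<Longrightarrow> square_integrable g \<Longrightarrow> square_integrable (\<lambda>x. f x - g x)"
  using square_integrable_add[OF _ square_integrable_uminus, of f g] by simp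

lemma borel_measurable_cnj [measurable]: "cnj \<in> borel_measurable borel"
  by (intro borel_measurable_continuous_onI continuous_intros)

lemma square_integrable_cnj:
  "square_integrable f \<Longrightarrow> square_integrable (\<lambda>x. cnj (f x))"
  unfolding square_integrable_def by auto

lemma square_integrable_reflect:
  assumes "square_integrable f"
  shows "square_integrable (\<lambda>x. f (- x))"
proof -
  have "integrable lborel (\<lambda>x. (cmod (f (0 + (-1) * x)))\<^sup>2)"
    using assms by (intro lborel_integrable_real_affine) (auto simp: square_integrable_def)
  then show ?thesis
    using assms unfolding square_integrable_def by auto
qed

lemma square_integrable_cong_AE:
  assumes "square_integrable f" "g \<in> borel_measurable borel" "AE x in lborel. f x = g x"
  shows "square_integrable g"
proof -
  have "integrable lborel (\<lambda>x. (cmod (g x))\<^sup>2) = integrable lborel (\<lambda>x. (cmod (f x))\<^sup>2)"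
    using assms by (intro integrable_cong_AE) auto
  then show ?thesis
    using assms by (simp add: square_integrable_def)
qed

lemma integrable_mult_square_integrable:
  assumes "square_integrable f" "square_integrable g"
  shows "integrable lborel (\<lambda>x. f x * g x)"
proof (rule Bochner_Integration.integrable_bound)
  show "integrable lborel (\<lambda>x. (cmod (f x))\<^sup>2 + (cmod (g x))\<^sup>2)"
    using assms by (auto simp: square_integrable_def)
  show "AE x in lborel. norm (f x * g x) \<le> norm ((cmod (f x))\<^sup>2 + (cmod (g x))\<^sup>2)"
  proof (rule AE_I2)
    fix x
    have "2 * (cmod (f x) * cmod (g x)) \<le> (cmod (f x))\<^sup>2 + (cmod (g x))\<^sup>2"
      using zero_le_power2[of "cmod (f x) - cmod (g x)"] by (simp add: power2_eq_square algebra_simps)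
    moreover have "0 \<le> cmod (f x) * cmod (g x)" by simp
    ultimately show "norm (f x * g x) \<le> norm ((cmod (f x))\<^sup>2 + (cmod (g x))\<^sup>2)"
      unfolding norm_mult real_norm_def by simp (smt (verit) mult_nonneg_nonneg norm_ge_zero)
  qed
qed (use assms in measurable)

lemma inner_complex_Re: "inner z w = Re (z * cnj w)" for z w :: complex
  by (simp add: inner_complex_def)

lemma integrable_inner_square_integrable:
  assumes "square_integrable f" "square_integrable g"
  shows "integrable lborel (\<lambda>x. inner (f x) (g x))"
  unfolding inner_complex_Re
  by (intro integrable_Re integrable_mult_square_integrable square_integrable_cnj assms)

text \<open>
  The relation is reflexive only on square integrable functions, so that its quotient is exactly
  $L^2(\mathbb{R})$.
\<close>
definition l2_eq :: "(real \<Rightarrow> complex) \<Rightarrow> (real \<Rightarrow> complex) \<Rightarrow> bool" where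
  "l2_eq f g \<longleftrightarrow> square_integrable f \<and> square_integrable g \<and> (AE x in lborel. f x = g x)"

quotient_type l2 = "real \<Rightarrow> complex" / partial: l2_eq
  morphisms rep_l2 L2
proof (rule part_equivpI)
  show "\<exists>x. l2_eq x x"
    by (rule exI[of _ "\<lambda>_. 0"]) (simp add: l2_eq_def)
  show "symp l2_eq"
    by (auto simp: symp_def l2_eq_def)
  show "transp l2_eq"
  proof (rule transpI)
    fix f g h assume "l2_eq f g" "l2_eq g h"
    then show "l2_eq f h"
      unfolding l2_eq_def by (auto elim: eventually_elim2)
  qed
qed

instantiation l2 :: real_inner
begin

lift_definition zero_l2 :: l2 is "\<lambda>x. 0"
  by (simp add: l2_eq_def)

lift_definition plus_l2 :: "l2 \<Rightarrow> l2 \<Rightarrow> l2" is "\<lambda>f g x. f x + g x"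
  unfolding l2_eq_def by (auto intro: square_integrable_add elim: eventually_elim2)

lift_definition minus_l2 :: "l2 \<Rightarrow> l2 \<Rightarrow> l2" is "\<lambda>f g x. f x - g x"
  unfolding l2_eq_def by (auto intro: square_integrable_diff elim: eventually_elim2)

lift_definition uminus_l2 :: "l2 \<Rightarrow> l2" is "\<lambda>f x. - f x"
  unfolding l2_eq_def by (auto intro: square_integrable_uminus)

lift_definition scaleR_l2 :: "real \<Rightarrow> l2 \<Rightarrow> l2" is "\<lambda>c f x. c *\<^sub>R f x"
  unfolding l2_eq_def by (auto intro: square_integrable_scaleR)

lift_definition inner_l2 :: "l2 \<Rightarrow> l2 \<Rightarrow> real" is "\<lambda>f g. LINT x|lborel. inner (f x) (g x)"
proof -
  fix f f' g g' assume "l2_eq f f'" "l2_eq g g'"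
  then have [measurable]: "f \<in> borel_measurable borel" "g \<in> borel_measurable borel"
      "f' \<in> borel_measurable borel" "g' \<in> borel_measurable borel"
    and "AE x in lborel. f x = f' x" "AE x in lborel. g x = g' x"
    by (auto simp: l2_eq_def square_integrable_def)
  then show "(LINT x|lborel. inner (f x) (g x)) = (LINT x|lborel. inner (f' x) (g' x))"
    by (intro integral_cong_AE) (auto elim: eventually_elim2)
qed

definition norm_l2 :: "l2 \<Rightarrow> real" where "norm_l2 x = sqrt (inner x x)"
definition dist_l2 :: "l2 \<Rightarrow> l2 \<Rightarrow> real" where "dist_l2 x y = norm (x - y)"
definition sgn_l2 :: "l2 \<Rightarrow> l2" where "sgn_l2 x = scaleR (inverse (norm x)) x"
definition uniformity_l2 :: "(l2 \<times> l2) filter" where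
  "uniformity_l2 = (INF e\<in>{0<..}. principal {(x, y). dist x y < e})"
definition open_l2 :: "l2 set \<Rightarrow> bool" where
  "open_l2 U = (\<forall>x\<in>U. eventually (\<lambda>(x', y). x' = x \<longrightarrow> y \<in> U) uniformity)"

instance
proof
  fix x y z :: l2 and a b :: real
  show "x + y + z = x + (y + z)"
    by transfer (simp add: l2_eq_def square_integrable_add ac_simps)
  show "x + y = y + x"
    by transfer (simp add: l2_eq_def square_integrable_add ac_simps)
  show "0 + x = x"
    by transfer (simp add: l2_eq_def)
  show "- x + x = 0"
    by transfer (simp add: l2_eq_def)
  show "x - y = x + - y"
    by transfer (simp add: l2_eq_def square_integrable_diff)
  show "a *\<^sub>R (x + y) = a *\<^sub>R x + a *\<^sub>R y"
    by transfer (simp add: l2_eq_def square_integrable_add square_integrable_scaleR algebra_simps del: scaleR_conv_of_real)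
  show "(a + b) *\<^sub>R x = a *\<^sub>R x + b *\<^sub>R x"
    by transfer (simp add: l2_eq_def square_integrable_add square_integrable_scaleR scaleR_left_distrib)
  show "a *\<^sub>R b *\<^sub>R x = (a * b) *\<^sub>R x"
    by transfer (simp add: l2_eq_def square_integrable_scaleR)
  show "1 *\<^sub>R x = x"
    by transfer (simp add: l2_eq_def square_integrable_scaleR)
  show "inner x y = inner y x"
    by transfer (simp add: inner_commute)
  show "inner (x + y) z = inner x z + inner y z"
    by transfer (simp add: l2_eq_def inner_add_left integrable_inner_square_integrable)
  show "inner (a *\<^sub>R x) y = a * inner x y"
    by transfer simp
  show "0 \<le> inner x x"
    by transfer simp
  show "inner x x = 0 \<longleftrightarrow> x = 0"
  proof transfer
    fix f assume "l2_eq f f"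
    then have "square_integrable f" by (simp add: l2_eq_def)
    then have "(LINT x|lborel. inner (f x) (f x)) = 0 \<longleftrightarrow> (AE x in lborel. inner (f x) (f x) = 0)"
      by (intro integral_nonneg_eq_0_iff_AE integrable_inner_square_integrable) auto
    then show "(LINT x|lborel. inner (f x) (f x)) = 0 \<longleftrightarrow> l2_eq f (\<lambda>x. 0)"
      using \<open>square_integrable f\<close> by (simp add: l2_eq_def)
  qed
qed (simp_all add: dist_l2_def sgn_l2_def uniformity_l2_def open_l2_def norm_l2_def)

end

lemma L2_exhaust: obtains f where "square_integrable f" "x = L2 f"
proof -
  have "l2_eq (rep_l2 x) (rep_l2 x)" using Quotient3_rep_reflp[OF Quotient3_l2] .
  moreover have "L2 (rep_l2 x) = x" by (rule Quotient3_abs_rep[OF Quotient3_l2])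
  ultimately show ?thesis using that by (metis l2_eq_def)
qed

lemma L2_eq_iff:
  "square_integrable f \<Longrightarrow> square_integrable g \<Longrightarrow> L2 f = L2 g \<longleftrightarrow> (AE x in lborel. f x = g x)"
  using Quotient3_rel[OF Quotient3_l2, of f g] by (auto simp: l2_eq_def)

lemma L2_add: "square_integrable f \<Longrightarrow> square_integrable g \<Longrightarrow> L2 (\<lambda>x. f x + g x) = L2 f + L2 g"
  by (simp add: plus_l2.abs_eq l2_eq_def)

lemma L2_diff: "square_integrable f \<Longrightarrow> square_integrable g \<Longrightarrow> L2 (\<lambda>x. f x - g x) = L2 f - L2 g"
  by (simp add: minus_l2.abs_eq l2_eq_def)

lemma L2_zero: "L2 (\<lambda>x. 0) = 0"
  by (simp add: zero_l2_def)

lemma L2_scaleR: "square_integrable f \<Longrightarrow> L2 (\<lambda>x. c *\<^sub>R f x) = c *\<^sub>R L2 f"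
  by (simp add: scaleR_l2.abs_eq l2_eq_def)

lemma L2_inner: "square_integrable f \<Longrightarrow> square_integrable g \<Longrightarrow>
    inner (L2 f) (L2 g) = (LINT x|lborel. inner (f x) (g x))"
  by (simp add: inner_l2.abs_eq l2_eq_def)

lemma L2_norm_squared:
  "square_integrable f \<Longrightarrow> (norm (L2 f))\<^sup>2 = (LINT x|lborel. (cmod (f x))\<^sup>2)"
  by (simp add: power2_norm_eq_inner L2_inner)

lemma L2_norm_nn:
  assumes "square_integrable f"
  shows "(\<integral>\<^sup>+x. ennreal ((cmod (f x))\<^sup>2) \<partial>lborel) = ennreal ((norm (L2 f))\<^sup>2)"
  unfolding L2_norm_squared[OF assms]
  using assms by (intro nn_integral_eq_integral) (auto simp: square_integrable_def)

lemma L2_norm_mono: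
  assumes "square_integrable f" "square_integrable g" "0 \<le> c" "\<And>x. cmod (f x) \<le> c * cmod (g x)"
  shows "norm (L2 f) \<le> c * norm (L2 g)"
proof -
  have "(norm (L2 f))\<^sup>2 \<le> (LINT x|lborel. c\<^sup>2 * (cmod (g x))\<^sup>2)"
    unfolding L2_norm_squared[OF assms(1)]
    using assms power_mono[OF assms(4), of _ 2]
    by (intro integral_mono) (auto simp: square_integrable_def power_mult_distrib)
  also have "\<dots> = (c * norm (L2 g))\<^sup>2"
    by (simp add: power_mult_distrib L2_norm_squared assms)
  finally show ?thesis
    by (rule power2_le_imp_le) (use assms in auto)
qed

lemma L2_cong_AE:
  assumes "square_integrable f" "square_integrable g" "AE x in lborel. f x = g x"
  shows "L2 f = L2 g"
  using L2_eq_iff assms by blast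

text \<open>
  Fatou's lemma in the form that is used throughout: closed balls of \<open>l2\<close> are stable under pointwise
  limits. The limit is a function rather than a class because pointwise limits identify it.
\<close>
lemma L2_tendsto_AE_Fatou:
  assumes sq: "\<And>n. square_integrable (f n)" "square_integrable h"
    and g [measurable]: "g \<in> borel_measurable borel"
    and lim: "AE x in lborel. (\<lambda>n. f n x) \<longlonglongrightarrow> g x"
    and bound: "\<And>n::nat. n \<ge> N \<Longrightarrow> norm (L2 (f n) - L2 h) \<le> e"
  shows "square_integrable g" "norm (L2 g - L2 h) \<le> e"
proof -
  note sq[measurable]
  have e: "0 \<le> e" using bound[of N] norm_ge_zero[of "L2 (f N) - L2 h"] by linarith
  have "(\<integral>\<^sup>+x. ennreal ((cmod (g x - h x))\<^sup>2) \<partial>lborel)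
      = (\<integral>\<^sup>+x. liminf (\<lambda>n. ennreal ((cmod (f n x - h x))\<^sup>2)) \<partial>lborel)"
  proof (rule nn_integral_cong_AE, use lim in eventually_elim)
    fix x assume "(\<lambda>n. f n x) \<longlonglongrightarrow> g x"
    then have "(\<lambda>n. ennreal ((cmod (f n x - h x))\<^sup>2)) \<longlonglongrightarrow> ennreal ((cmod (g x - h x))\<^sup>2)"
      by (intro tendsto_intros)
    then show "ennreal ((cmod (g x - h x))\<^sup>2) = liminf (\<lambda>n. ennreal ((cmod (f n x - h x))\<^sup>2))"
      by (rule lim_imp_Liminf[OF trivial_limit_sequentially, symmetric])
  qed
  also have "\<dots> \<le> liminf (\<lambda>n. \<integral>\<^sup>+x. ennreal ((cmod (f n x - h x))\<^sup>2) \<partial>lborel)"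
    by (intro nn_integral_liminf) auto
  also have "\<dots> \<le> ennreal (e\<^sup>2)"
  proof (rule Liminf_le)
    show "eventually (\<lambda>n. (\<integral>\<^sup>+x. ennreal ((cmod (f n x - h x))\<^sup>2) \<partial>lborel) \<le> ennreal (e\<^sup>2)) sequentially"
      unfolding eventually_sequentially
    proof (intro exI allI impI)
      fix n assume "N \<le> n"
      have "(\<integral>\<^sup>+x. ennreal ((cmod (f n x - h x))\<^sup>2) \<partial>lborel) = ennreal ((norm (L2 (f n) - L2 h))\<^sup>2)"
        by (subst L2_norm_nn) (auto simp: sq square_integrable_diff L2_diff)
      also have "\<dots> \<le> ennreal (e\<^sup>2)"
        by (intro ennreal_leI power_mono bound \<open>N \<le> n\<close>) auto
      finally show "(\<integral>\<^sup>+x. ennreal ((cmod (f n x - h x))\<^sup>2) \<partial>lborel) \<le> ennreal (e\<^sup>2)" .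
    qed
  qed auto
  finally have le: "(\<integral>\<^sup>+x. ennreal ((cmod (g x - h x))\<^sup>2) \<partial>lborel) \<le> ennreal (e\<^sup>2)" .
  then have d: "square_integrable (\<lambda>x. g x - h x)"
    unfolding square_integrable_iff_nn by (auto intro: le_less_trans)
  from square_integrable_add[OF d sq(2)] show sg: "square_integrable g" by simp
  have "(norm (L2 g - L2 h))\<^sup>2 \<le> e\<^sup>2"
    using le L2_norm_nn[OF d] by (simp add: L2_diff sg sq)
  then show "norm (L2 g - L2 h) \<le> e"
    using e by (rule power2_le_imp_le)
qed

text \<open>
  Both kinds of limit see the same function. This identifies abstractly obtained \<open>l2\<close> limits with
  explicit integrals.
\<close>
lemma L2_limit_pointwise_limit:
  assumes "\<And>n::nat. square_integrable (f n)" "square_integrable h" "g \<in> borel_measurable borel"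
    and lim: "AE x in lborel. (\<lambda>n. f n x) \<longlonglongrightarrow> g x"
    and L2: "(\<lambda>n. L2 (f n)) \<longlonglongrightarrow> L2 h"
  shows "square_integrable g" "L2 g = L2 h"
proof -
  have bd: "\<exists>N. \<forall>n\<ge>N. norm (L2 (f n) - L2 h) \<le> e" if "e > 0" for e
    using L2[THEN LIMSEQ_D, OF that] by (meson less_imp_le)
  then obtain N where "\<forall>n\<ge>N. norm (L2 (f n) - L2 h) \<le> 1" by (meson zero_less_one)
  then show sg: "square_integrable g"
    using L2_tendsto_AE_Fatou(1)[OF assms(1-4), of N 1] by blast
  have "norm (L2 g - L2 h) \<le> e" if e: "e > 0" for e
  proof -
    obtain N where "\<forall>n\<ge>N. norm (L2 (f n) - L2 h) \<le> e" using bd[OF e] by blast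
    then show ?thesis using L2_tendsto_AE_Fatou(2)[OF assms(1-4), of N e] by blast
  qed
  then have "norm (L2 g - L2 h) \<le> 0"
    by (metis field_le_epsilon add_0)
  then show "L2 g = L2 h" by simp
qed

text \<open>
  The pointwise half of the Riesz--Fischer theorem. With $d_n = |f_{n+1}-f_n|^2$ the function
  $\sum_n 2^n d_n$ has finite integral, hence is finite almost everywhere, and there the increments
  decay geometrically.
\<close>
lemma L2_rapidly_Cauchy_AE_convergent:
  assumes sq: "\<And>n. square_integrable (f n)"
    and rapid: "\<And>n. norm (L2 (f (Suc n)) - L2 (f n)) \<le> (1/2) ^ n"
  shows "AE x in lborel. convergent (\<lambda>n. f n x)"
proof -
  note sq[measurable]
  define d where "d n x = (cmod (f (Suc n) x - f n x))\<^sup>2" for n x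
  have [measurable]: "d n \<in> borel_measurable borel" for n unfolding d_def by measurable
  have "(\<integral>\<^sup>+x. (\<Sum>n. ennreal (2 ^ n * d n x)) \<partial>lborel) = (\<Sum>n. \<integral>\<^sup>+x. ennreal (2 ^ n * d n x) \<partial>lborel)"
    by (intro nn_integral_suminf) auto
  also have "\<dots> \<le> (\<Sum>n. ennreal ((1/2) ^ n))"
  proof (intro suminf_le summableI)
    fix n
    have "(\<integral>\<^sup>+x. ennreal (2 ^ n * d n x) \<partial>lborel) = ennreal (2 ^ n) * (\<integral>\<^sup>+x. ennreal (d n x) \<partial>lborel)"
      by (subst nn_integral_cmult[symmetric]) (auto simp: ennreal_mult d_def)
    also have "(\<integral>\<^sup>+x. ennreal (d n x) \<partial>lborel) = ennreal ((norm (L2 (f (Suc n)) - L2 (f n)))\<^sup>2)"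
      unfolding d_def by (subst L2_norm_nn) (auto simp: sq square_integrable_diff L2_diff)
    also have "ennreal (2 ^ n) * \<dots> \<le> ennreal (2 ^ n) * ennreal (((1/2) ^ n)\<^sup>2)"
      by (intro mult_left_mono ennreal_leI power_mono rapid) auto
    also have "\<dots> = ennreal ((1/2) ^ n)"
      by (subst ennreal_mult[symmetric]) (auto simp: power_divide power2_eq_square)
    finally show "(\<integral>\<^sup>+x. ennreal (2 ^ n * d n x) \<partial>lborel) \<le> ennreal ((1/2) ^ n)" .
  qed
  also have "\<dots> = ennreal (\<Sum>n. (1/2) ^ n)"
    by (intro suminf_ennreal2 summable_geometric) auto
  finally have "(\<integral>\<^sup>+x. (\<Sum>n. ennreal (2 ^ n * d n x)) \<partial>lborel) < \<infinity>"
    by (auto intro: le_less_trans)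
  then have "AE x in lborel. (\<Sum>n. ennreal (2 ^ n * d n x)) \<noteq> \<infinity>"
    by (intro nn_integral_PInf_AE) auto
  then show ?thesis
  proof eventually_elim
    fix x assume fin: "(\<Sum>n. ennreal (2 ^ n * d n x)) \<noteq> \<infinity>"
    have s: "summable (\<lambda>n. 2 ^ n * d n x)"
      using fin by (intro summable_suminf_not_top) (auto simp: d_def)
    have "Bseq (\<lambda>n. 2 ^ n * d n x)"
      using summable_LIMSEQ_zero[OF s] convergent_imp_Bseq convergentI by blast
    then obtain C where C: "C > 0" "\<And>n. norm (2 ^ n * d n x) \<le> C"
      unfolding Bseq_def by blast
    have bd: "cmod (f (Suc n) x - f n x) \<le> sqrt C * (sqrt (1/2)) ^ n" for n
    proof (rule power2_le_imp_le)
      have "2 ^ n * d n x \<le> C" using C(2)[of n] by (simp add: d_def)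
      then have "d n x \<le> C * (1/2) ^ n"
        by (simp add: power_one_over field_simps)
      also have "\<dots> = (sqrt C * (sqrt (1/2)) ^ n)\<^sup>2"
        using C(1) by (simp add: power_mult_distrib power_even_eq[symmetric] power_mult[symmetric] mult.commute[of n])
          (simp add: power_mult)
      finally show "(cmod (f (Suc n) x - f n x))\<^sup>2 \<le> (sqrt C * (sqrt (1/2)) ^ n)\<^sup>2"
        by (simp add: d_def)
    qed (use C in auto)
    have "summable (\<lambda>n. sqrt C * (sqrt (1/2)) ^ n)"
      by (intro summable_mult summable_geometric) (auto simp: real_sqrt_lt_1_iff)
    then have "summable (\<lambda>n. f (Suc n) x - f n x)"
      by (rule summable_comparison_test') (use bd in auto)
    then show "convergent (\<lambda>n. f n x)"
      using convergent_diff_const_right_iff[of "\<lambda>n. f n x" "f 0 x"]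
        sum_lessThan_telescope[of "\<lambda>n. f n x"]
      by (simp add: summable_iff_convergent)
  qed
qed

text \<open>
  Riesz--Fischer: a rapidly converging subsequence has a pointwise limit, which is its limit in norm
  by \<open>L2_tendsto_AE_Fatou\<close>.
\<close>
instance l2 :: banach
proof
  fix X :: "nat \<Rightarrow> l2" assume X: "Cauchy X"
  have "\<exists>r. strict_mono r \<and> (\<forall>n. \<forall>m\<ge>r n. norm (X m - X (r n)) \<le> (1/2) ^ n)"
  proof -
    have ex: "\<exists>k. \<forall>m\<ge>k. \<forall>n\<ge>k. norm (X m - X n) \<le> (1/2) ^ j" for j
      using CauchyD[OF X, of "(1/2) ^ j"] by (meson less_imp_le zero_less_power half_gt_zero zero_less_one)
    then obtain N where N: "\<And>j m n. m \<ge> N j \<Longrightarrow> n \<ge> N j \<Longrightarrow> norm (X m - X n) \<le> (1/2) ^ j"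
      by metis
    \<comment> \<open>a strictly increasing choice of indices beyond the given bounds\<close>
    define r where "r = rec_nat (N 0) (\<lambda>j q. max (Suc q) (N (Suc j)))"
    have "strict_mono r"
      by (rule strict_monoI_Suc) (auto simp: r_def)
    moreover have "r j \<ge> N j" for j by (cases j) (auto simp: r_def)
    ultimately show ?thesis using N by (meson order_trans)
  qed
  then obtain r where r: "strict_mono r" "\<And>n m. m \<ge> r n \<Longrightarrow> norm (X m - X (r n)) \<le> (1/2) ^ n"
    by blast
  have "\<exists>f. square_integrable f \<and> X (r n) = L2 f" for n
    by (metis L2_exhaust)
  then obtain f where sq: "\<And>n. square_integrable (f n)" and f: "\<And>n. X (r n) = L2 (f n)"
    by metis
  note sq[measurable]
  have close: "norm (L2 (f m) - L2 (f n)) \<le> (1/2) ^ n" if "m \<ge> n" for m n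
    using r(2)[of n "r m"] that strict_mono_less_eq[OF r(1)] by (simp add: f)
  have convolution: "AE x in lborel. convergent (\<lambda>n. f n x)"
    by (rule L2_rapidly_Cauchy_AE_convergent[OF sq]) (use close in simp)
  define g where "g x = lim (\<lambda>n. f n x)" for x
  have g [measurable]: "g \<in> borel_measurable borel"
    unfolding g_def by (rule borel_measurable_lim_metric) measurable
  have lim: "AE x in lborel. (\<lambda>n. f n x) \<longlonglongrightarrow> g x"
    using convolution by eventually_elim (simp add: g_def convergent_LIMSEQ_iff)
  have "norm (X (r n) - L2 g) \<le> (1/2) ^ n" for n
    using L2_tendsto_AE_Fatou(2)[OF sq sq g lim, of n n "(1/2)^n"] close
    by (simp add: f norm_minus_commute)
  then have "(\<lambda>n. X (r n)) \<longlonglongrightarrow> L2 g"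
    by (intro LIM_zero_cancel[OF Lim_null_comparison[OF always_eventually LIMSEQ_power_zero[of "1/2"]]]) auto
  then have "X \<longlonglongrightarrow> L2 g"
    using Cauchy_converges_subseq[OF X r(1)] by (simp add: o_def)
  then show "convergent X" by (rule convergentI)
qed

section \<open>Fourier integrals, convolutions and translations\<close>

text \<open>
  The absolutely convergent Fourier integral, meaningful for integrable functions.
\<close>
definition ft :: "(real \<Rightarrow> complex) \<Rightarrow> real \<Rightarrow> complex" where
  "ft f \<xi> = complex_of_real (1 / sqrt (2 * pi)) * (LINT x|lborel. f x * cis (- (\<xi> * x)))"

definition convolution :: "(real \<Rightarrow> complex) \<Rightarrow> (real \<Rightarrow> complex) \<Rightarrow> real \<Rightarrow> complex" where
  "convolution f g x = (LINT y|lborel. f (x - y) * g y)"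

lemma cis_measurable [measurable]: "cis \<in> borel_measurable borel"
  by (intro borel_measurable_continuous_onI continuous_intros)

lemma integrable_mult_cis:
  assumes "integrable lborel f" "p \<in> borel_measurable borel"
  shows "integrable lborel (\<lambda>x. f x * cis (p x))"
  by (rule Bochner_Integration.integrable_bound[OF assms(1)])
    (use assms in \<open>auto simp: norm_mult\<close>)

lemma ft_measurable [measurable]:
  assumes [measurable]: "f \<in> borel_measurable borel"
  shows "ft f \<in> borel_measurable borel"
  unfolding ft_def by measurable

lemma convolution_measurable [measurable]:
  assumes [measurable]: "f \<in> borel_measurable borel" "g \<in> borel_measurable borel"
  shows "convolution f g \<in> borel_measurable borel"
  unfolding convolution_def by measurable

lemma ft_diff:
  assumes "integrable lborel f" "integrable lborel g"
  shows "ft (\<lambda>x. f x - g x) \<xi> = ft f \<xi> - ft g \<xi>"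
proof -
  have "(LINT x|lborel. (f x - g x) * cis (- (\<xi> * x)))
      = (LINT x|lborel. f x * cis (- (\<xi> * x)) - g x * cis (- (\<xi> * x)))"
    by (simp add: left_diff_distrib)
  also have "\<dots> = (LINT x|lborel. f x * cis (- (\<xi> * x))) - (LINT x|lborel. g x * cis (- (\<xi> * x)))"
    by (intro Bochner_Integration.integral_diff integrable_mult_cis assms) measurable
  finally show ?thesis unfolding ft_def by (simp add: right_diff_distrib)
qed

text \<open>
  Hence the transform of the autocorrelation of a function is, up to a constant, the squared modulus
  of its transform.
\<close>
lemma ft_cnj_reflect: "ft (\<lambda>x. cnj (f (- x))) \<xi> = cnj (ft f \<xi>)"
proof -
  have "cnj (LINT x|lborel. f x * cis (- (\<xi> * x))) = (LINT x|lborel. cnj (f x) * cis (\<xi> * x))"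
    using Bochner_Integration.integral_cnj[of lborel "\<lambda>x. f x * cis (- (\<xi> * x))"] by (simp add: cis_cnj)
  also have "\<dots> = (LINT x|lborel. cnj (f (- x)) * cis (- (\<xi> * x)))"
    by (subst lborel_integral_real_affine[where c = "-1" and t = 0]) auto
  finally show ?thesis unfolding ft_def by simp
qed

lemma ft_tendsto:
  assumes "integrable lborel w" "\<And>n. f n \<in> borel_measurable borel" "g \<in> borel_measurable borel"
    "AE x in lborel. (\<lambda>n::nat. f n x) \<longlonglongrightarrow> g x" "\<And>n. AE x in lborel. cmod (f n x) \<le> w x"
  shows "(\<lambda>n. ft (f n) \<xi>) \<longlonglongrightarrow> ft g \<xi>"
  unfolding ft_def
proof (intro tendsto_mult tendsto_const integral_dominated_convergence[where w = w])
  show "AE x in lborel. (\<lambda>n. f n x * cis (- (\<xi> * x))) \<longlonglongrightarrow> g x * cis (- (\<xi> * x))"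
    using assms(4) by eventually_elim (intro tendsto_intros)
  show "AE x in lborel. norm (f n x * cis (- (\<xi> * x))) \<le> w x" for n
    using assms(5)[of n] by eventually_elim (simp add: norm_mult)
qed (use assms in auto)

lemma integrable_prod_times:
  fixes f g :: "real \<Rightarrow> complex"
  assumes f: "integrable lborel f" and g: "integrable lborel g"
    and k: "case_prod k \<in> borel_measurable (borel \<Otimes>\<^sub>M borel)" "\<And>x y. cmod (k x y) \<le> 1"
  shows "integrable (lborel \<Otimes>\<^sub>M lborel) (\<lambda>(x, y). f x * g y * k x y)"
proof (rule Bochner_Integration.integrable_bound)
  have [measurable]: "f \<in> borel_measurable borel" "g \<in> borel_measurable borel"
    using f g by (auto dest: borel_measurable_integrable)
  note k(1)[measurable]
  show "integrable (lborel \<Otimes>\<^sub>M lborel) (\<lambda>(x, y). f x * g y)"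
  proof (rule lborel_pair.Fubini_integrable)
    have "(LINT y|lborel. norm (case (x, y) of (x, y) \<Rightarrow> f x * g y)) = cmod (f x) * (LINT y|lborel. cmod (g y))" for x
      by (simp add: norm_mult)
    then show "integrable lborel (\<lambda>x. LINT y|lborel. norm (case (x, y) of (x, y) \<Rightarrow> f x * g y))"
      using f by simp
    show "AE x in lborel. integrable lborel (\<lambda>y. case (x, y) of (x, y) \<Rightarrow> f x * g y)"
      using g by simp
  qed measurable
  show "(\<lambda>(x, y). f x * g y * k x y) \<in> borel_measurable (lborel \<Otimes>\<^sub>M lborel)"
    by measurable
  show "AE p in lborel \<Otimes>\<^sub>M lborel. norm (case p of (x, y) \<Rightarrow> f x * g y * k x y)
      \<le> norm (case p of (x, y) \<Rightarrow> f x * g y)"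
    using k(2) by (intro AE_I2) (auto simp: norm_mult intro!: mult_left_le)
qed

text \<open>
  Fubini's theorem for the symmetric kernel $e^{-ix\xi}$. The formula moves a transform from one factor
  to the other; it yields the Gaussian energy identity as well as the adjoint of the transform.
\<close>
lemma ft_multiplication_formula:
  assumes f: "integrable lborel f" and g: "integrable lborel g"
  shows "(LINT \<xi>|lborel. ft f \<xi> * g \<xi>) = (LINT x|lborel. f x * ft g x)"
proof -
  have [measurable]: "f \<in> borel_measurable borel" "g \<in> borel_measurable borel"
    using f g by (auto dest: borel_measurable_integrable)
  let ?c = "complex_of_real (1 / sqrt (2 * pi))"
  have "(LINT \<xi>|lborel. ft f \<xi> * g \<xi>) = ?c * (LINT \<xi>|lborel. LINT x|lborel. f x * g \<xi> * cis (- (\<xi> * x)))"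
    unfolding ft_def by (subst integral_mult_right_zero[symmetric], rule Bochner_Integration.integral_cong)
      (auto simp: mult_ac simp flip: integral_mult_right_zero integral_mult_left_zero)
  also have "(LINT \<xi>|lborel. LINT x|lborel. f x * g \<xi> * cis (- (\<xi> * x)))
      = (LINT x|lborel. LINT \<xi>|lborel. f x * g \<xi> * cis (- (\<xi> * x)))"
    by (rule lborel_pair.Fubini_integral, rule integrable_prod_times[OF f g]) auto
  also have "?c * \<dots> = (LINT x|lborel. f x * ft g x)"
    unfolding ft_def by (subst integral_mult_right_zero[symmetric], rule Bochner_Integration.integral_cong)
      (auto simp: mult_ac simp flip: integral_mult_right_zero integral_mult_left_zero)
  finally show ?thesis .
qed

lemma integrable_convolution_kernel:
  fixes f g :: "real \<Rightarrow> complex"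
  assumes f: "integrable lborel f" and g: "integrable lborel g"
  shows "integrable (lborel \<Otimes>\<^sub>M lborel) (\<lambda>(y, x). f (x - y) * g y :: complex)"
proof -
  have [measurable]: "f \<in> borel_measurable borel" "g \<in> borel_measurable borel"
    using f g by (auto dest: borel_measurable_integrable)
  have sh: "(LINT x|lborel. cmod (f (x - y))) = (LINT x|lborel. cmod (f x))" for y
    using lborel_integral_real_affine[of 1 "\<lambda>x. cmod (f x)" "- y"] by simp
  have shi: "integrable lborel (\<lambda>x. f (x - y))" for y
    using lborel_integrable_real_affine[OF f, of 1 "- y"] by simp
  show ?thesis
  proof (rule lborel_pair.Fubini_integrable)
    have "(LINT x|lborel. norm (case (y, x) of (y, x) \<Rightarrow> f (x - y) * g y))
        = (LINT x|lborel. cmod (f x)) * cmod (g y)" for y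
      by (simp add: norm_mult sh)
    then show "integrable lborel (\<lambda>y. LINT x|lborel. norm (case (y, x) of (y, x) \<Rightarrow> f (x - y) * g y))"
      using g by simp
    show "AE y in lborel. integrable lborel (\<lambda>x. case (y, x) of (y, x) \<Rightarrow> f (x - y) * g y)"
      using shi by simp
  qed measurable
qed

lemma convolution_integrable:
  fixes f g :: "real \<Rightarrow> complex"
  assumes f: "integrable lborel f" and g: "integrable lborel g"
  shows "integrable lborel (convolution f g)"
  using lborel_pair.integrable_snd[OF integrable_convolution_kernel[OF assms]]
  unfolding convolution_def[abs_def] by simp

lemma ft_convolution:
  fixes f g :: "real \<Rightarrow> complex"
  assumes f: "integrable lborel f" and g: "integrable lborel g"
  shows "ft (convolution f g) \<xi> = complex_of_real (sqrt (2 * pi)) * ft f \<xi> * ft g \<xi>"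
proof -
  have [measurable]: "f \<in> borel_measurable borel" "g \<in> borel_measurable borel"
    using f g by (auto dest: borel_measurable_integrable)
  have int: "integrable (lborel \<Otimes>\<^sub>M lborel) (\<lambda>(y, x). f (x - y) * g y * cis (- (\<xi> * x)))"
    by (rule Bochner_Integration.integrable_bound[OF integrable_convolution_kernel[OF assms]])
      (auto simp: norm_mult)
  have "(LINT x|lborel. convolution f g x * cis (- (\<xi> * x)))
      = (LINT x|lborel. LINT y|lborel. f (x - y) * g y * cis (- (\<xi> * x)))"
    unfolding convolution_def by simp
  also have "\<dots> = (LINT y|lborel. LINT x|lborel. f (x - y) * g y * cis (- (\<xi> * x)))"
    by (rule lborel_pair.Fubini_integral[OF int])
  also have "\<dots> = (LINT y|lborel. g y * cis (- (\<xi> * y)) * (LINT x|lborel. f x * cis (- (\<xi> * x))))"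
  proof (rule Bochner_Integration.integral_cong[OF refl])
    fix y
    have "(LINT x|lborel. f (x - y) * g y * cis (- (\<xi> * x)))
        = (LINT x|lborel. f x * g y * cis (- (\<xi> * (x + y))))"
      by (subst lborel_integral_real_affine[where c = 1 and t = y]) (simp_all add: add_ac)
    also have "\<dots> = (LINT x|lborel. (g y * cis (- (\<xi> * y))) * (f x * cis (- (\<xi> * x))))"
      by (intro Bochner_Integration.integral_cong) (auto simp: distrib_left cis_mult mult_ac)
    finally show "(LINT x|lborel. f (x - y) * g y * cis (- (\<xi> * x)))
        = g y * cis (- (\<xi> * y)) * (LINT x|lborel. f x * cis (- (\<xi> * x)))"
      by simp
  qed
  finally have "(LINT x|lborel. convolution f g x * cis (- (\<xi> * x)))
      = (LINT y|lborel. g y * cis (- (\<xi> * y))) * (LINT x|lborel. f x * cis (- (\<xi> * x)))"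
    by simp
  moreover have "complex_of_real (sqrt (2 * pi)) * complex_of_real (1 / sqrt (2 * pi)) = 1"
    by (subst of_real_mult[symmetric]) simp
  ultimately show ?thesis unfolding ft_def by (simp add: mult_ac)
qed

text \<open>
  A Gaussian of width $1/e$ is transformed into one of width $e$; this rescales the characteristic
  function of the standard normal distribution.
\<close>
lemma ft_gauss:
  assumes e: "e > 0"
  shows "ft (\<lambda>\<xi>. complex_of_real (exp (- (e * \<xi>)\<^sup>2 / 2))) x = complex_of_real (exp (- (x / e)\<^sup>2 / 2) / e)"
proof -
  have ch: "(LINT z|lborel. std_normal_density z *\<^sub>R iexp (t * z)) = complex_of_real (exp (- t\<^sup>2 / 2))" for t
    using fun_cong[OF char_std_normal_distribution, of t]
    by (simp add: char_def integral_density)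
  have "(LINT \<xi>|lborel. complex_of_real (exp (- (e * \<xi>)\<^sup>2 / 2)) * cis (- (x * \<xi>)))
      = (1 / e) *\<^sub>R (LINT z|lborel. complex_of_real (exp (- z\<^sup>2 / 2)) * cis ((- x / e) * z))"
    using e by (subst lborel_integral_real_affine[where c = "1 / e" and t = 0]) (auto simp: divide_simps)
  also have "(LINT z|lborel. complex_of_real (exp (- z\<^sup>2 / 2)) * cis ((- x / e) * z))
      = (LINT z|lborel. complex_of_real (sqrt (2 * pi)) * (std_normal_density z *\<^sub>R iexp ((- x / e) * z)))"
    by (intro Bochner_Integration.integral_cong)
      (auto simp: std_normal_density_def scaleR_conv_of_real cis_conv_exp)
  also have "\<dots> = complex_of_real (sqrt (2 * pi)) * complex_of_real (exp (- (- x / e)\<^sup>2 / 2))"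
    by (simp only: integral_mult_right_zero ch)
  finally show ?thesis
    unfolding ft_def by (simp add: scaleR_conv_of_real)
qed

text \<open>
  Continuity at $0$ of $z \mapsto f(\cdot + z)$ in $L^1$, stated along sequences because that is the
  form that dominated convergence delivers and the Gaussian limit consumes.
\<close>
definition translation_continuous :: "(real \<Rightarrow> complex) \<Rightarrow> bool" where
  "translation_continuous f \<longleftrightarrow>
     (\<forall>z. z \<longlonglongrightarrow> 0 \<longrightarrow> (\<lambda>n::nat. LINT x|lborel. cmod (f (x + z n) - f x)) \<longlonglongrightarrow> 0)"

lemma integrable_translate:
  fixes f :: "real \<Rightarrow> 'a :: {banach, second_countable_topology}"
  shows "integrable lborel f \<Longrightarrow> integrable lborel (\<lambda>x. f (x + z))"
  using lborel_integrable_real_affine[of f 1 z] by (simp add: add.commute)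

lemma integral_translate:
  fixes f :: "real \<Rightarrow> 'a :: {banach, second_countable_topology}"
  shows "(LINT x|lborel. f (x + z)) = (LINT x|lborel. f x)"
  using lborel_integral_real_affine[of 1 f z] by (simp add: add.commute)

text \<open>
  The property is closed under $L^1$ limits, since translations are isometries of $L^1$.
\<close>
lemma translation_continuous_approx:
  assumes f: "integrable lborel f"
    and approx: "\<And>e. e > 0 \<Longrightarrow> \<exists>g. integrable lborel g \<and> translation_continuous g \<and>
      (LINT x|lborel. cmod (f x - g x)) \<le> e"
  shows "translation_continuous f"
  unfolding translation_continuous_def
proof (intro allI impI LIMSEQ_I)
  fix z :: "nat \<Rightarrow> real" and r :: real assume z: "z \<longlonglongrightarrow> 0" and r: "0 < r"
  obtain g where g: "integrable lborel g" "translation_continuous g"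
      and fg: "(LINT x|lborel. cmod (f x - g x)) \<le> r / 4"
    using approx[of "r / 4"] r by auto
  from g(2) z have "(\<lambda>n. LINT x|lborel. cmod (g (x + z n) - g x)) \<longlonglongrightarrow> 0"
    by (simp add: translation_continuous_def)
  from LIMSEQ_D[OF this, of "r/4"] r obtain N where
    N: "\<And>n. n \<ge> N \<Longrightarrow> norm ((LINT x|lborel. cmod (g (x + z n) - g x)) - 0) < r / 4"
    by auto
  show "\<exists>N. \<forall>n\<ge>N. norm ((LINT x|lborel. cmod (f (x + z n) - f x)) - 0) < r"
  proof (intro exI allI impI)
    fix n assume "n \<ge> N"
    have "(LINT x|lborel. cmod (f (x + z n) - f x)) \<le>
        (LINT x|lborel. cmod (f (x + z n) - g (x + z n)) + cmod (g (x + z n) - g x) + cmod (f x - g x))"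
      (is "_ \<le> integral\<^sup>L _ ?R")
    proof (rule integral_mono)
      fix x
      show "cmod (f (x + z n) - f x) \<le> ?R x"
        using norm_triangle_ineq[of "f (x + z n) - g (x + z n)" "g (x + z n) - g x"]
          norm_triangle_ineq4[of "f (x + z n) - g (x + z n) + (g (x + z n) - g x)" "f x - g x"]
        by simp
    qed (use f g in \<open>auto intro!: integrable_norm integrable_translate Bochner_Integration.integrable_diff Bochner_Integration.integrable_add\<close>)
    also have "\<dots> = (LINT x|lborel. cmod (f (x + z n) - g (x + z n)))
         + (LINT x|lborel. cmod (g (x + z n) - g x)) + (LINT x|lborel. cmod (f x - g x))"
      using f g integrable_translate[of "\<lambda>x. f x - g x" "z n"] integrable_translate[OF g(1), of "z n"]
      by (subst Bochner_Integration.integral_add; simp)+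
    also have "(LINT x|lborel. cmod (f (x + z n) - g (x + z n))) = (LINT x|lborel. cmod (f x - g x))"
      by (rule integral_translate)
    finally show "norm ((LINT x|lborel. cmod (f (x + z n) - f x)) - 0) < r"
      using fg N[OF \<open>n \<ge> N\<close>] r by simp
  qed
qed

text \<open>
  For open $U$ the points of $U$ that leave $U$ under a small shift vanish in the limit by dominated
  convergence. The points that enter have the same measure, since a shift preserves the measure
  of $U$.
\<close>
lemma translation_continuous_open:
  assumes U: "open U" "emeasure lborel U < \<infinity>"
  shows "translation_continuous (\<lambda>x. indicator U x *\<^sub>R c)"
  unfolding translation_continuous_def
proof (intro allI impI)
  fix z :: "nat \<Rightarrow> real" assume z: "z \<longlonglongrightarrow> 0"
  have [measurable]: "U \<in> sets borel" using U by auto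
  have iU: "integrable lborel (\<lambda>x. indicator U x :: real)"
    using U by (simp add: integrable_indicator_iff)
  note iUz = integrable_translate[OF iU]
  have lim: "(\<lambda>n. LINT x|lborel. indicator U x * (1 - indicator U (x + z n) :: real)) \<longlonglongrightarrow> (LINT x::real|lborel. (0::real))"
  proof (rule integral_dominated_convergence[where w = "\<lambda>x. indicator U x"])
    show "AE x in lborel. (\<lambda>n. indicator U x * (1 - indicator U (x + z n) :: real)) \<longlonglongrightarrow> 0"
    proof (rule AE_I2)
      fix x
      show "(\<lambda>n. indicator U x * (1 - indicator U (x + z n) :: real)) \<longlonglongrightarrow> 0"
      proof (cases "x \<in> U")
        case True
        have "(\<lambda>n. x + z n) \<longlonglongrightarrow> x + 0" by (intro tendsto_intros z)
        then have "\<forall>\<^sub>F n in sequentially. x + z n \<in> U"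
          using topological_tendstoD U(1) True by fastforce
        then have "\<forall>\<^sub>F n in sequentially. indicator U x * (1 - indicator U (x + z n) :: real) = 0"
          by eventually_elim simp
        then show ?thesis by (rule tendsto_eventually)
      qed simp
    qed
  qed (use iU in \<open>auto intro!: AE_I2 split: split_indicator\<close>)
  have "(LINT x|lborel. cmod (indicator U (x + z n) *\<^sub>R c - indicator U x *\<^sub>R c))
      = cmod c * (2 * (LINT x|lborel. indicator U x * (1 - indicator U (x + z n) :: real)))" for n
  proof -
    have i3: "integrable lborel (\<lambda>x. indicator U x * (1 - indicator U (x + z n) :: real))"
      by (rule Bochner_Integration.integrable_bound[OF iU]) (auto split: split_indicator)
    \<comment> \<open>$|1_U(x+z) - 1_U(x)|$ is the signed difference plus twice the part that leaves $U$\<close>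
    have "(LINT x|lborel. cmod (indicator U (x + z n) *\<^sub>R c - indicator U x *\<^sub>R c))
      = (LINT x|lborel. cmod c * ((indicator U (x + z n) - indicator U x) +
           2 * (indicator U x * (1 - indicator U (x + z n)))))"
      by (intro Bochner_Integration.integral_cong) (auto split: split_indicator)
    also have "\<dots> = cmod c * ((LINT x|lborel. indicator U (x + z n)) - (LINT x|lborel. indicator U x)
        + 2 * (LINT x|lborel. indicator U x * (1 - indicator U (x + z n))))"
      using iU iUz[of "z n"] i3 by (simp add: Bochner_Integration.integral_add Bochner_Integration.integral_diff)
    also have "(LINT x|lborel. indicator U (x + z n) :: real) = (LINT x|lborel. indicator U x)"
      by (rule integral_translate)
    finally show ?thesis by simp
  qed
  then show "(\<lambda>n. LINT x|lborel. cmod (indicator U (x + z n) *\<^sub>R c - indicator U x *\<^sub>R c)) \<longlonglongrightarrow> 0"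
    using tendsto_mult_left[OF tendsto_mult_left[OF lim, of 2], of "cmod c"] by simp
qed

text \<open>
  Indicators of measurable sets are approximated by indicators of open sets through outer regularity;
  the general case follows by linearity and dominated limits.
\<close>
lemma integrable_translation_continuous:
  assumes "integrable lborel f"
  shows "translation_continuous f"
  using assms
proof induction
  case (base A c)
  show ?case
  proof (rule translation_continuous_approx)
    show "integrable lborel (\<lambda>x. indicator A x *\<^sub>R c)"
      using base by simp
    fix e :: real assume e: "e > 0"
    \<comment> \<open>the summand $1$ covers the case $c = 0$\<close>
    define e' where "e' = e / (cmod c + 1)"
    have e': "e' > 0" using e by (simp add: e'_def add_nonneg_pos)
    from base(1) have A [measurable]: "A \<in> sets borel" by simp
    obtain U where U: "open U" "A \<subseteq> U" "emeasure lborel (U - A) < e'"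
      using outer_regular_lborel[OF A e'] .
    have [measurable]: "U \<in> sets borel" using U by auto
    have "emeasure lborel U = emeasure lborel (A \<union> (U - A))"
      using U by (simp add: Un_absorb1)
    also have "\<dots> \<le> emeasure lborel A + emeasure lborel (U - A)"
      by (rule emeasure_subadditive) auto
    also have "\<dots> < \<infinity>"
      using base(2) U(3) by (auto simp: ennreal_add_eq_top less_top dest: less_trans[OF _ ennreal_less_top])
    finally have finU: "emeasure lborel U < \<infinity>" .
    have "(LINT x|lborel. cmod (indicator A x *\<^sub>R c - indicator U x *\<^sub>R c))
       = (LINT x|lborel. indicator (U - A) x * cmod c)"
      using U(2) by (intro Bochner_Integration.integral_cong) (auto split: split_indicator)
    also have "\<dots> = measure lborel (U - A) * cmod c"
      by simp
    also have "\<dots> \<le> e' * (cmod c + 1)"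
      using U(3) e' by (intro mult_mono) (auto simp: measure_def enn2real_leI less_imp_le)
    also have "\<dots> = e"
      using norm_ge_zero[of c] unfolding e'_def by (simp add: add_nonneg_eq_0_iff)
    finally show "\<exists>g. integrable lborel g \<and> translation_continuous g \<and>
        (LINT x|lborel. cmod (indicator A x *\<^sub>R c - g x)) \<le> e"
      using translation_continuous_open[OF U(1) finU, of c] finU
      by (intro exI[of _ "\<lambda>x. indicator U x *\<^sub>R c"]) simp
  qed
next
  case (add f g)
  note [measurable] = borel_measurable_integrable[OF add.hyps(1)] borel_measurable_integrable[OF add.hyps(2)]
  show ?case
    unfolding translation_continuous_def
  proof (intro allI impI)
    fix z :: "nat \<Rightarrow> real" assume z: "z \<longlonglongrightarrow> 0"
    have lim: "(\<lambda>n. (LINT x|lborel. cmod (f (x + z n) - f x)) + (LINT x|lborel. cmod (g (x + z n) - g x))) \<longlonglongrightarrow> 0"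
      using add.IH z unfolding translation_continuous_def by (auto intro!: tendsto_add_zero)
    show "(\<lambda>n. LINT x|lborel. cmod (f (x + z n) + g (x + z n) - (f x + g x))) \<longlonglongrightarrow> 0"
    proof (rule Lim_null_comparison[OF always_eventually lim], rule allI)
      fix n
      have i: "integrable lborel (\<lambda>x. cmod (f (x + z n) - f x))" "integrable lborel (\<lambda>x. cmod (g (x + z n) - g x))"
        using add.hyps by (auto intro!: integrable_norm integrable_translate Bochner_Integration.integrable_diff)
      have "(LINT x|lborel. cmod (f (x + z n) + g (x + z n) - (f x + g x)))
         \<le> (LINT x|lborel. cmod (f (x + z n) - f x) + cmod (g (x + z n) - g x))"
        using add.hyps i
        by (intro integral_mono integrable_norm integrable_translate Bochner_Integration.integrable_diff Bochner_Integration.integrable_add)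
          (auto simp: norm_diff_triangle_ineq)
      then show "norm (LINT x|lborel. cmod (f (x + z n) + g (x + z n) - (f x + g x)))
          \<le> (LINT x|lborel. cmod (f (x + z n) - f x)) + (LINT x|lborel. cmod (g (x + z n) - g x))"
        using i by simp
    qed
  qed
next
  case (lim f s)
  note [measurable] = borel_measurable_integrable[OF lim.hyps(1)] borel_measurable_integrable[OF lim.hyps(4)]
  show ?case
  proof (rule translation_continuous_approx[OF lim.hyps(4)])
    fix e :: real assume "e > 0"
    have "(\<lambda>i. LINT x|lborel. cmod (f x - s i x)) \<longlonglongrightarrow> (LINT x::real|lborel. (0::real))"
    proof (rule integral_dominated_convergence[where w = "\<lambda>x. 3 * cmod (f x)"])
      show "AE x in lborel. (\<lambda>i. cmod (f x - s i x)) \<longlonglongrightarrow> 0"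
      proof (rule AE_I2)
        fix x :: real
        have "(\<lambda>i. cmod (f x - s i x)) \<longlonglongrightarrow> cmod (f x - f x)"
          using lim.hyps(2)[of x] by (intro tendsto_intros) auto
        then show "(\<lambda>i. cmod (f x - s i x)) \<longlonglongrightarrow> 0" by simp
      qed
      show "AE x in lborel. norm (cmod (f x - s i x)) \<le> 3 * cmod (f x)" for i
      proof (rule AE_I2)
        fix x :: real
        show "norm (cmod (f x - s i x)) \<le> 3 * cmod (f x)"
          using norm_triangle_ineq4[of "f x" "s i x"] lim.hyps(3)[of x i] by simp
      qed
    qed (use lim.hyps(4) in auto)
    then have "(\<lambda>i. LINT x|lborel. cmod (f x - s i x)) \<longlonglongrightarrow> 0" by simp
    from LIMSEQ_D[OF this \<open>e > 0\<close>] obtain i where "norm ((LINT x|lborel. cmod (f x - s i x)) - 0) < e"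
      by blast
    then show "\<exists>g. integrable lborel g \<and> translation_continuous g \<and> (LINT x|lborel. cmod (f x - g x)) \<le> e"
      using lim.hyps(1) lim.IH by (intro exI[of _ "s i"]) auto
  qed
qed

section \<open>Plancherel's theorem\<close>

lemma L2_dominated_convergence:
  assumes [measurable]: "\<And>n::nat. f n \<in> borel_measurable borel" "g \<in> borel_measurable borel"
    and w: "integrable lborel (\<lambda>x. (w x)\<^sup>2)"
    and lim: "AE x in lborel. (\<lambda>n. f n x) \<longlonglongrightarrow> g x"
    and bound: "\<And>n. AE x in lborel. cmod (f n x) \<le> w x"
  shows "\<And>n. square_integrable (f n)" "square_integrable g" "(\<lambda>n. L2 (f n)) \<longlonglongrightarrow> L2 g"
proof -
  have sq: "square_integrable u"
    if [measurable]: "u \<in> borel_measurable borel" and b: "AE x in lborel. cmod (u x) \<le> w x" for u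
    unfolding square_integrable_def
  proof
    show "integrable lborel (\<lambda>x. (cmod (u x))\<^sup>2)"
    proof (rule Bochner_Integration.integrable_bound[OF w])
      show "AE x in lborel. norm ((cmod (u x))\<^sup>2) \<le> norm ((w x)\<^sup>2)"
        using b by eventually_elim (auto intro: power_mono)
    qed measurable
  qed measurable
  show f: "square_integrable (f n)" for n using bound by (intro sq) auto
  have gb: "AE x in lborel. cmod (g x) \<le> w x"
  proof -
    have "AE x in lborel. \<forall>n. cmod (f n x) \<le> w x"
      using bound by (simp add: AE_all_countable)
    then show ?thesis
      using lim by eventually_elim (rule LIMSEQ_le_const2[OF tendsto_norm], auto)
  qed
  then show g: "square_integrable g" by (intro sq) auto
  have "(\<lambda>n. LINT x|lborel. (cmod (f n x - g x))\<^sup>2) \<longlonglongrightarrow> (LINT x::real|lborel. (0::real))"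
  proof (rule integral_dominated_convergence[where w = "\<lambda>x. 4 * (w x)\<^sup>2"])
    show "AE x in lborel. (\<lambda>n. (cmod (f n x - g x))\<^sup>2) \<longlonglongrightarrow> 0"
      using lim
    proof eventually_elim
      case (elim x)
      then have "(\<lambda>n. (cmod (f n x - g x))\<^sup>2) \<longlonglongrightarrow> (cmod (g x - g x))\<^sup>2"
        by (intro tendsto_intros)
      then show ?case by simp
    qed
    show "AE x in lborel. norm ((cmod (f n x - g x))\<^sup>2) \<le> 4 * (w x)\<^sup>2" for n
      using bound[of n] gb
    proof eventually_elim
      case (elim x)
      have "cmod (f n x - g x) \<le> 2 * w x"
        using norm_triangle_ineq4[of "f n x" "g x"] elim by simp
      then have "(cmod (f n x - g x))\<^sup>2 \<le> (2 * w x)\<^sup>2"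
        by (intro power_mono) auto
      then show ?case by (simp add: power_mult_distrib)
    qed
  qed (use w in auto)
  moreover have "(norm (L2 (f n) - L2 g))\<^sup>2 = (LINT x|lborel. (cmod (f n x - g x))\<^sup>2)" for n
    unfolding L2_diff[OF f g, symmetric] by (rule L2_norm_squared[OF square_integrable_diff[OF f g]])
  ultimately have "(\<lambda>n. (norm (L2 (f n) - L2 g))\<^sup>2) \<longlonglongrightarrow> 0"
    by simp
  from tendsto_real_sqrt[OF this] have "(\<lambda>n. norm (L2 (f n) - L2 g)) \<longlonglongrightarrow> 0" by simp
  then show "(\<lambda>n. L2 (f n)) \<longlonglongrightarrow> L2 g" by (rule LIM_zero_cancel[OF tendsto_norm_zero_cancel])
qed

lemma integrable_gauss: "e > 0 \<Longrightarrow> integrable lborel (\<lambda>x::real. exp (- (e * x)\<^sup>2 / 2))"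
proof -
  assume e: "e > 0"
  have "integrable lborel (\<lambda>x. sqrt (2 * pi) * std_normal_density (0 + e * x))"
    using e by (intro Bochner_Integration.integrable_mult_right lborel_integrable_real_affine) auto
  then show ?thesis by (simp add: std_normal_density_def)
qed

text \<open>
  The autocorrelation $h(w) = \int f(y+w)\overline{f(y)}\,dy$ of a bounded integrable function is
  continuous at $0$: one factor is bounded and the other is continuous under translation in $L^1$.
\<close>
lemma autocorrelation_at_0_limit:
  assumes f: "integrable lborel f" and M: "\<And>x. cmod (f x) \<le> M"
    and z: "z \<longlonglongrightarrow> 0"
  defines "h \<equiv> convolution f (\<lambda>y. cnj (f (- y)))"
  shows "(\<lambda>n::nat. h (z n)) \<longlonglongrightarrow> complex_of_real (LINT x|lborel. (cmod (f x))\<^sup>2)"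
    and "cmod (h w) \<le> M * (LINT x|lborel. cmod (f x))"
proof -
  note [measurable] = borel_measurable_integrable[OF f]
  have M0: "0 \<le> M" using M[of 0] norm_ge_zero order_trans by blast
  have heq: "h w = (LINT y|lborel. f (y + w) * cnj (f y))" for w
    unfolding h_def convolution_def
    by (subst lborel_integral_real_affine[where c = "-1" and t = 0]) (auto simp: add_ac)
  have bi: "integrable lborel (\<lambda>y. f (y + w) * cnj (f y))" for w
  proof (rule Bochner_Integration.integrable_bound)
    show "integrable lborel (\<lambda>y. M * cmod (f y))" using f by auto
    show "AE y in lborel. norm (f (y + w) * cnj (f y)) \<le> norm (M * cmod (f y))"
      using M M0 by (auto simp: norm_mult intro!: mult_right_mono AE_I2)
  qed measurable
  have "cmod (h w) \<le> (LINT y|lborel. cmod (f (y + w) * cnj (f y)))"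
    unfolding heq by (rule integral_norm_bound)
  also have "\<dots> \<le> (LINT y|lborel. M * cmod (f y))"
    using bi f M by (intro integral_mono integrable_norm) (auto simp: norm_mult intro!: mult_right_mono)
  finally show "cmod (h w) \<le> M * (LINT x|lborel. cmod (f x))" by simp
  have h0: "h 0 = complex_of_real (LINT x|lborel. (cmod (f x))\<^sup>2)"
    unfolding heq integral_complex_of_real[symmetric]
    by (intro Bochner_Integration.integral_cong) (auto simp: complex_norm_square simp del: of_real_power)
  have lim: "(\<lambda>n. M * (LINT x|lborel. cmod (f (x + z n) - f x))) \<longlonglongrightarrow> 0"
    using integrable_translation_continuous[OF f] z
    unfolding translation_continuous_def by (auto intro!: tendsto_mult_right_zero)
  have "(\<lambda>n. h (z n) - h 0) \<longlonglongrightarrow> 0"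
  proof (rule Lim_null_comparison[OF always_eventually lim], rule allI)
    fix n
    have i: "integrable lborel (\<lambda>x. cmod (f (x + z n) - f x))"
      using f by (intro integrable_norm Bochner_Integration.integrable_diff integrable_translate)
    have "h (z n) - h 0 = (LINT y|lborel. f (y + z n) * cnj (f y)) - (LINT y|lborel. f (y + 0) * cnj (f y))"
      by (simp only: heq)
    also have "\<dots> = (LINT y|lborel. f (y + z n) * cnj (f y) - f (y + 0) * cnj (f y))"
      using bi by (intro Bochner_Integration.integral_diff[symmetric])
    also have "\<dots> = (LINT y|lborel. (f (y + z n) - f y) * cnj (f y))"
      by (simp add: left_diff_distrib)
    finally have "norm (h (z n) - h 0) \<le> (LINT y|lborel. cmod ((f (y + z n) - f y) * cnj (f y)))"
      by (simp only: integral_norm_bound)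
    also have "\<dots> \<le> (LINT y|lborel. M * cmod (f (y + z n) - f y))"
    proof (rule integral_mono)
      show "integrable lborel (\<lambda>y. cmod ((f (y + z n) - f y) * cnj (f y)))"
        using Bochner_Integration.integrable_diff[OF bi[of "z n"] bi[of 0]]
        by (intro integrable_norm) (simp add: left_diff_distrib)
      show "cmod ((f (y + z n) - f y) * cnj (f y)) \<le> M * cmod (f (y + z n) - f y)" for y
        using M[of y] by (simp add: norm_mult mult.commute[of M] mult_left_mono)
    qed (use i in simp)
    finally show "norm (h (z n) - h 0) \<le> M * (LINT x|lborel. cmod (f (x + z n) - f x))" by simp
  qed
  then show "(\<lambda>n. h (z n)) \<longlonglongrightarrow> complex_of_real (LINT x|lborel. (cmod (f x))\<^sup>2)"
    unfolding h0[symmetric] by (rule LIM_zero_cancel)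
qed

text \<open>
  Multiplication formula for the autocorrelation $h$, whose transform is $\sqrt{2\pi}\,|\hat f|^2$, and a
  Gaussian.
\<close>
lemma Gauss_weighted_energy:
  assumes f: "integrable lborel f" and e: "e > 0"
  defines "h \<equiv> convolution f (\<lambda>y. cnj (f (- y)))"
  shows "complex_of_real (LINT \<xi>|lborel. (cmod (ft f \<xi>))\<^sup>2 * exp (- (e * \<xi>)\<^sup>2 / 2))
    = (LINT z|lborel. h (e * z) * complex_of_real (std_normal_density z))"
proof -
  note [measurable] = borel_measurable_integrable[OF f]
  let ?G = "\<lambda>\<xi>. complex_of_real (exp (- (e * \<xi>)\<^sup>2 / 2))"
  let ?q = "complex_of_real (sqrt (2 * pi))"
  have q: "?q \<noteq> 0" by simp
  have fr: "integrable lborel (\<lambda>y. cnj (f (- y)))"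
    using lborel_integrable_real_affine[OF f, of "-1" 0] by simp
  have h: "integrable lborel h"
    unfolding h_def by (rule convolution_integrable[OF f fr])
  have G: "integrable lborel ?G"
    using integrable_gauss[OF e] by simp
  have fth: "ft h \<xi> = ?q * complex_of_real ((cmod (ft f \<xi>))\<^sup>2)" for \<xi>
    unfolding h_def ft_convolution[OF f fr] ft_cnj_reflect by (simp add: complex_norm_square mult.assoc del: of_real_power)
  have "?q * complex_of_real (LINT \<xi>|lborel. (cmod (ft f \<xi>))\<^sup>2 * exp (- (e * \<xi>)\<^sup>2 / 2))
      = (LINT \<xi>|lborel. ft h \<xi> * ?G \<xi>)"
    unfolding fth integral_complex_of_real[symmetric] integral_mult_right_zero[symmetric]
    by (intro Bochner_Integration.integral_cong) (auto simp: mult_ac)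
  also have "\<dots> = (LINT x|lborel. h x * ft ?G x)"
    by (rule ft_multiplication_formula[OF h G])
  also have "\<dots> = (LINT x|lborel. h x * complex_of_real (exp (- (x / e)\<^sup>2 / 2) / e))"
    by (simp only: ft_gauss[OF e])
  also have "\<dots> = e *\<^sub>R (LINT z|lborel. h (e * z) * complex_of_real (exp (- z\<^sup>2 / 2)) * complex_of_real (1 / e))"
    using e by (subst lborel_integral_real_affine[where c = e and t = 0]) auto
  also have "\<dots> = (LINT z|lborel. h (e * z) * complex_of_real (exp (- z\<^sup>2 / 2)))"
    using e unfolding integral_mult_left_zero by (simp add: scaleR_conv_of_real)
  also have "\<dots> = (LINT z|lborel. ?q * (h (e * z) * complex_of_real (std_normal_density z)))"
    by (intro Bochner_Integration.integral_cong) (auto simp: std_normal_density_def)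
  finally show ?thesis
    unfolding integral_mult_right_zero mult_cancel_left using q by simp
qed

text \<open>
  As $e \to 0$ in \<open>Gauss_weighted_energy\<close>, the right-hand side tends to $h(0) = \|f\|^2$, and the
  left-hand side to the energy of $\hat f$.
\<close>
lemma Plancherel_bounded:
  assumes f: "integrable lborel f" and M: "\<And>x. cmod (f x) \<le> M"
  shows "square_integrable f" "square_integrable (ft f)" "norm (L2 (ft f)) = norm (L2 f)"
proof -
  note [measurable] = borel_measurable_integrable[OF f]
  have M0: "0 \<le> M" using M[of 0] norm_ge_zero order_trans by blast
  show sqf: "square_integrable f"
  proof (rule square_integrableI_bound)
    show "integrable lborel (\<lambda>x. M * cmod (f x))" using f by auto
    show "(cmod (f x))\<^sup>2 \<le> M * cmod (f x)" for x
      using M by (simp add: power2_eq_square mult_right_mono)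
  qed measurable
  \<comment> \<open>the Gaussians $e^{-(e_n\xi)^2/2}$ spread out and increase to $1$\<close>
  define e where "e n = inverse (real (Suc n))" for n
  have e: "e n > 0" "e \<longlonglongrightarrow> 0" for n
    unfolding e_def by (simp, rule LIMSEQ_inverse_real_of_nat)
  define a where "a n = (LINT \<xi>|lborel. (cmod (ft f \<xi>))\<^sup>2 * exp (- (e n * \<xi>)\<^sup>2 / 2))" for n
  define h where "h = convolution f (\<lambda>y. cnj (f (- y)))"
  have fr: "integrable lborel (\<lambda>y. cnj (f (- y)))"
    using lborel_integrable_real_affine[OF f, of "-1" 0] by simp
  have [measurable]: "h \<in> borel_measurable borel"
    using convolution_integrable[OF f fr] unfolding h_def by (auto dest: borel_measurable_integrable)
  let ?E = "LINT x|lborel. (cmod (f x))\<^sup>2"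
  let ?B = "M * (LINT x|lborel. cmod (f x))"
  have "(\<lambda>n. LINT z|lborel. h (e n * z) * complex_of_real (std_normal_density z))
      \<longlonglongrightarrow> (LINT z|lborel. complex_of_real ?E * complex_of_real (std_normal_density z))"
  proof (rule integral_dominated_convergence[where w = "\<lambda>z. ?B * std_normal_density z"])
    show "AE z in lborel. (\<lambda>n. h (e n * z) * complex_of_real (std_normal_density z))
        \<longlonglongrightarrow> complex_of_real ?E * complex_of_real (std_normal_density z)"
      unfolding h_def
      by (intro AE_I2 tendsto_mult tendsto_const autocorrelation_at_0_limit(1)[OF f M])
        (rule tendsto_mult_left_zero[OF e(2)])
    show "AE z in lborel. norm (h (e n * z) * complex_of_real (std_normal_density z)) \<le> ?B * std_normal_density z" for n
      using autocorrelation_at_0_limit(2)[OF f M e(2)]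
      by (intro AE_I2) (auto simp: norm_mult h_def normal_density_nonneg intro!: mult_right_mono)
  qed auto
  also have "(LINT z|lborel. complex_of_real ?E * complex_of_real (std_normal_density z)) = complex_of_real ?E"
    by simp
  finally have "(\<lambda>n. complex_of_real (a n)) \<longlonglongrightarrow> complex_of_real ?E"
    unfolding a_def h_def Gauss_weighted_energy[OF f e(1)] .
  then have a: "a \<longlonglongrightarrow> ?E" by (simp add: tendsto_of_real_iff)
  have ftb: "cmod (ft f \<xi>) \<le> 1 / sqrt (2 * pi) * (LINT x|lborel. cmod (f x))" for \<xi>
  proof -
    have "cmod (LINT x|lborel. f x * cis (- (\<xi> * x))) \<le> (LINT x|lborel. cmod (f x * cis (- (\<xi> * x))))"
      by (rule integral_norm_bound)
    also have "\<dots> = (LINT x|lborel. cmod (f x))" by (simp add: norm_mult)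
    finally show ?thesis unfolding ft_def by (simp add: norm_mult norm_divide divide_right_mono)
  qed
  let ?C = "1 / sqrt (2 * pi) * (LINT x|lborel. cmod (f x))"
  have inta: "integrable lborel (\<lambda>\<xi>. (cmod (ft f \<xi>))\<^sup>2 * exp (- (e n * \<xi>)\<^sup>2 / 2))" for n
  proof (rule Bochner_Integration.integrable_bound)
    show "integrable lborel (\<lambda>\<xi>. ?C\<^sup>2 * exp (- (e n * \<xi>)\<^sup>2 / 2))"
      using integrable_gauss[OF e(1)] by simp
    show "AE \<xi> in lborel. norm ((cmod (ft f \<xi>))\<^sup>2 * exp (- (e n * \<xi>)\<^sup>2 / 2)) \<le> norm (?C\<^sup>2 * exp (- (e n * \<xi>)\<^sup>2 / 2))"
      using power_mono[OF ftb norm_ge_zero, of _ 2] by (intro AE_I2) (auto intro!: mult_right_mono)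
  qed measurable
  have lim: "(\<lambda>n. (cmod (ft f \<xi>))\<^sup>2 * exp (- (e n * \<xi>)\<^sup>2 / 2)) \<longlonglongrightarrow> (cmod (ft f \<xi>))\<^sup>2" for \<xi>
  proof -
    have "(\<lambda>n. (cmod (ft f \<xi>))\<^sup>2 * exp (- (e n * \<xi>)\<^sup>2 / 2)) \<longlonglongrightarrow> (cmod (ft f \<xi>))\<^sup>2 * exp (- (0 * \<xi>)\<^sup>2 / 2)"
      by (intro tendsto_intros e) auto
    then show ?thesis by simp
  qed
  have "(\<integral>\<^sup>+\<xi>. ennreal ((cmod (ft f \<xi>))\<^sup>2) \<partial>lborel)
      = (\<integral>\<^sup>+\<xi>. liminf (\<lambda>n. ennreal ((cmod (ft f \<xi>))\<^sup>2 * exp (- (e n * \<xi>)\<^sup>2 / 2))) \<partial>lborel)"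
    by (intro nn_integral_cong lim_imp_Liminf[OF trivial_limit_sequentially, symmetric] tendsto_ennrealI lim)
  also have "\<dots> \<le> liminf (\<lambda>n. \<integral>\<^sup>+\<xi>. ennreal ((cmod (ft f \<xi>))\<^sup>2 * exp (- (e n * \<xi>)\<^sup>2 / 2)) \<partial>lborel)"
    by (intro nn_integral_liminf) auto
  also have "\<dots> = liminf (\<lambda>n. ennreal (a n))"
    unfolding a_def by (subst nn_integral_eq_integral[OF inta]) auto
  also have "\<dots> = ennreal ?E"
    by (intro lim_imp_Liminf[OF trivial_limit_sequentially] tendsto_ennrealI a)
  finally have "(\<integral>\<^sup>+\<xi>. ennreal ((cmod (ft f \<xi>))\<^sup>2) \<partial>lborel) < \<infinity>"
    by (auto intro: le_less_trans)
  \<comment> \<open>Fatou gives square integrability, hence the majorant for dominated convergence below\<close>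
  then show sqft: "square_integrable (ft f)"
    unfolding square_integrable_iff_nn by auto
  have "a \<longlonglongrightarrow> (LINT \<xi>|lborel. (cmod (ft f \<xi>))\<^sup>2)"
    unfolding a_def
  proof (rule integral_dominated_convergence[where w = "\<lambda>\<xi>. (cmod (ft f \<xi>))\<^sup>2"])
    show "AE \<xi> in lborel. norm ((cmod (ft f \<xi>))\<^sup>2 * exp (- (e n * \<xi>)\<^sup>2 / 2)) \<le> (cmod (ft f \<xi>))\<^sup>2" for n
      by (intro AE_I2) (auto intro!: mult_left_le)
  qed (use lim square_integrable_integrable[OF sqft] in auto)
  then have "(LINT \<xi>|lborel. (cmod (ft f \<xi>))\<^sup>2) = ?E"
    using a LIMSEQ_unique by blast
  then have "(norm (L2 (ft f)))\<^sup>2 = (norm (L2 f))\<^sup>2"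
    by (simp add: L2_norm_squared sqf sqft)
  then show "norm (L2 (ft f)) = norm (L2 f)" by simp
qed

text \<open>
  Cutting off large values gives bounded functions that converge in $L^1$ and in $L^2$. Their
  transforms converge pointwise by the first and in $L^2$ by the second, and the two limits agree.
\<close>
lemma Plancherel_integrable:
  assumes f: "integrable lborel f" and sqf: "square_integrable f"
  shows "square_integrable (ft f)" "norm (L2 (ft f)) = norm (L2 f)"
proof -
  note [measurable] = borel_measurable_integrable[OF f]
  define g where "g n x = (if cmod (f x) \<le> real n then f x else 0)" for n x
  have [measurable]: "g n \<in> borel_measurable borel" for n unfolding g_def by measurable
  have gi: "integrable lborel (g n)" for n
    by (rule Bochner_Integration.integrable_bound[OF f]) (auto simp: g_def)
  have gb: "cmod (g n x) \<le> real n" for n x by (auto simp: g_def)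
  have glim: "(\<lambda>n. g n x) \<longlonglongrightarrow> f x" for x
  proof (rule tendsto_eventually)
    obtain N where "cmod (f x) \<le> real N" using real_arch_simple by blast
    then have "\<forall>n\<ge>N. g n x = f x" by (auto simp: g_def)
    then show "\<forall>\<^sub>F n in sequentially. g n x = f x" unfolding eventually_sequentially by blast
  qed
  have gL2: "(\<lambda>n. L2 (g n)) \<longlonglongrightarrow> L2 f"
    by (rule L2_dominated_convergence(3)[where w = "\<lambda>x. cmod (f x)"])
      (use glim square_integrable_integrable[OF sqf] in \<open>auto simp: g_def\<close>)
  note P = Plancherel_bounded[OF gi gb]
  have "norm (L2 (ft (g m)) - L2 (ft (g n))) = norm (L2 (g m) - L2 (g n))" for m n
  proof -
    have i: "integrable lborel (\<lambda>x. g m x - g n x)" by (intro Bochner_Integration.integrable_diff gi)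
    have "cmod (g m x - g n x) \<le> real m + real n" for x
      using norm_triangle_ineq4[of "g m x" "g n x"] gb[of m x] gb[of n x] by linarith
    from Plancherel_bounded(3)[OF i this]
    have "norm (L2 (\<lambda>\<xi>. ft (g m) \<xi> - ft (g n) \<xi>)) = norm (L2 (\<lambda>x. g m x - g n x))"
      by (simp add: ft_diff[OF gi gi, abs_def])
    then show ?thesis by (simp add: L2_diff P(1,2))
  qed
  moreover have "Cauchy (\<lambda>n. L2 (g n))" using gL2 convergent_Cauchy convergentI by blast
  ultimately have "Cauchy (\<lambda>n. L2 (ft (g n)))"
    by (simp add: Cauchy_def dist_norm)
  then obtain Y where Y: "(\<lambda>n. L2 (ft (g n))) \<longlonglongrightarrow> Y"
    using Cauchy_convergent_iff convergent_def by blast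
  obtain y where y: "square_integrable y" "Y = L2 y" by (rule L2_exhaust)
  have pl: "(\<lambda>n. ft (g n) \<xi>) \<longlonglongrightarrow> ft f \<xi>" for \<xi>
    by (rule ft_tendsto[where w = "\<lambda>x. cmod (f x)"]) (use f glim in \<open>auto simp: g_def\<close>)
  note lim = L2_limit_pointwise_limit[OF P(2) y(1) ft_measurable AE_I2[OF pl] Y[unfolded y(2)]]
  show "square_integrable (ft f)" using lim(1) by simp
  have "(\<lambda>n. norm (L2 (ft (g n)))) \<longlonglongrightarrow> norm (L2 (ft f))"
    using tendsto_norm[OF Y] lim(2) y(2) by simp
  moreover have "(\<lambda>n. norm (L2 (ft (g n)))) \<longlonglongrightarrow> norm (L2 f)"
    using tendsto_norm[OF gL2] P(3) by simp
  ultimately show "norm (L2 (ft f)) = norm (L2 f)" by (rule LIMSEQ_unique)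
qed

definition trunc :: "real \<Rightarrow> (real \<Rightarrow> complex) \<Rightarrow> real \<Rightarrow> complex" where
  "trunc R f x = indicator {-R..R} x *\<^sub>R f x"

lemma trunc_measurable [measurable]: "f \<in> borel_measurable borel \<Longrightarrow> trunc R f \<in> borel_measurable borel"
  unfolding trunc_def by measurable

lemma truncated_fourier_eq: "truncated_fourier R f = ft (trunc R f)"
  unfolding truncated_fourier_def ft_def trunc_def set_lebesgue_integral_def
  by (auto simp: fun_eq_iff cis_conv_exp mult_ac)

lemma cmod_trunc_le: "cmod (trunc R f x) \<le> cmod (f x)"
  by (auto simp: trunc_def split: split_indicator)

lemma trunc_square_integrable:
  assumes "square_integrable f" shows "square_integrable (trunc R f)"
  by (rule square_integrableI_bound[OF _ square_integrable_integrable[OF assms]])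
    (use assms cmod_trunc_le in \<open>auto intro!: power_mono\<close>)

lemma trunc_integrable:
  assumes f: "square_integrable f" shows "integrable lborel (trunc R f)"
proof -
  have "square_integrable (\<lambda>x. indicator {-R..R} x :: complex)"
  proof -
    have "(\<lambda>x. (cmod (indicator {-R..R} x :: complex))\<^sup>2) = indicator {-R..R}"
      by (auto split: split_indicator)
    then show ?thesis
      unfolding square_integrable_def by (simp add: integrable_indicator_iff emeasure_lborel_Icc_eq)
  qed
  from integrable_mult_square_integrable[OF this f] show ?thesis
    unfolding trunc_def[abs_def] by (simp add: scaleR_conv_of_real of_real_indicator)
qed

lemma trunc_tendsto_pointwise:
  assumes "filterlim X at_top sequentially"
  shows "(\<lambda>n. trunc (X n) f x) \<longlonglongrightarrow> f x"
proof (rule tendsto_eventually)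
  have "\<forall>\<^sub>F n in sequentially. \<bar>x\<bar> \<le> X n"
    using assms by (simp add: filterlim_at_top)
  then show "\<forall>\<^sub>F n in sequentially. trunc (X n) f x = f x"
    by eventually_elim (auto simp: trunc_def split: split_indicator)
qed

lemma trunc_tendsto:
  assumes f: "square_integrable f"
  shows "((\<lambda>R. L2 (trunc R f)) \<longlongrightarrow> L2 f) at_top"
proof (rule tendsto_at_topI_sequentially)
  fix X :: "nat \<Rightarrow> real" assume X: "filterlim X at_top sequentially"
  show "(\<lambda>n. L2 (trunc (X n) f)) \<longlonglongrightarrow> L2 f"
    by (rule L2_dominated_convergence(3)[where w = "\<lambda>x. cmod (f x)"])
      (use f square_integrable_integrable[OF f] trunc_tendsto_pointwise[OF X] cmod_trunc_le in auto)
qed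

lemma ft_trunc_square_integrable: "square_integrable f \<Longrightarrow> square_integrable (ft (trunc R f))"
  by (intro Plancherel_integrable trunc_integrable trunc_square_integrable)

text \<open>
  The extended nonnegative integral in the definition is the squared \<open>l2\<close> distance.
\<close>
lemma is_fourier_iff:
  assumes f: "square_integrable f"
  shows "is_fourier f F \<longleftrightarrow> square_integrable F \<and> ((\<lambda>R. L2 (ft (trunc R f))) \<longlongrightarrow> L2 F) at_top"
proof (cases "square_integrable F")
  case F: True
  have "(\<integral>\<^sup>+\<xi>. ennreal ((cmod (truncated_fourier R f \<xi> - F \<xi>))\<^sup>2) \<partial>lborel)
      = ennreal ((norm (L2 (ft (trunc R f)) - L2 F))\<^sup>2)" for R
    unfolding truncated_fourier_eq
    by (subst L2_norm_nn) (simp_all add: L2_diff square_integrable_diff ft_trunc_square_integrable f F)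
  moreover have "((\<lambda>R. ennreal ((norm (L2 (ft (trunc R f)) - L2 F))\<^sup>2)) \<longlongrightarrow> ennreal 0) at_top
     \<longleftrightarrow> ((\<lambda>R. (norm (L2 (ft (trunc R f)) - L2 F))\<^sup>2) \<longlongrightarrow> 0) at_top"
    by (rule tendsto_ennreal_iff) auto
  moreover have "((\<lambda>R. (norm (L2 (ft (trunc R f)) - L2 F))\<^sup>2) \<longlongrightarrow> 0) at_top
     \<longleftrightarrow> ((\<lambda>R. L2 (ft (trunc R f))) \<longlongrightarrow> L2 F) at_top"
    (is "?l \<longleftrightarrow> ?r")
  proof
    assume ?l
    from tendsto_real_sqrt[OF this] have "((\<lambda>R. norm (L2 (ft (trunc R f)) - L2 F)) \<longlongrightarrow> 0) at_top" by simp
    then show ?r by (rule LIM_zero_cancel[OF tendsto_norm_zero_cancel])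
  next
    assume ?r
    then have "((\<lambda>R. (norm (L2 (ft (trunc R f)) - L2 F))\<^sup>2) \<longlongrightarrow> (norm (L2 F - L2 F))\<^sup>2) at_top"
      by (intro tendsto_intros)
    then show ?l by simp
  qed
  ultimately show ?thesis unfolding is_fourier_def using F by simp
qed (simp add: is_fourier_def)

lemma trunc_diff_Plancherel:
  assumes f: "square_integrable f"
  shows "norm (L2 (ft (trunc R f)) - L2 (ft (trunc R' f))) = norm (L2 (trunc R f) - L2 (trunc R' f))"
proof -
  note t = trunc_integrable[OF f] trunc_square_integrable[OF f]
  have "norm (L2 (ft (\<lambda>x. trunc R f x - trunc R' f x))) = norm (L2 (\<lambda>x. trunc R f x - trunc R' f x))"
    by (intro Plancherel_integrable Bochner_Integration.integrable_diff square_integrable_diff t)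
  then show ?thesis
    by (simp add: ft_diff[OF t(1) t(1), abs_def] L2_diff t ft_trunc_square_integrable f)
qed

text \<open>
  By Plancherel's theorem the transforms of the truncations form a Cauchy family exactly as the
  truncations themselves do. The limit $F$ along integers is then the limit along all radii, since letting
  $n \to \infty$ in $\|\hat f_R - \hat f_n\| = \|f_R - f_n\|$ gives $\|\hat f_R - F\| = \|f_R - f\|$.
\<close>
lemma fourier_exists:
  assumes f: "square_integrable f"
  shows "\<exists>F. is_fourier f F"
proof -
  let ?T = "\<lambda>R. L2 (ft (trunc R f))"
  have seq: "(\<lambda>n. L2 (trunc (real n) f)) \<longlonglongrightarrow> L2 f"
    by (rule filterlim_compose[OF trunc_tendsto[OF f] filterlim_real_sequentially])
  have "Cauchy (\<lambda>n. L2 (trunc (real n) f))" using seq convergent_Cauchy convergentI by blast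
  then have "Cauchy (\<lambda>n. ?T (real n))"
    by (simp add: Cauchy_def dist_norm trunc_diff_Plancherel[OF f])
  then obtain Y where Y: "(\<lambda>n. ?T (real n)) \<longlonglongrightarrow> Y"
    using Cauchy_convergent_iff convergent_def by blast
  obtain F where F: "square_integrable F" "Y = L2 F" by (rule L2_exhaust)
  have "norm (?T R - Y) = norm (L2 (trunc R f) - L2 f)" for R
  proof (rule LIMSEQ_unique)
    show "(\<lambda>n. norm (?T R - ?T (real n))) \<longlonglongrightarrow> norm (?T R - Y)"
      by (intro tendsto_intros Y)
    show "(\<lambda>n. norm (?T R - ?T (real n))) \<longlonglongrightarrow> norm (L2 (trunc R f) - L2 f)"
      unfolding trunc_diff_Plancherel[OF f] by (intro tendsto_intros seq)
  qed
  moreover have "((\<lambda>R. norm (L2 (trunc R f) - L2 f)) \<longlongrightarrow> 0) at_top"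
    by (intro tendsto_norm_zero LIM_zero trunc_tendsto f)
  ultimately have "((\<lambda>R. norm (?T R - Y)) \<longlongrightarrow> 0) at_top" by simp
  then have "(?T \<longlongrightarrow> Y) at_top" by (rule LIM_zero_cancel[OF tendsto_norm_zero_cancel])
  then show ?thesis using F unfolding is_fourier_iff[OF f] by auto
qed

lemma
  assumes f: "square_integrable f"
  shows fourier_square_integrable: "square_integrable (fourier f)"
    and fourier_tendsto: "((\<lambda>R. L2 (ft (trunc R f))) \<longlongrightarrow> L2 (fourier f)) at_top"
  using someI_ex[OF fourier_exists[OF f]] unfolding fourier_def[symmetric] unfolding is_fourier_iff[OF f] by auto

lemma fourier_eqI:
  assumes "square_integrable f" "((\<lambda>R. L2 (ft (trunc R f))) \<longlongrightarrow> y) at_top"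
  shows "L2 (fourier f) = y"
  using tendsto_unique[OF trivial_limit_at_top_linorder fourier_tendsto[OF assms(1)] assms(2)] .

lemma fourier_norm:
  assumes f: "square_integrable f"
  shows "norm (L2 (fourier f)) = norm (L2 f)"
proof (rule tendsto_unique[OF trivial_limit_at_top_linorder])
  show "((\<lambda>R. norm (L2 (ft (trunc R f)))) \<longlongrightarrow> norm (L2 (fourier f))) at_top"
    by (intro tendsto_intros fourier_tendsto f)
  show "((\<lambda>R. norm (L2 (ft (trunc R f)))) \<longlongrightarrow> norm (L2 f)) at_top"
    using tendsto_norm[OF trunc_tendsto[OF f]]
    by (simp add: Plancherel_integrable trunc_integrable trunc_square_integrable f)
qed

lemma fourier_diff:
  assumes "square_integrable f" "square_integrable g"
  shows "L2 (fourier (\<lambda>x. f x - g x)) = L2 (fourier f) - L2 (fourier g)"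
proof (rule fourier_eqI)
  have "trunc R (\<lambda>x. f x - g x) = (\<lambda>x. trunc R f x - trunc R g x)" for R
    by (auto simp: trunc_def fun_eq_iff scaleR_diff_right)
  then have "L2 (ft (trunc R (\<lambda>x. f x - g x))) = L2 (ft (trunc R f)) - L2 (ft (trunc R g))" for R
    by (simp add: ft_diff[OF trunc_integrable[OF assms(1)] trunc_integrable[OF assms(2)], abs_def] assms L2_diff ft_trunc_square_integrable)
  then show "((\<lambda>R. L2 (ft (trunc R (\<lambda>x. f x - g x)))) \<longlongrightarrow> L2 (fourier f) - L2 (fourier g)) at_top"
    by (simp add: tendsto_diff fourier_tendsto assms)
qed (intro square_integrable_diff assms)

lemma fourier_cong_AE:
  assumes "f \<in> borel_measurable borel" "g \<in> borel_measurable borel" "AE x in lborel. f x = g x"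
  shows "fourier f = fourier g"
proof -
  have "ft (trunc R f) \<xi> = ft (trunc R g) \<xi>" for R \<xi>
    unfolding ft_def
    by (intro arg_cong2[where f = times] refl integral_cong_AE)
      (use assms(1,2) in measurable, use assms(3) in \<open>eventually_elim\<close>, simp add: trunc_def)
  then have "is_fourier f F = is_fourier g F" for F
    unfolding is_fourier_def truncated_fourier_eq by simp
  then have "is_fourier f = is_fourier g" by (rule ext)
  then show ?thesis unfolding fourier_def by (rule arg_cong)
qed

lemma fourier_inj:
  assumes f: "square_integrable f" and g: "square_integrable g"
    and eq: "L2 (fourier f) = L2 (fourier g)"
  shows "L2 f = L2 g"
proof -
  have "norm (L2 f - L2 g) = norm (L2 (fourier (\<lambda>x. f x - g x)))"
    using fourier_norm[OF square_integrable_diff[OF f g]] by (simp add: L2_diff f g)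
  also have "\<dots> = 0" by (simp add: fourier_diff f g eq)
  finally show ?thesis by simp
qed

lemma fourier_eq_fourier_integral:
  assumes f: "square_integrable f" and i: "integrable lborel f"
  shows "L2 (fourier f) = L2 (ft f)"
proof -
  note [measurable] = borel_measurable_integrable[OF i]
  have L: "(\<lambda>n. L2 (ft (trunc (real n) f))) \<longlonglongrightarrow> L2 (fourier f)"
    by (rule filterlim_compose[OF fourier_tendsto[OF f] filterlim_real_sequentially])
  have "(\<lambda>n. ft (trunc (real n) f) \<xi>) \<longlonglongrightarrow> ft f \<xi>" for \<xi>
    by (rule ft_tendsto[where w = "\<lambda>x. cmod (f x)"])
      (use i trunc_tendsto_pointwise[OF filterlim_real_sequentially] cmod_trunc_le in auto)
  from L2_limit_pointwise_limit(2)[OF ft_trunc_square_integrable[OF f] fourier_square_integrable[OF f]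
      ft_measurable AE_I2[OF this] L] show ?thesis by simp
qed

text \<open>
  The inverse transform, written as a conjugate of the forward one; in this form it inherits the isometry
  property.
\<close>
definition ifourier :: "(real \<Rightarrow> complex) \<Rightarrow> real \<Rightarrow> complex" where
  "ifourier g x = cnj (fourier (\<lambda>\<xi>. cnj (g \<xi>)) x)"

lemma L2_norm_cnj: "square_integrable f \<Longrightarrow> norm (L2 (\<lambda>x. cnj (f x))) = norm (L2 f)"
  using L2_norm_squared[of f] L2_norm_squared[of "\<lambda>x. cnj (f x)"]
  by (simp add: square_integrable_cnj) (metis norm_ge_zero power2_eq_imp_eq)

lemma tendsto_L2_cnj:
  assumes "((\<lambda>R. L2 (f R)) \<longlongrightarrow> L2 g) F" "\<And>R. square_integrable (f R)" "square_integrable g"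
  shows "((\<lambda>R. L2 (\<lambda>x. cnj (f R x))) \<longlongrightarrow> L2 (\<lambda>x. cnj (g x))) F"
proof -
  have "norm (L2 (\<lambda>x. cnj (f R x)) - L2 (\<lambda>x. cnj (g x))) = norm (L2 (f R) - L2 g)" for R
    using L2_norm_cnj[of "\<lambda>x. f R x - g x"] assms(2,3)
    by (simp add: L2_diff square_integrable_cnj square_integrable_diff)
  moreover have "((\<lambda>R. norm (L2 (f R) - L2 g)) \<longlongrightarrow> 0) F"
    by (intro tendsto_norm_zero LIM_zero assms)
  ultimately have "((\<lambda>R. norm (L2 (\<lambda>x. cnj (f R x)) - L2 (\<lambda>x. cnj (g x)))) \<longlongrightarrow> 0) F" by simp
  then show ?thesis by (rule LIM_zero_cancel[OF tendsto_norm_zero_cancel])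
qed

lemma ifourier_square_integrable: "square_integrable g \<Longrightarrow> square_integrable (ifourier g)"
  unfolding ifourier_def by (intro square_integrable_cnj fourier_square_integrable)

lemma ifourier_norm: "square_integrable g \<Longrightarrow> norm (L2 (ifourier g)) = norm (L2 g)"
  unfolding ifourier_def
  by (simp add: L2_norm_cnj fourier_norm square_integrable_cnj fourier_square_integrable)

text \<open>
  The multiplication formula for truncations, passed to the limit.
\<close>
lemma fourier_adjoint:
  assumes f: "square_integrable f" and g: "square_integrable g"
  shows "inner (L2 (fourier f)) (L2 g) = inner (L2 f) (L2 (ifourier g))"
proof (rule tendsto_unique[OF trivial_limit_at_top_linorder])
  let ?f = "\<lambda>R. trunc R f" and ?g = "\<lambda>R. trunc R g" and ?h = "\<lambda>R. trunc R (\<lambda>\<xi>. cnj (g \<xi>))"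
  note sq = trunc_square_integrable[OF f] trunc_square_integrable[OF g]
    ft_trunc_square_integrable[OF f] ft_trunc_square_integrable[OF square_integrable_cnj[OF g]]
  show "((\<lambda>R. inner (L2 (ft (?f R))) (L2 (?g R))) \<longlongrightarrow> inner (L2 (fourier f)) (L2 g)) at_top"
    by (intro tendsto_inner fourier_tendsto trunc_tendsto f g)
  have "inner (L2 (ft (?f R))) (L2 (?g R)) = inner (L2 (?f R)) (L2 (\<lambda>x. cnj (ft (?h R) x)))" for R
  proof -
    have "inner (L2 (ft (?f R))) (L2 (?g R)) = (LINT \<xi>|lborel. Re (ft (?f R) \<xi> * ?h R \<xi>))"
      by (subst L2_inner) (auto simp: sq inner_complex_Re trunc_def)
    also have "\<dots> = Re (LINT \<xi>|lborel. ft (?f R) \<xi> * ?h R \<xi>)"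
      by (intro integral_Re integrable_mult_square_integrable sq trunc_square_integrable square_integrable_cnj g)
    also have "\<dots> = Re (LINT x|lborel. ?f R x * ft (?h R) x)"
      by (subst ft_multiplication_formula) (auto intro!: trunc_integrable square_integrable_cnj f g)
    also have "\<dots> = (LINT x|lborel. Re (?f R x * ft (?h R) x))"
      by (intro integral_Re[symmetric] integrable_mult_square_integrable sq)
    also have "\<dots> = inner (L2 (?f R)) (L2 (\<lambda>x. cnj (ft (?h R) x)))"
      by (subst L2_inner) (auto simp: sq square_integrable_cnj inner_complex_Re)
    finally show ?thesis .
  qed
  moreover have "((\<lambda>R. inner (L2 (?f R)) (L2 (\<lambda>x. cnj (ft (?h R) x)))) \<longlongrightarrow> inner (L2 f) (L2 (ifourier g))) at_top"
    unfolding ifourier_def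
    by (intro tendsto_inner tendsto_L2_cnj fourier_tendsto trunc_tendsto f square_integrable_cnj g sq fourier_square_integrable)
  ultimately show "((\<lambda>R. inner (L2 (ft (?f R))) (L2 (?g R))) \<longlongrightarrow> inner (L2 f) (L2 (ifourier g))) at_top"
    by simp
qed

text \<open>
  With $F$ the transform and $F^*$ its adjoint, both isometries,
  $\|FF^*g - g\|^2 = \|F^*g\|^2 - 2\|F^*g\|^2 + \|g\|^2 = 0$.
\<close>
lemma fourier_ifourier:
  assumes g: "square_integrable g"
  shows "L2 (fourier (ifourier g)) = L2 g"
proof -
  let ?x = "L2 (fourier (ifourier g))"
  have "(norm (?x - L2 g))\<^sup>2 = (norm ?x)\<^sup>2 - 2 * inner ?x (L2 g) + (norm (L2 g))\<^sup>2"
    by (simp add: power2_norm_eq_inner inner_diff inner_commute)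
  also have "\<dots> = 0"
    unfolding fourier_adjoint[OF ifourier_square_integrable[OF g] g] fourier_norm[OF ifourier_square_integrable[OF g]]
      power2_norm_eq_inner[symmetric] ifourier_norm[OF g] by simp
  finally show ?thesis by simp
qed

lemma ifourier_fourier:
  assumes f: "square_integrable f"
  shows "L2 (ifourier (fourier f)) = L2 f"
  using fourier_square_integrable[OF f]
  by (intro fourier_inj[OF ifourier_square_integrable _ fourier_ifourier] f)

section \<open>Fourier multipliers and Sobolev spaces\<close>

definition bounded_symbol :: "(real \<Rightarrow> complex) \<Rightarrow> bool" where
  "bounded_symbol m \<longleftrightarrow> m \<in> borel_measurable borel \<and> (\<exists>C. \<forall>\<xi>. cmod (m \<xi>) \<le> C)"

definition symbol_op :: "(real \<Rightarrow> complex) \<Rightarrow> l2 \<Rightarrow> l2" where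
  "symbol_op m x = L2 (\<lambda>\<xi>. m \<xi> * rep_l2 x \<xi>)"

text \<open>
  Complex conjugation of functions, seen on the Fourier side. Its fixed points are the transforms of
  real-valued functions.
\<close>
definition conj_reflect :: "l2 \<Rightarrow> l2" where
  "conj_reflect x = L2 (\<lambda>\<xi>. cnj (rep_l2 x (- \<xi>)))"

lemma rep_l2_square_integrable: "square_integrable (rep_l2 x)"
  using Quotient3_rep_reflp[OF Quotient3_l2, of x] by (simp add: l2_eq_def)

lemma L2_rep_l2: "L2 (rep_l2 x) = x"
  by (rule Quotient3_abs_rep[OF Quotient3_l2])

lemma rep_l2_L2_AE: "square_integrable f \<Longrightarrow> AE x in lborel. rep_l2 (L2 f) x = f x"
  using L2_eq_iff[of "rep_l2 (L2 f)" f] by (simp add: rep_l2_square_integrable L2_rep_l2)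

lemma square_integrable_symbol:
  "bounded_symbol m \<Longrightarrow> square_integrable f \<Longrightarrow> square_integrable (\<lambda>\<xi>. m \<xi> * f \<xi>)"
  unfolding bounded_symbol_def by (auto intro: square_integrable_mult_bounded)

lemma symbol_op_L2:
  assumes m: "bounded_symbol m" and f: "square_integrable f"
  shows "symbol_op m (L2 f) = L2 (\<lambda>\<xi>. m \<xi> * f \<xi>)"
  unfolding symbol_op_def
  by (intro L2_cong_AE square_integrable_symbol[OF m] rep_l2_square_integrable f)
    (use rep_l2_L2_AE[OF f] in eventually_elim, simp)

lemma square_integrable_conj_reflect: "square_integrable f \<Longrightarrow> square_integrable (\<lambda>\<xi>. cnj (f (- \<xi>)))"
  by (intro square_integrable_cnj square_integrable_reflect)

lemma conj_reflect_L2: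
  assumes f: "square_integrable f"
  shows "conj_reflect (L2 f) = L2 (\<lambda>\<xi>. cnj (f (- \<xi>)))"
proof -
  note [measurable] = square_integrableD[OF f] square_integrableD[OF rep_l2_square_integrable]
  have "AE x in lborel. rep_l2 (L2 f) (0 + (-1) * x) = f (0 + (-1) * x)"
    by (rule AE_borel_affine[OF _ _ rep_l2_L2_AE[OF f]]) auto
  then show ?thesis
    unfolding conj_reflect_def
    by (intro L2_cong_AE square_integrable_conj_reflect rep_l2_square_integrable f) auto
qed

lemma symbol_op_add: "bounded_symbol m \<Longrightarrow> symbol_op m (x + y) = symbol_op m x + symbol_op m y"
  by (rule L2_exhaust[of x], rule L2_exhaust[of y])
    (simp add: symbol_op_L2 L2_add[symmetric] square_integrable_add square_integrable_symbol distrib_left)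

lemma symbol_op_scaleR: "bounded_symbol m \<Longrightarrow> symbol_op m (c *\<^sub>R x) = c *\<^sub>R symbol_op m x"
  by (rule L2_exhaust[of x])
    (simp add: symbol_op_L2 L2_scaleR[symmetric] square_integrable_scaleR square_integrable_symbol)

lemma norm_symbol_op_le:
  assumes m: "bounded_symbol m" "0 \<le> C" "\<And>\<xi>. cmod (m \<xi>) \<le> C"
  shows "norm (symbol_op m x) \<le> C * norm x"
  by (rule L2_exhaust[of x])
    (use m in \<open>auto simp: symbol_op_L2 norm_mult square_integrable_symbol intro!: L2_norm_mono mult_right_mono\<close>)

lemma bounded_linear_symbol_op:
  assumes m: "bounded_symbol m"
  shows "bounded_linear (symbol_op m)"
proof -
  obtain C where C: "\<And>\<xi>. cmod (m \<xi>) \<le> C" using m by (auto simp: bounded_symbol_def)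
  then have "0 \<le> C" using norm_ge_zero order_trans by blast
  then show ?thesis
    using norm_symbol_op_le[OF m _ C] symbol_op_add[OF m] symbol_op_scaleR[OF m]
    by (intro bounded_linear_intro[where K = C]) (auto simp: mult.commute)
qed

lemma bounded_symbol_times:
  assumes "bounded_symbol m" "bounded_symbol n"
  shows "bounded_symbol (\<lambda>\<xi>. m \<xi> * n \<xi>)"
proof -
  obtain C D where C: "\<And>\<xi>. cmod (m \<xi>) \<le> C" and D: "\<And>\<xi>. cmod (n \<xi>) \<le> D"
    using assms by (auto simp: bounded_symbol_def)
  then have "cmod (m \<xi> * n \<xi>) \<le> C * D" for \<xi>
    unfolding norm_mult by (meson mult_mono norm_ge_zero order_trans)
  then show ?thesis using assms unfolding bounded_symbol_def by auto
qed

lemma symbol_op_compose: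
  assumes "bounded_symbol m" "bounded_symbol n"
  shows "symbol_op m (symbol_op n x) = symbol_op (\<lambda>\<xi>. m \<xi> * n \<xi>) x"
  by (rule L2_exhaust[of x])
    (simp add: symbol_op_L2 assms bounded_symbol_times square_integrable_symbol mult.assoc)

lemma bounded_symbol_const: "bounded_symbol (\<lambda>_. c)"
  unfolding bounded_symbol_def by auto

lemma conj_reflect_add: "conj_reflect (x + y) = conj_reflect x + conj_reflect y"
  by (rule L2_exhaust[of x], rule L2_exhaust[of y])
    (simp add: conj_reflect_L2 L2_add[symmetric] square_integrable_add square_integrable_conj_reflect)

lemma conj_reflect_scaleR: "conj_reflect (c *\<^sub>R x) = c *\<^sub>R conj_reflect x"
  by (rule L2_exhaust[of x])
    (simp add: conj_reflect_L2 L2_scaleR[symmetric] square_integrable_scaleR square_integrable_conj_reflect)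

lemma norm_conj_reflect: "norm (conj_reflect x) = norm x"
proof (rule L2_exhaust[of x])
  fix f assume f: "square_integrable f" "x = L2 f"
  have "(norm (conj_reflect x))\<^sup>2 = (LINT \<xi>|lborel. (cmod (f (0 + (-1) * \<xi>)))\<^sup>2)"
    by (simp add: f conj_reflect_L2 L2_norm_squared square_integrable_conj_reflect)
  also have "\<dots> = (norm x)\<^sup>2"
    using lborel_integral_real_affine[of "-1" "\<lambda>\<xi>. (cmod (f \<xi>))\<^sup>2" 0]
    by (simp add: f L2_norm_squared)
  finally show ?thesis by simp
qed

lemma bounded_linear_conj_reflect: "bounded_linear conj_reflect"
  by (rule bounded_linear_intro[where K = 1]) (simp_all add: conj_reflect_add conj_reflect_scaleR norm_conj_reflect)

text \<open>
  Multipliers with Hermitian symbol preserve real-valuedness.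
\<close>
lemma conj_reflect_symbol_op:
  assumes m: "bounded_symbol m" and sym: "\<And>\<xi>. cnj (m (- \<xi>)) = m \<xi>"
  shows "conj_reflect (symbol_op m x) = symbol_op m (conj_reflect x)"
  by (rule L2_exhaust[of x])
    (simp add: symbol_op_L2 conj_reflect_L2 m square_integrable_symbol square_integrable_conj_reflect sym)

lemma fourier_diff_AE:
  assumes "square_integrable f" "square_integrable g"
  shows "AE \<xi> in lborel. fourier (\<lambda>x. f x - g x) \<xi> = fourier f \<xi> - fourier g \<xi>"
  by (subst L2_eq_iff[symmetric])
    (simp_all add: assms fourier_diff L2_diff fourier_square_integrable square_integrable_diff)

lemma fourier_cmult_AE:
  assumes f: "square_integrable f"
  shows "AE \<xi> in lborel. fourier (\<lambda>x. c * f x) \<xi> = c * fourier f \<xi>"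
proof (subst L2_eq_iff[symmetric])
  show "L2 (fourier (\<lambda>x. c * f x)) = L2 (\<lambda>\<xi>. c * fourier f \<xi>)"
  proof (rule fourier_eqI)
    have "ft (trunc R (\<lambda>x. c * f x)) = (\<lambda>\<xi>. c * ft (trunc R f) \<xi>)" for R
      unfolding ft_def fun_eq_iff trunc_def
      by (auto simp: mult_ac simp flip: integral_mult_right_zero)
    then have "L2 (ft (trunc R (\<lambda>x. c * f x))) = symbol_op (\<lambda>_. c) (L2 (ft (trunc R f)))" for R
      by (simp add: symbol_op_L2 bounded_symbol_const ft_trunc_square_integrable f)
    moreover have "((\<lambda>R. symbol_op (\<lambda>_. c) (L2 (ft (trunc R f)))) \<longlongrightarrow> symbol_op (\<lambda>_. c) (L2 (fourier f))) at_top"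
      by (intro bounded_linear.tendsto[OF bounded_linear_symbol_op] bounded_symbol_const fourier_tendsto f)
    ultimately show "((\<lambda>R. L2 (ft (trunc R (\<lambda>x. c * f x)))) \<longlongrightarrow> L2 (\<lambda>\<xi>. c * fourier f \<xi>)) at_top"
      by (simp add: symbol_op_L2 bounded_symbol_const fourier_square_integrable f)
  qed (intro square_integrable_cmult f)
qed (intro square_integrable_cmult fourier_square_integrable f)+

lemma fourier_cnj_AE:
  assumes f: "square_integrable f"
  shows "AE \<xi> in lborel. fourier (\<lambda>x. cnj (f x)) \<xi> = cnj (fourier f (- \<xi>))"
proof (subst L2_eq_iff[symmetric])
  show "L2 (fourier (\<lambda>x. cnj (f x))) = L2 (\<lambda>\<xi>. cnj (fourier f (- \<xi>)))"
  proof (rule fourier_eqI)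
    have "ft (trunc R (\<lambda>x. cnj (f x))) \<xi> = cnj (ft (trunc R f) (- \<xi>))" for R \<xi>
    proof -
      have "cnj (ft (trunc R f) (- \<xi>)) = ft (\<lambda>x. cnj (trunc R f (- x))) (- \<xi>)"
        by (simp add: ft_cnj_reflect)
      also have "\<dots> = ft (trunc R (\<lambda>x. cnj (f x))) \<xi>"
        unfolding ft_def
        by (subst lborel_integral_real_affine[where c = "-1" and t = 0])
          (auto simp: trunc_def intro!: Bochner_Integration.integral_cong)
      finally show ?thesis by simp
    qed
    then have "L2 (ft (trunc R (\<lambda>x. cnj (f x)))) = conj_reflect (L2 (ft (trunc R f)))" for R
      by (subst conj_reflect_L2) (auto intro: ft_trunc_square_integrable f simp: fun_eq_iff intro!: arg_cong[where f = L2])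
    moreover have "((\<lambda>R. conj_reflect (L2 (ft (trunc R f)))) \<longlongrightarrow> conj_reflect (L2 (fourier f))) at_top"
      by (intro bounded_linear.tendsto[OF bounded_linear_conj_reflect] fourier_tendsto f)
    ultimately show "((\<lambda>R. L2 (ft (trunc R (\<lambda>x. cnj (f x))))) \<longlongrightarrow> L2 (\<lambda>\<xi>. cnj (fourier f (- \<xi>)))) at_top"
      by (simp add: conj_reflect_L2 fourier_square_integrable f)
  qed (intro square_integrable_cnj f)
qed (intro square_integrable_cnj square_integrable_conj_reflect fourier_square_integrable f)+

definition weight :: "real \<Rightarrow> real \<Rightarrow> real" where
  "weight s \<xi> = (1 + \<xi>\<^sup>2) powr (s / 2)"

lemma weight_measurable [measurable]: "weight s \<in> borel_measurable borel"
  unfolding weight_def by measurable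

lemma weight_pos: "weight s \<xi> > 0"
  unfolding weight_def by (simp add: add_pos_nonneg powr_gt_zero) (metis add_pos_nonneg less_irrefl zero_le_power2 zero_less_one)

lemma weight_squared: "(weight s \<xi>)\<^sup>2 = (1 + \<xi>\<^sup>2) powr s"
  unfolding weight_def power2_eq_square by (simp add: powr_add[symmetric])

lemma weight_ge_1: "s \<ge> 0 \<Longrightarrow> weight s \<xi> \<ge> 1"
  unfolding weight_def by (simp add: ge_one_powr_ge_zero)

lemma weight_reflect: "weight s (- \<xi>) = weight s \<xi>"
  by (simp add: weight_def)

text \<open>
  Since $1+(a+b)^2$ is at most four times the larger of $1+a^2$ and $1+b^2$.
\<close>
lemma weight_triangle:
  assumes s: "s \<ge> 0"
  shows "weight s (a + b) \<le> 2 powr s * (weight s a + weight s b)"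
proof -
  let ?m = "max (1 + a\<^sup>2) (1 + b\<^sup>2)"
  have "(a + b)\<^sup>2 \<le> 2 * a\<^sup>2 + 2 * b\<^sup>2"
    using zero_le_power2[of "a - b"] by (simp add: power2_eq_square algebra_simps)
  then have "1 + (a + b)\<^sup>2 \<le> 4 * ?m" by (simp add: max_def)
  then have "weight s (a + b) \<le> (4 * ?m) powr (s / 2)"
    unfolding weight_def using s by (intro powr_mono2) (auto simp: add_nonneg_nonneg)
  also have "\<dots> = 4 powr (s / 2) * ?m powr (s / 2)"
    by (rule powr_mult)
  also have "4 powr (s / 2) = (2 :: real) powr s"
    using powr_powr[of "2::real" 2 "s / 2"] by simp
  also have "?m powr (s / 2) \<le> weight s a + weight s b"
    using weight_pos[of s a] weight_pos[of s b] unfolding weight_def by (auto simp: max_def)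
  finally show ?thesis by simp
qed

text \<open>
  The isometric identification of $H^s$ with $L^2$.
\<close>
definition sobolev_l2 :: "real \<Rightarrow> (real \<Rightarrow> complex) \<Rightarrow> l2" where
  "sobolev_l2 s f = L2 (\<lambda>\<xi>. complex_of_real (weight s \<xi>) * fourier f \<xi>)"

lemma sobolev_iff:
  "f \<in> sobolev s \<longleftrightarrow> square_integrable f \<and>
     square_integrable (\<lambda>\<xi>. complex_of_real (weight s \<xi>) * fourier f \<xi>)"
proof (cases "square_integrable f")
  case True
  note [measurable] = square_integrableD[OF fourier_square_integrable[OF True]]
  show ?thesis
    unfolding sobolev_def square_integrable_def[of "\<lambda>\<xi>. complex_of_real (weight s \<xi>) * fourier f \<xi>"]
    using weight_squared[of s] True by (auto simp: norm_mult power_mult_distrib)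
qed (simp add: sobolev_def)

lemma
  assumes "f \<in> sobolev s"
  shows sobolev_square_integrable: "square_integrable f"
    and sobolev_weighted: "square_integrable (\<lambda>\<xi>. complex_of_real (weight s \<xi>) * fourier f \<xi>)"
  using assms by (auto simp: sobolev_iff)

lemma sobolev_norm_eq: "f \<in> sobolev s \<Longrightarrow> sobolev_norm s f = norm (sobolev_l2 s f)"
  unfolding sobolev_norm_def sobolev_l2_def
  by (rule real_sqrt_unique) (simp_all add: L2_norm_squared sobolev_weighted norm_mult power_mult_distrib weight_squared)

text \<open>
  Membership and the value of \<open>sobolev_l2\<close> can be read off from any explicit version of the
  transform. All closure properties of $H^s$ are obtained in this way.
\<close>
lemma sobolev_fourierI:
  assumes g: "square_integrable g" and F: "square_integrable (\<lambda>\<xi>. complex_of_real (weight s \<xi>) * F \<xi>)"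
    and eq: "AE \<xi> in lborel. fourier g \<xi> = F \<xi>"
  shows "g \<in> sobolev s" "sobolev_l2 s g = L2 (\<lambda>\<xi>. complex_of_real (weight s \<xi>) * F \<xi>)"
proof -
  note [measurable] = square_integrableD[OF fourier_square_integrable[OF g]]
  have eq': "AE \<xi> in lborel. complex_of_real (weight s \<xi>) * F \<xi> = complex_of_real (weight s \<xi>) * fourier g \<xi>"
    using eq by eventually_elim simp
  then have sq: "square_integrable (\<lambda>\<xi>. complex_of_real (weight s \<xi>) * fourier g \<xi>)"
    by (rule square_integrable_cong_AE[OF F, rotated]) measurable
  with g show "g \<in> sobolev s" by (simp add: sobolev_iff)
  show "sobolev_l2 s g = L2 (\<lambda>\<xi>. complex_of_real (weight s \<xi>) * F \<xi>)"
    unfolding sobolev_l2_def using eq' by (intro L2_cong_AE sq F) (auto elim: eventually_mono)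
qed

lemma sobolev_diff:
  assumes "f \<in> sobolev s" "g \<in> sobolev s"
  shows "(\<lambda>x. f x - g x) \<in> sobolev s" "sobolev_l2 s (\<lambda>x. f x - g x) = sobolev_l2 s f - sobolev_l2 s g"
proof -
  note sq = assms[THEN sobolev_square_integrable] and w = assms[THEN sobolev_weighted]
  have "square_integrable (\<lambda>\<xi>. complex_of_real (weight s \<xi>) * (fourier f \<xi> - fourier g \<xi>))"
    using square_integrable_diff[OF w] by (simp add: right_diff_distrib)
  note R = sobolev_fourierI[OF square_integrable_diff[OF sq] this fourier_diff_AE[OF sq]]
  show "(\<lambda>x. f x - g x) \<in> sobolev s" by (rule R)
  show "sobolev_l2 s (\<lambda>x. f x - g x) = sobolev_l2 s f - sobolev_l2 s g"
    unfolding R(2) by (simp add: right_diff_distrib L2_diff w sobolev_l2_def)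
qed

lemma sobolev_cmult:
  assumes "f \<in> sobolev s"
  shows "(\<lambda>x. c * f x) \<in> sobolev s" "sobolev_l2 s (\<lambda>x. c * f x) = symbol_op (\<lambda>_. c) (sobolev_l2 s f)"
proof -
  note sq = assms[THEN sobolev_square_integrable] and w = assms[THEN sobolev_weighted]
  have "square_integrable (\<lambda>\<xi>. complex_of_real (weight s \<xi>) * (c * fourier f \<xi>))"
    using square_integrable_cmult[OF w, of c] by (simp add: mult_ac)
  note R = sobolev_fourierI[OF square_integrable_cmult[OF sq] this fourier_cmult_AE[OF sq]]
  show "(\<lambda>x. c * f x) \<in> sobolev s" by (rule R)
  show "sobolev_l2 s (\<lambda>x. c * f x) = symbol_op (\<lambda>_. c) (sobolev_l2 s f)"
    unfolding R(2) unfolding sobolev_l2_def by (subst symbol_op_L2[OF bounded_symbol_const w]) (simp add: mult_ac)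
qed

lemma sobolev_scaleR:
  assumes f: "f \<in> sobolev s"
  shows "(\<lambda>x. c *\<^sub>R f x) \<in> sobolev s" "sobolev_l2 s (\<lambda>x. c *\<^sub>R f x) = c *\<^sub>R sobolev_l2 s f"
proof -
  show "(\<lambda>x. c *\<^sub>R f x) \<in> sobolev s"
    using sobolev_cmult(1)[OF f, of "complex_of_real c"] by (simp add: scaleR_conv_of_real)
  have "sobolev_l2 s (\<lambda>x. complex_of_real c * f x) = c *\<^sub>R sobolev_l2 s f"
    unfolding sobolev_cmult(2)[OF f] unfolding sobolev_l2_def
    by (simp add: symbol_op_L2 bounded_symbol_const sobolev_weighted f L2_scaleR[symmetric] scaleR_conv_of_real)
  then show "sobolev_l2 s (\<lambda>x. c *\<^sub>R f x) = c *\<^sub>R sobolev_l2 s f" by (simp add: scaleR_conv_of_real)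
qed

lemma sobolev_zero: "(\<lambda>x. 0) \<in> sobolev s" "sobolev_l2 s (\<lambda>x. 0) = 0"
proof -
  have "AE \<xi> in lborel. fourier (\<lambda>x. 0) \<xi> = 0"
    using fourier_diff_AE[of "\<lambda>x. 0" "\<lambda>x. 0"] by simp
  from sobolev_fourierI[OF square_integrable_zero _ this, of s]
  show "(\<lambda>x. 0) \<in> sobolev s" "sobolev_l2 s (\<lambda>x. 0) = 0" by (simp_all add: L2_zero)
qed

lemma sobolev_add:
  assumes "f \<in> sobolev s" "g \<in> sobolev s"
  shows "(\<lambda>x. f x + g x) \<in> sobolev s" "sobolev_l2 s (\<lambda>x. f x + g x) = sobolev_l2 s f + sobolev_l2 s g"
  using sobolev_diff[OF assms(1) sobolev_scaleR(1)[OF assms(2)], of "-1"] sobolev_scaleR(2)[OF assms(2), of "-1"]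
  by simp_all

lemma sobolev_sum:
  assumes "finite A" "\<And>i. i \<in> A \<Longrightarrow> f i \<in> sobolev s"
  shows "(\<lambda>x. \<Sum>i\<in>A. c i *\<^sub>R f i x) \<in> sobolev s \<and> sobolev_l2 s (\<lambda>x. \<Sum>i\<in>A. c i *\<^sub>R f i x) = (\<Sum>i\<in>A. c i *\<^sub>R sobolev_l2 s (f i))"
  using assms by (induction A) (simp_all add: sobolev_zero sobolev_add sobolev_scaleR)

lemma sobolev_l2_cong_AE:
  assumes "f \<in> sobolev s" "g \<in> borel_measurable borel" "AE x in lborel. f x = g x"
  shows "g \<in> sobolev s" "sobolev_l2 s g = sobolev_l2 s f"
proof -
  have f: "square_integrable f" using assms sobolev_square_integrable by blast
  have "square_integrable g" using square_integrable_cong_AE[OF f assms(2,3)] .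
  moreover have "fourier f = fourier g"
    using f assms by (intro fourier_cong_AE) auto
  ultimately show "g \<in> sobolev s" "sobolev_l2 s g = sobolev_l2 s f" using assms(1) by (simp_all add: sobolev_iff sobolev_l2_def)
qed

lemma sobolev_l2_inject:
  assumes "f \<in> sobolev s" "g \<in> sobolev s"
  shows "sobolev_l2 s f = sobolev_l2 s g \<longleftrightarrow> (AE x in lborel. f x = g x)"
proof
  note sq = assms[THEN sobolev_square_integrable]
  assume "sobolev_l2 s f = sobolev_l2 s g"
  then have "AE \<xi> in lborel. complex_of_real (weight s \<xi>) * fourier f \<xi> = complex_of_real (weight s \<xi>) * fourier g \<xi>"
    unfolding sobolev_l2_def by (subst (asm) L2_eq_iff) (intro sobolev_weighted assms)+
  then have "AE \<xi> in lborel. fourier f \<xi> = fourier g \<xi>"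
    using weight_pos[of s] by (auto simp: less_le)
  then have "L2 (fourier f) = L2 (fourier g)"
    by (intro L2_cong_AE fourier_square_integrable sq)
  then show "AE x in lborel. f x = g x"
    using fourier_inj[OF sq] L2_eq_iff[OF sq] by blast
next
  assume "AE x in lborel. f x = g x"
  then show "sobolev_l2 s f = sobolev_l2 s g" using sobolev_l2_cong_AE(2)[OF assms(1)] sobolev_square_integrable[OF assms(2)] by auto
qed

text \<open>
  Divide by the weight and invert the Fourier transform.
\<close>
lemma sobolev_l2_surj:
  assumes s: "s \<ge> 0"
  shows "\<exists>f. f \<in> sobolev s \<and> sobolev_l2 s f = U"
proof (rule L2_exhaust[of U])
  fix V assume V: "square_integrable V" "U = L2 V"
  let ?F = "\<lambda>\<xi>. complex_of_real (1 / weight s \<xi>) * V \<xi>"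
  have F: "square_integrable ?F"
  proof (rule square_integrable_mult_bounded[where C = 1, OF V(1)])
    show "cmod (complex_of_real (1 / weight s \<xi>)) \<le> 1" for \<xi>
      using weight_ge_1[OF s, of \<xi>] by (simp add: norm_divide)
  qed measurable
  have wF: "(\<lambda>\<xi>. complex_of_real (weight s \<xi>) * ?F \<xi>) = V"
    using weight_pos[of s] by (auto simp: fun_eq_iff less_le)
  have "AE \<xi> in lborel. fourier (ifourier ?F) \<xi> = ?F \<xi>"
    by (rule iffD1[OF L2_eq_iff fourier_ifourier[OF F]])
      (intro F fourier_square_integrable ifourier_square_integrable)+
  from sobolev_fourierI[OF ifourier_square_integrable[OF F] _ this, of s]
  show ?thesis unfolding wF using V by blast
qed

lemma fourier_multiplier_spec:
  assumes m: "bounded_symbol m" and f: "square_integrable f"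
  shows "square_integrable (fourier_multiplier m f) \<and>
    (AE \<xi> in lborel. fourier (fourier_multiplier m f) \<xi> = m \<xi> * fourier f \<xi>)"
  unfolding fourier_multiplier_def
proof (rule someI_ex[where P = "\<lambda>g. square_integrable g \<and> (AE \<xi> in lborel. fourier g \<xi> = m \<xi> * fourier f \<xi>)"])
  have F: "square_integrable (\<lambda>\<xi>. m \<xi> * fourier f \<xi>)"
    by (intro square_integrable_symbol m fourier_square_integrable f)
  have "AE \<xi> in lborel. fourier (ifourier (\<lambda>\<xi>. m \<xi> * fourier f \<xi>)) \<xi> = m \<xi> * fourier f \<xi>"
    by (rule iffD1[OF L2_eq_iff fourier_ifourier[OF F]])
      (intro F fourier_square_integrable ifourier_square_integrable)+
  then show "\<exists>g. square_integrable g \<and> (AE \<xi> in lborel. fourier g \<xi> = m \<xi> * fourier f \<xi>)"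
    using ifourier_square_integrable[OF F] by blast
qed

lemma sobolev_fourier_multiplier:
  assumes m: "bounded_symbol m" and f: "f \<in> sobolev s"
  shows "fourier_multiplier m f \<in> sobolev s" "sobolev_l2 s (fourier_multiplier m f) = symbol_op m (sobolev_l2 s f)"
proof -
  note S = fourier_multiplier_spec[OF m sobolev_square_integrable[OF f]]
  have eq: "(\<lambda>\<xi>. complex_of_real (weight s \<xi>) * (m \<xi> * fourier f \<xi>))
     = (\<lambda>\<xi>. m \<xi> * (complex_of_real (weight s \<xi>) * fourier f \<xi>))" by (simp add: mult_ac)
  have w: "square_integrable (\<lambda>\<xi>. complex_of_real (weight s \<xi>) * (m \<xi> * fourier f \<xi>))"
    unfolding eq by (intro square_integrable_symbol m sobolev_weighted f)
  note R = sobolev_fourierI[OF conjunct1[OF S] w conjunct2[OF S]]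
  show "fourier_multiplier m f \<in> sobolev s" by (rule R)
  show "sobolev_l2 s (fourier_multiplier m f) = symbol_op m (sobolev_l2 s f)"
    unfolding R(2) eq unfolding sobolev_l2_def by (simp add: symbol_op_L2 m sobolev_weighted f)
qed

lemma sobolev_cnj:
  assumes f: "f \<in> sobolev s"
  shows "(\<lambda>x. cnj (f x)) \<in> sobolev s" "sobolev_l2 s (\<lambda>x. cnj (f x)) = conj_reflect (sobolev_l2 s f)"
proof -
  note sq = sobolev_square_integrable[OF f]
  have eq: "(\<lambda>\<xi>. complex_of_real (weight s \<xi>) * cnj (fourier f (- \<xi>)))
     = (\<lambda>\<xi>. cnj (complex_of_real (weight s (- \<xi>)) * fourier f (- \<xi>)))"
    by (simp add: weight_reflect)
  have w: "square_integrable (\<lambda>\<xi>. complex_of_real (weight s \<xi>) * cnj (fourier f (- \<xi>)))"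
    unfolding eq by (rule square_integrable_conj_reflect[OF sobolev_weighted[OF f]])
  note R = sobolev_fourierI[OF square_integrable_cnj[OF sq] w fourier_cnj_AE[OF sq]]
  show "(\<lambda>x. cnj (f x)) \<in> sobolev s" by (rule R)
  show "sobolev_l2 s (\<lambda>x. cnj (f x)) = conj_reflect (sobolev_l2 s f)"
    unfolding R(2) eq unfolding sobolev_l2_def conj_reflect_L2[OF sobolev_weighted[OF f]] ..
qed

section \<open>Products in Sobolev spaces\<close>

text \<open>
  Split $p\,q = (p\sqrt q)\sqrt q$, apply the Cauchy--Schwarz inequality in $\eta$ and then Tonelli's
  theorem.
\<close>
lemma Young_L2_L1:
  fixes p q :: "real \<Rightarrow> real"
  assumes [measurable]: "p \<in> borel_measurable borel" "q \<in> borel_measurable borel"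
    and nonneg: "\<And>x. 0 \<le> p x" "\<And>x. 0 \<le> q x"
  shows "(\<integral>\<^sup>+\<zeta>. (\<integral>\<^sup>+\<eta>. ennreal (p (\<zeta> - \<eta>) * q \<eta>) \<partial>lborel)\<^sup>2 \<partial>lborel)
    \<le> (\<integral>\<^sup>+x. ennreal ((p x)\<^sup>2) \<partial>lborel) * (\<integral>\<^sup>+x. ennreal (q x) \<partial>lborel)\<^sup>2"
proof -
  let ?P = "\<integral>\<^sup>+x. ennreal ((p x)\<^sup>2) \<partial>lborel" and ?Q = "\<integral>\<^sup>+x. ennreal (q x) \<partial>lborel"
  have "(\<integral>\<^sup>+\<eta>. ennreal (p (\<zeta> - \<eta>) * q \<eta>) \<partial>lborel)\<^sup>2
      \<le> (\<integral>\<^sup>+\<eta>. ennreal ((p (\<zeta> - \<eta>))\<^sup>2 * q \<eta>) \<partial>lborel) * ?Q" for \<zeta>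
  proof -
    have "(\<integral>\<^sup>+\<eta>. ennreal (p (\<zeta> - \<eta>) * q \<eta>) \<partial>lborel)
        = (\<integral>\<^sup>+\<eta>. ennreal (p (\<zeta> - \<eta>) * sqrt (q \<eta>)) * ennreal (sqrt (q \<eta>)) \<partial>lborel)"
      by (intro nn_integral_cong) (simp add: ennreal_mult[symmetric] nonneg mult.assoc)
    also have "\<dots>\<^sup>2 \<le> (\<integral>\<^sup>+\<eta>. (ennreal (p (\<zeta> - \<eta>) * sqrt (q \<eta>)))\<^sup>2 \<partial>lborel) * (\<integral>\<^sup>+\<eta>. (ennreal (sqrt (q \<eta>)))\<^sup>2 \<partial>lborel)"
      by (rule Cauchy_Schwarz_nn_integral) measurable
    also have "(\<integral>\<^sup>+\<eta>. (ennreal (p (\<zeta> - \<eta>) * sqrt (q \<eta>)))\<^sup>2 \<partial>lborel) = (\<integral>\<^sup>+\<eta>. ennreal ((p (\<zeta> - \<eta>))\<^sup>2 * q \<eta>) \<partial>lborel)"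
      by (intro nn_integral_cong) (simp add: ennreal_power nonneg power_mult_distrib)
    also have "(\<integral>\<^sup>+\<eta>. (ennreal (sqrt (q \<eta>)))\<^sup>2 \<partial>lborel) = ?Q"
      by (intro nn_integral_cong) (simp add: ennreal_power nonneg)
    finally show ?thesis .
  qed
  then have "(\<integral>\<^sup>+\<zeta>. (\<integral>\<^sup>+\<eta>. ennreal (p (\<zeta> - \<eta>) * q \<eta>) \<partial>lborel)\<^sup>2 \<partial>lborel)
      \<le> (\<integral>\<^sup>+\<zeta>. (\<integral>\<^sup>+\<eta>. ennreal ((p (\<zeta> - \<eta>))\<^sup>2 * q \<eta>) \<partial>lborel) * ?Q \<partial>lborel)"
    by (rule nn_integral_mono)
  also have "\<dots> = (\<integral>\<^sup>+\<zeta>. \<integral>\<^sup>+\<eta>. ennreal ((p (\<zeta> - \<eta>))\<^sup>2 * q \<eta>) \<partial>lborel \<partial>lborel) * ?Q"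
    by (rule nn_integral_multc) measurable
  also have "(\<integral>\<^sup>+\<zeta>. \<integral>\<^sup>+\<eta>. ennreal ((p (\<zeta> - \<eta>))\<^sup>2 * q \<eta>) \<partial>lborel \<partial>lborel)
      = (\<integral>\<^sup>+\<eta>. \<integral>\<^sup>+\<zeta>. ennreal ((p (\<zeta> - \<eta>))\<^sup>2 * q \<eta>) \<partial>lborel \<partial>lborel)"
    by (rule lborel_pair.Fubini') measurable
  also have "\<dots> = (\<integral>\<^sup>+\<eta>. ?P * ennreal (q \<eta>) \<partial>lborel)"
  proof (rule nn_integral_cong)
    fix \<eta>
    have "(\<integral>\<^sup>+\<zeta>. ennreal ((p (\<zeta> - \<eta>))\<^sup>2 * q \<eta>) \<partial>lborel) = (\<integral>\<^sup>+\<zeta>. ennreal ((p (\<zeta> - \<eta>))\<^sup>2) * ennreal (q \<eta>) \<partial>lborel)"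
      by (simp add: ennreal_mult nonneg)
    also have "\<dots> = (\<integral>\<^sup>+\<zeta>. ennreal ((p (\<zeta> - \<eta>))\<^sup>2) \<partial>lborel) * ennreal (q \<eta>)"
      by (rule nn_integral_multc) measurable
    also have "(\<integral>\<^sup>+\<zeta>. ennreal ((p (\<zeta> - \<eta>))\<^sup>2) \<partial>lborel) = ?P"
      using nn_integral_real_affine[of "\<lambda>x. ennreal ((p x)\<^sup>2)" 1 "- \<eta>"] by simp
    finally show "(\<integral>\<^sup>+\<zeta>. ennreal ((p (\<zeta> - \<eta>))\<^sup>2 * q \<eta>) \<partial>lborel) = ?P * ennreal (q \<eta>)" .
  qed
  also have "\<dots> = ?P * ?Q"
    by (rule nn_integral_cmult) measurable
  finally show ?thesis by (simp add: power2_eq_square mult.assoc)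
qed

lemma integrable_inverse_1_plus_square_UNIV: "integrable lborel (\<lambda>x::real. inverse (1 + x\<^sup>2))"
  using integrable_inverse_1_plus_square by (simp add: set_integrable_def einterval_eq_UNIV)

text \<open>
  The constant is $\pi$, the squared $L^2$ norm of $\langle\xi\rangle^{-1}$.
\<close>
definition cauchy_mass :: real where
  "cauchy_mass = (LINT x|lborel. inverse (1 + x\<^sup>2))"

text \<open>
  The embedding of $H^s$ into functions with integrable transform, by the Cauchy--Schwarz inequality
  against $\langle\xi\rangle^{-s}$, which for $s \ge 1$ is square integrable as $(1+\xi^2)^{-1}$ is
  integrable.
\<close>
lemma sobolev_fourier_integrable:
  assumes f: "f \<in> sobolev s" and s: "s \<ge> 1"
  shows "(\<integral>\<^sup>+\<xi>. ennreal (cmod (fourier f \<xi>)) \<partial>lborel)\<^sup>2 \<le> ennreal ((norm (sobolev_l2 s f))\<^sup>2 * cauchy_mass)"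
    and "integrable lborel (fourier f)"
proof -
  note [measurable] = square_integrableD[OF fourier_square_integrable[OF sobolev_square_integrable[OF f]]]
  have w: "weight s \<xi> > 0" for \<xi> by (rule weight_pos)
  have "(\<integral>\<^sup>+\<xi>. ennreal (cmod (fourier f \<xi>)) \<partial>lborel)
      = (\<integral>\<^sup>+\<xi>. ennreal (weight s \<xi> * cmod (fourier f \<xi>)) * ennreal (inverse (weight s \<xi>)) \<partial>lborel)"
  proof (rule nn_integral_cong)
    fix \<xi>
    show "ennreal (cmod (fourier f \<xi>)) = ennreal (weight s \<xi> * cmod (fourier f \<xi>)) * ennreal (inverse (weight s \<xi>))"
      using w[of \<xi>] by (simp add: ennreal_mult[symmetric] field_simps)
  qed
  also have "\<dots>\<^sup>2 \<le> (\<integral>\<^sup>+\<xi>. (ennreal (weight s \<xi> * cmod (fourier f \<xi>)))\<^sup>2 \<partial>lborel)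
      * (\<integral>\<^sup>+\<xi>. (ennreal (inverse (weight s \<xi>)))\<^sup>2 \<partial>lborel)"
    by (rule Cauchy_Schwarz_nn_integral) measurable
  also have "(\<integral>\<^sup>+\<xi>. (ennreal (weight s \<xi> * cmod (fourier f \<xi>)))\<^sup>2 \<partial>lborel) = ennreal ((norm (sobolev_l2 s f))\<^sup>2)"
    unfolding sobolev_l2_def L2_norm_nn[OF sobolev_weighted[OF f], symmetric]
    using w by (intro nn_integral_cong) (simp add: ennreal_power norm_mult less_imp_le)
  also have "(\<integral>\<^sup>+\<xi>. (ennreal (inverse (weight s \<xi>)))\<^sup>2 \<partial>lborel) \<le> (\<integral>\<^sup>+\<xi>. ennreal (inverse (1 + \<xi>\<^sup>2)) \<partial>lborel)"
  proof (rule nn_integral_mono)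
    fix \<xi> :: real
    have "(1 + \<xi>\<^sup>2) powr 1 \<le> (1 + \<xi>\<^sup>2) powr s" using s by (intro powr_mono) auto
    then have "1 + \<xi>\<^sup>2 \<le> (weight s \<xi>)\<^sup>2" by (simp add: weight_squared add_nonneg_nonneg)
    then have "inverse ((weight s \<xi>)\<^sup>2) \<le> inverse (1 + \<xi>\<^sup>2)"
      by (intro le_imp_inverse_le) (auto simp: add_pos_nonneg)
    then show "(ennreal (inverse (weight s \<xi>)))\<^sup>2 \<le> ennreal (inverse (1 + \<xi>\<^sup>2))"
      using w[of \<xi>] by (simp add: ennreal_power power_inverse ennreal_leI less_imp_le)
  qed
  also have "(\<integral>\<^sup>+\<xi>. ennreal (inverse (1 + \<xi>\<^sup>2)) \<partial>lborel) = ennreal cauchy_mass"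
    unfolding cauchy_mass_def
    by (intro nn_integral_eq_integral integrable_inverse_1_plus_square_UNIV) (auto simp: add_nonneg_nonneg)
  also have "ennreal ((norm (sobolev_l2 s f))\<^sup>2) * ennreal cauchy_mass = ennreal ((norm (sobolev_l2 s f))\<^sup>2 * cauchy_mass)"
    by (subst ennreal_mult') auto
  finally show le: "(\<integral>\<^sup>+\<xi>. ennreal (cmod (fourier f \<xi>)) \<partial>lborel)\<^sup>2 \<le> ennreal ((norm (sobolev_l2 s f))\<^sup>2 * cauchy_mass)"
    by (simp add: mult_left_mono)
  have "(\<integral>\<^sup>+\<xi>. ennreal (cmod (fourier f \<xi>)) \<partial>lborel) \<noteq> top"
  proof
    assume "(\<integral>\<^sup>+\<xi>. ennreal (cmod (fourier f \<xi>)) \<partial>lborel) = top"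
    with le show False by (simp add: power2_eq_square ennreal_mult_top top_unique)
  qed
  then show "integrable lborel (fourier f)"
    by (simp add: integrable_iff_bounded less_top)
qed

lemma ennreal_add_square_le: "(x + y)\<^sup>2 \<le> 4 * (x\<^sup>2 + y\<^sup>2)" for x y :: ennreal
proof -
  have *: "(x + y)\<^sup>2 \<le> 4 * (x\<^sup>2 + y\<^sup>2)" if "x \<le> y" for x y :: ennreal
  proof -
    have "(x + y)\<^sup>2 \<le> (2 * y)\<^sup>2"
      using that by (intro power_mono) (auto simp: mult_2 add_right_mono)
    also have "\<dots> = 4 * y\<^sup>2" by (simp add: power_mult_distrib)
    also have "\<dots> \<le> 4 * (x\<^sup>2 + y\<^sup>2)" by (intro mult_left_mono) auto
    finally show ?thesis .
  qed
  show ?thesis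
  proof (cases "x \<le> y")
    case False
    then show ?thesis using *[of y x] by (simp add: add.commute)
  qed (rule *)
qed

text \<open>
  The weight is distributed over the two factors of the convolution, and each of the two resulting
  terms is estimated by Young's inequality with the weighted factor in $L^2$ and the other in $L^1$.
\<close>
lemma convolution_weighted_bound:
  assumes u: "u \<in> sobolev s" and v: "v \<in> sobolev s" and s: "s \<ge> 1"
  defines "H \<equiv> convolution (fourier u) (fourier v)"
  shows "(\<integral>\<^sup>+\<zeta>. ennreal ((weight s \<zeta> * cmod (H \<zeta>))\<^sup>2) \<partial>lborel)
    \<le> ennreal ((2 powr s)\<^sup>2 * 8 * cauchy_mass * (norm (sobolev_l2 s u) * norm (sobolev_l2 s v))\<^sup>2)"
proof -
  let ?F = "fourier u" and ?G = "fourier v"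
  have s0: "s \<ge> 0" using s by simp
  note [measurable] = square_integrableD[OF fourier_square_integrable[OF sobolev_square_integrable[OF u]]]
    square_integrableD[OF fourier_square_integrable[OF sobolev_square_integrable[OF v]]]
  have wpos: "0 \<le> weight s \<xi>" for \<xi> using weight_pos less_imp_le by blast
  have mass: "0 \<le> cauchy_mass" unfolding cauchy_mass_def by (intro Bochner_Integration.integral_nonneg) (auto simp: add_nonneg_nonneg)
  \<comment> \<open>the weighted factor carries the shifted argument in both terms\<close>
  define A where "A \<zeta> = (\<integral>\<^sup>+\<eta>. ennreal ((weight s (\<zeta> - \<eta>) * cmod (?F (\<zeta> - \<eta>))) * cmod (?G \<eta>)) \<partial>lborel)" for \<zeta>
  define B where "B \<zeta> = (\<integral>\<^sup>+\<eta>. ennreal ((weight s (\<zeta> - \<eta>) * cmod (?G (\<zeta> - \<eta>))) * cmod (?F \<eta>)) \<partial>lborel)" for \<zeta>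
  have [measurable]: "A \<in> borel_measurable borel" "B \<in> borel_measurable borel"
    unfolding A_def B_def by measurable
  have young: "(\<integral>\<^sup>+\<zeta>. (\<integral>\<^sup>+\<eta>. ennreal ((weight s (\<zeta> - \<eta>) * cmod (fourier f (\<zeta> - \<eta>))) * cmod (fourier g \<eta>)) \<partial>lborel)\<^sup>2 \<partial>lborel)
     \<le> ennreal (cauchy_mass * (norm (sobolev_l2 s f) * norm (sobolev_l2 s g))\<^sup>2)" if f: "f \<in> sobolev s" and g: "g \<in> sobolev s" for f g
  proof -
    note [measurable] = square_integrableD[OF fourier_square_integrable[OF sobolev_square_integrable[OF f]]]
      square_integrableD[OF fourier_square_integrable[OF sobolev_square_integrable[OF g]]]
    have "(\<integral>\<^sup>+\<zeta>. (\<integral>\<^sup>+\<eta>. ennreal ((weight s (\<zeta> - \<eta>) * cmod (fourier f (\<zeta> - \<eta>))) * cmod (fourier g \<eta>)) \<partial>lborel)\<^sup>2 \<partial>lborel)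
       \<le> (\<integral>\<^sup>+x. ennreal ((weight s x * cmod (fourier f x))\<^sup>2) \<partial>lborel) * (\<integral>\<^sup>+x. ennreal (cmod (fourier g x)) \<partial>lborel)\<^sup>2"
      by (rule Young_L2_L1) (auto simp: wpos)
    also have "(\<integral>\<^sup>+x. ennreal ((weight s x * cmod (fourier f x))\<^sup>2) \<partial>lborel) = ennreal ((norm (sobolev_l2 s f))\<^sup>2)"
      unfolding sobolev_l2_def L2_norm_nn[OF sobolev_weighted[OF f], symmetric]
      by (intro nn_integral_cong) (simp add: norm_mult wpos)
    also have "ennreal ((norm (sobolev_l2 s f))\<^sup>2) * (\<integral>\<^sup>+x. ennreal (cmod (fourier g x)) \<partial>lborel)\<^sup>2
        \<le> ennreal ((norm (sobolev_l2 s f))\<^sup>2) * ennreal ((norm (sobolev_l2 s g))\<^sup>2 * cauchy_mass)"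
      by (intro mult_left_mono sobolev_fourier_integrable(1)[OF g s]) auto
    also have "\<dots> = ennreal (cauchy_mass * (norm (sobolev_l2 s f) * norm (sobolev_l2 s g))\<^sup>2)"
      using mass by (simp add: ennreal_mult[symmetric] power_mult_distrib mult_ac)
    finally show ?thesis .
  qed
  have distr: "ennreal (a * (b + c)) = ennreal a * (ennreal b + ennreal c)" if "0 \<le> a" "0 \<le> b" "0 \<le> c" for a b c
    using that by (simp add: ennreal_mult)
  have pointwise: "ennreal (weight s \<zeta> * cmod (H \<zeta>)) \<le> ennreal (2 powr s) * (A \<zeta> + B \<zeta>)" for \<zeta>
  proof -
    have "ennreal (cmod (H \<zeta>)) \<le> (\<integral>\<^sup>+\<eta>. ennreal (cmod (?F (\<zeta> - \<eta>)) * cmod (?G \<eta>)) \<partial>lborel)"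
    proof (cases "integrable lborel (\<lambda>\<eta>. ?F (\<zeta> - \<eta>) * ?G \<eta>)")
      case True
      from integral_norm_bound_ennreal[OF this] show ?thesis
        unfolding H_def convolution_def by (simp add: norm_mult)
    next
      case False
      then show ?thesis unfolding H_def convolution_def by (simp add: not_integrable_integral_eq)
    qed
    then have "ennreal (weight s \<zeta> * cmod (H \<zeta>)) \<le> ennreal (weight s \<zeta>) * (\<integral>\<^sup>+\<eta>. ennreal (cmod (?F (\<zeta> - \<eta>)) * cmod (?G \<eta>)) \<partial>lborel)"
      by (subst ennreal_mult) (auto simp: wpos mult_left_mono)
    also have "\<dots> = (\<integral>\<^sup>+\<eta>. ennreal (weight s \<zeta> * (cmod (?F (\<zeta> - \<eta>)) * cmod (?G \<eta>))) \<partial>lborel)"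
      by (subst nn_integral_cmult[symmetric]) (auto simp: ennreal_mult wpos)
    also have "\<dots> \<le> (\<integral>\<^sup>+\<eta>. ennreal (2 powr s) * (ennreal ((weight s (\<zeta> - \<eta>) * cmod (?F (\<zeta> - \<eta>))) * cmod (?G \<eta>))
        + ennreal ((weight s \<eta> * cmod (?G \<eta>)) * cmod (?F (\<zeta> - \<eta>)))) \<partial>lborel)"
    proof (rule nn_integral_mono)
      fix \<eta>
      have "weight s \<zeta> \<le> 2 powr s * (weight s (\<zeta> - \<eta>) + weight s \<eta>)"
        using weight_triangle[OF s0, of "\<zeta> - \<eta>" \<eta>] by simp
      then have "weight s \<zeta> * (cmod (?F (\<zeta> - \<eta>)) * cmod (?G \<eta>))
          \<le> 2 powr s * (weight s (\<zeta> - \<eta>) + weight s \<eta>) * (cmod (?F (\<zeta> - \<eta>)) * cmod (?G \<eta>))"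
        by (intro mult_right_mono) auto
      also have "\<dots> = 2 powr s * ((weight s (\<zeta> - \<eta>) * cmod (?F (\<zeta> - \<eta>))) * cmod (?G \<eta>)
        + (weight s \<eta> * cmod (?G \<eta>)) * cmod (?F (\<zeta> - \<eta>)))"
        by (simp add: algebra_simps)
      finally have "ennreal (weight s \<zeta> * (cmod (?F (\<zeta> - \<eta>)) * cmod (?G \<eta>))) \<le> ennreal \<dots>"
        by (rule ennreal_leI)
      then show "ennreal (weight s \<zeta> * (cmod (?F (\<zeta> - \<eta>)) * cmod (?G \<eta>)))
          \<le> ennreal (2 powr s) * (ennreal ((weight s (\<zeta> - \<eta>) * cmod (?F (\<zeta> - \<eta>))) * cmod (?G \<eta>))
        + ennreal ((weight s \<eta> * cmod (?G \<eta>)) * cmod (?F (\<zeta> - \<eta>))))"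
        by (subst (asm) distr) (auto simp: wpos)
    qed
    also have "\<dots> = ennreal (2 powr s) * (A \<zeta> + (\<integral>\<^sup>+\<eta>. ennreal ((weight s \<eta> * cmod (?G \<eta>)) * cmod (?F (\<zeta> - \<eta>))) \<partial>lborel))"
      unfolding A_def by (subst nn_integral_cmult, measurable, subst nn_integral_add) auto
    also have "(\<integral>\<^sup>+\<eta>. ennreal ((weight s \<eta> * cmod (?G \<eta>)) * cmod (?F (\<zeta> - \<eta>))) \<partial>lborel) = B \<zeta>"
      unfolding B_def by (subst nn_integral_real_affine[where c = "-1" and t = \<zeta>]) auto
    finally show ?thesis .
  qed
  have "(\<integral>\<^sup>+\<zeta>. ennreal ((weight s \<zeta> * cmod (H \<zeta>))\<^sup>2) \<partial>lborel)
      \<le> (\<integral>\<^sup>+\<zeta>. ennreal ((2 powr s)\<^sup>2 * 4) * ((A \<zeta>)\<^sup>2 + (B \<zeta>)\<^sup>2) \<partial>lborel)"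
  proof (rule nn_integral_mono)
    fix \<zeta>
    have "ennreal ((weight s \<zeta> * cmod (H \<zeta>))\<^sup>2) = (ennreal (weight s \<zeta> * cmod (H \<zeta>)))\<^sup>2"
      by (simp add: ennreal_power wpos)
    also have "\<dots> \<le> (ennreal (2 powr s) * (A \<zeta> + B \<zeta>))\<^sup>2"
      by (intro power_mono pointwise) auto
    also have "\<dots> \<le> (ennreal (2 powr s))\<^sup>2 * (4 * ((A \<zeta>)\<^sup>2 + (B \<zeta>)\<^sup>2))"
      unfolding power_mult_distrib by (intro mult_left_mono ennreal_add_square_le) auto
    also have "\<dots> = ennreal ((2 powr s)\<^sup>2 * 4) * ((A \<zeta>)\<^sup>2 + (B \<zeta>)\<^sup>2)"
      by (simp add: ennreal_mult ennreal_power mult.assoc)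
    finally show "ennreal ((weight s \<zeta> * cmod (H \<zeta>))\<^sup>2) \<le> ennreal ((2 powr s)\<^sup>2 * 4) * ((A \<zeta>)\<^sup>2 + (B \<zeta>)\<^sup>2)" .
  qed
  also have "\<dots> = ennreal ((2 powr s)\<^sup>2 * 4) * ((\<integral>\<^sup>+\<zeta>. (A \<zeta>)\<^sup>2 \<partial>lborel) + (\<integral>\<^sup>+\<zeta>. (B \<zeta>)\<^sup>2 \<partial>lborel))"
    by (subst nn_integral_cmult, measurable, subst nn_integral_add) auto
  also have "\<dots> \<le> ennreal ((2 powr s)\<^sup>2 * 4) * (ennreal (cauchy_mass * (norm (sobolev_l2 s u) * norm (sobolev_l2 s v))\<^sup>2)
      + ennreal (cauchy_mass * (norm (sobolev_l2 s v) * norm (sobolev_l2 s u))\<^sup>2))"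
    unfolding A_def B_def by (intro mult_left_mono add_mono young u v) auto
  also have "\<dots> = ennreal ((2 powr s)\<^sup>2 * 8 * cauchy_mass * (norm (sobolev_l2 s u) * norm (sobolev_l2 s v))\<^sup>2)"
    using mass by (simp add: ennreal_mult[symmetric] mult_ac flip: ennreal_plus)
  finally show ?thesis .
qed

lemma ifourier_eq_fourier_integral:
  assumes "square_integrable F" "integrable lborel F"
  shows "AE x in lborel. ifourier F x = cnj (ft (\<lambda>\<xi>. cnj (F \<xi>)) x)"
proof -
  have i: "integrable lborel (\<lambda>\<xi>. cnj (F \<xi>))" using assms by simp
  have "AE x in lborel. fourier (\<lambda>\<xi>. cnj (F \<xi>)) x = ft (\<lambda>\<xi>. cnj (F \<xi>)) x"
    using fourier_eq_fourier_integral[OF square_integrable_cnj[OF assms(1)] i]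
    by (subst L2_eq_iff[symmetric])
      (auto intro: fourier_square_integrable square_integrable_cnj Plancherel_integrable assms i)
  then show ?thesis unfolding ifourier_def by eventually_elim simp
qed

text \<open>
  Both factors have integrable transforms, so they are given pointwise by inverse Fourier integrals.
  The product of these integrals is the inverse Fourier integral of the convolution, and the
  convolution is square integrable; inverting gives the claim.
\<close>
lemma fourier_mult_AE:
  assumes u: "u \<in> sobolev s" and v: "v \<in> sobolev s" and s: "s \<ge> 1"
  defines "H \<equiv> convolution (fourier u) (fourier v)"
  shows "square_integrable (\<lambda>x. u x * v x)" "square_integrable (\<lambda>\<zeta>. complex_of_real (weight s \<zeta>) * H \<zeta>)"
    "AE \<zeta> in lborel. fourier (\<lambda>x. u x * v x) \<zeta> = complex_of_real (1 / sqrt (2 * pi)) * H \<zeta>"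
proof -
  let ?F = "fourier u" and ?G = "fourier v" and ?c = "complex_of_real (1 / sqrt (2 * pi))"
  note squ = sobolev_square_integrable[OF u] and sqv = sobolev_square_integrable[OF v]
  note F = fourier_square_integrable[OF squ] sobolev_fourier_integrable(2)[OF u s]
  note G = fourier_square_integrable[OF sqv] sobolev_fourier_integrable(2)[OF v s]
  note [measurable] = square_integrableD[OF F(1)] square_integrableD[OF G(1)] square_integrableD[OF squ] square_integrableD[OF sqv]
  have Hm [measurable]: "H \<in> borel_measurable borel" unfolding H_def by measurable
  have Hi: "integrable lborel H" unfolding H_def by (rule convolution_integrable[OF F(2) G(2)])
  have wpos: "0 \<le> weight s \<xi>" for \<xi> using weight_pos less_imp_le by blast
  have "(\<integral>\<^sup>+\<zeta>. ennreal ((cmod (complex_of_real (weight s \<zeta>) * H \<zeta>))\<^sup>2) \<partial>lborel)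
      = (\<integral>\<^sup>+\<zeta>. ennreal ((weight s \<zeta> * cmod (H \<zeta>))\<^sup>2) \<partial>lborel)"
    by (simp add: norm_mult wpos)
  also have "\<dots> < \<infinity>"
    using convolution_weighted_bound[OF u v s] unfolding H_def by (auto intro: le_less_trans)
  finally show wH: "square_integrable (\<lambda>\<zeta>. complex_of_real (weight s \<zeta>) * H \<zeta>)"
    unfolding square_integrable_iff_nn by auto
  have H2: "square_integrable H"
  proof (rule square_integrableI_bound[OF _ square_integrable_integrable[OF wH]])
    show "(cmod (H x))\<^sup>2 \<le> (cmod (complex_of_real (weight s x) * H x))\<^sup>2" for x
      using weight_ge_1[of s x] s by (intro power_mono) (auto simp: norm_mult mult_le_cancel_right1)
  qed measurable
  have inv: "AE x in lborel. f x = cnj (ft (\<lambda>\<xi>. cnj (fourier f \<xi>)) x)"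
    if "square_integrable f" "integrable lborel (fourier f)" for f
  proof -
    have "AE x in lborel. ifourier (fourier f) x = f x"
      by (rule iffD1[OF L2_eq_iff ifourier_fourier[OF that(1)]])
        (intro ifourier_square_integrable fourier_square_integrable that)+
    then show ?thesis
      using ifourier_eq_fourier_integral[OF fourier_square_integrable[OF that(1)] that(2)] by eventually_elim simp
  qed
  have cH: "(\<lambda>\<xi>. cnj (H \<xi>)) = convolution (\<lambda>\<xi>. cnj (?F \<xi>)) (\<lambda>\<xi>. cnj (?G \<xi>))"
    unfolding H_def convolution_def fun_eq_iff
    by (simp flip: Bochner_Integration.integral_cnj)
  have "ft (\<lambda>\<xi>. cnj (H \<xi>)) x = complex_of_real (sqrt (2 * pi)) * ft (\<lambda>\<xi>. cnj (?F \<xi>)) x * ft (\<lambda>\<xi>. cnj (?G \<xi>)) x" for x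
    unfolding cH by (rule ft_convolution) (use F G in auto)
  then have prod: "?c * cnj (ft (\<lambda>\<xi>. cnj (H \<xi>)) x) = cnj (ft (\<lambda>\<xi>. cnj (?F \<xi>)) x) * cnj (ft (\<lambda>\<xi>. cnj (?G \<xi>)) x)" for x
    by simp
  have eq: "AE x in lborel. ?c * ifourier H x = u x * v x"
    using inv[OF squ F(2)] inv[OF sqv G(2)] ifourier_eq_fourier_integral[OF H2 Hi]
    by eventually_elim (metis prod)
  have sqc: "square_integrable (\<lambda>x. ?c * ifourier H x)"
    by (intro square_integrable_cmult ifourier_square_integrable H2)
  show "square_integrable (\<lambda>x. u x * v x)"
    by (rule square_integrable_cong_AE[OF sqc _ eq]) measurable
  have "fourier (\<lambda>x. u x * v x) = fourier (\<lambda>x. ?c * ifourier H x)"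
    by (intro fourier_cong_AE square_integrableD[OF sqc]) (use eq in \<open>auto elim: eventually_mono\<close>)
  moreover have "AE \<zeta> in lborel. fourier (ifourier H) \<zeta> = H \<zeta>"
    by (rule iffD1[OF L2_eq_iff fourier_ifourier[OF H2]])
      (intro H2 fourier_square_integrable ifourier_square_integrable)+
  ultimately show "AE \<zeta> in lborel. fourier (\<lambda>x. u x * v x) \<zeta> = ?c * H \<zeta>"
    using fourier_cmult_AE[OF ifourier_square_integrable[OF H2], of ?c] by (auto elim: eventually_elim2)
qed

lemma sobolev_algebra:
  assumes s: "s \<ge> 1"
  obtains K where "K > 0"
    "\<And>u v. u \<in> sobolev s \<Longrightarrow> v \<in> sobolev s \<Longrightarrow> (\<lambda>x. u x * v x) \<in> sobolev s"
    "\<And>u v. u \<in> sobolev s \<Longrightarrow> v \<in> sobolev s \<Longrightarrow> norm (sobolev_l2 s (\<lambda>x. u x * v x)) \<le> K * norm (sobolev_l2 s u) * norm (sobolev_l2 s v)"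
proof -
  let ?c = "complex_of_real (1 / sqrt (2 * pi))"
  define C where "C = (2 powr s)\<^sup>2 * 8 * cauchy_mass"
  have C0: "0 \<le> C"
    unfolding C_def cauchy_mass_def by (auto intro!: mult_nonneg_nonneg Bochner_Integration.integral_nonneg simp: add_nonneg_nonneg)
  have main: "(\<lambda>x. u x * v x) \<in> sobolev s \<and> norm (sobolev_l2 s (\<lambda>x. u x * v x)) \<le> (sqrt C + 1) * norm (sobolev_l2 s u) * norm (sobolev_l2 s v)"
    if u: "u \<in> sobolev s" and v: "v \<in> sobolev s" for u v
  proof -
    define H where "H = convolution (fourier u) (fourier v)"
    note M = fourier_mult_AE[OF u v s, folded H_def]
    have eq: "(\<lambda>\<zeta>. complex_of_real (weight s \<zeta>) * (?c * H \<zeta>)) = (\<lambda>\<zeta>. ?c * (complex_of_real (weight s \<zeta>) * H \<zeta>))"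
      by (simp add: mult_ac)
    have "square_integrable (\<lambda>\<zeta>. complex_of_real (weight s \<zeta>) * (?c * H \<zeta>))"
      unfolding eq by (intro square_integrable_cmult M)
    note R = sobolev_fourierI[OF M(1) this M(3)]
    let ?y = "L2 (\<lambda>\<zeta>. complex_of_real (weight s \<zeta>) * H \<zeta>)"
    have "ennreal ((norm ?y)\<^sup>2) \<le> ennreal (C * (norm (sobolev_l2 s u) * norm (sobolev_l2 s v))\<^sup>2)"
      unfolding L2_norm_nn[OF M(2), symmetric] C_def
      using convolution_weighted_bound[OF u v s] weight_pos[of s] by (simp add: H_def norm_mult abs_of_pos)
    then have "(norm ?y)\<^sup>2 \<le> C * (norm (sobolev_l2 s u) * norm (sobolev_l2 s v))\<^sup>2"
      using C0 by (subst (asm) ennreal_le_iff) auto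
    also have "\<dots> = (sqrt C * (norm (sobolev_l2 s u) * norm (sobolev_l2 s v)))\<^sup>2"
      using C0 by (simp add: power_mult_distrib)
    finally have y: "norm ?y \<le> sqrt C * (norm (sobolev_l2 s u) * norm (sobolev_l2 s v))"
      by (rule power2_le_imp_le) (use C0 in auto)
    have "sqrt (2 * pi) \<ge> 1" using pi_ge_two by (intro real_sqrt_ge_one) linarith
    then have "norm (sobolev_l2 s (\<lambda>x. u x * v x)) \<le> 1 * norm ?y"
      unfolding R(2) eq symbol_op_L2[OF bounded_symbol_const M(2), symmetric]
      by (intro norm_symbol_op_le bounded_symbol_const) (auto simp: norm_divide)
    also have "\<dots> \<le> (sqrt C + 1) * norm (sobolev_l2 s u) * norm (sobolev_l2 s v)"
      using y mult_nonneg_nonneg[OF norm_ge_zero norm_ge_zero, of "sobolev_l2 s u" "sobolev_l2 s v"]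
      unfolding distrib_right mult.assoc mult_1 by linarith
    finally show ?thesis using R(1) by blast
  qed
  show thesis
  proof (rule that)
    \<comment> \<open>the summand $1$ only serves to make the constant positive\<close>
    show "0 < sqrt C + 1" using C0 by (simp add: add_nonneg_pos)
  qed (use main in blast)+
qed

section \<open>Riemann integrals and integral equations in Banach spaces\<close>

text \<open>
  For continuous integrands a constant gauge suffices, by uniform continuity. Hence the integral of
  Henstock and Kurzweil on a Banach space is the limit of Riemann sums by which integrals of
  $H^s$-valued curves are defined.
\<close>
lemma continuous_Riemann_integral:
  fixes f :: "real \<Rightarrow> 'a::banach"
  assumes f: "continuous_on {a..b} f" and ab: "a \<le> b" and e: "e > 0"
  shows "\<exists>\<delta>>0. \<forall>p. p tagged_division_of {a..b} \<and> (\<lambda>\<tau>. ball \<tau> \<delta>) fine p \<longrightarrow>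
    norm ((\<Sum>(\<tau>, k)\<in>p. measure lborel k *\<^sub>R f \<tau>) - integral {a..b} f) < e"
proof -
  \<comment> \<open>the summand $1$ covers the degenerate interval\<close>
  define e' where "e' = e / (b - a + 1)"
  have e': "e' > 0" unfolding e'_def using e ab by simp
  have "uniformly_continuous_on {a..b} f"
    using f by (intro compact_uniformly_continuous) auto
  then obtain d where d: "d > 0" "\<And>x y. x \<in> {a..b} \<Longrightarrow> y \<in> {a..b} \<Longrightarrow> dist y x < d \<Longrightarrow> dist (f y) (f x) < e'"
    unfolding uniformly_continuous_on_def using e' by meson
  show ?thesis
  proof (intro exI[of _ d] conjI allI impI)
    fix p assume p: "p tagged_division_of {a..b} \<and> (\<lambda>\<tau>. ball \<tau> d) fine p"
    then have p1: "p tagged_division_of cbox a b" and fine: "(\<lambda>\<tau>. ball \<tau> d) fine p" by auto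
    note pD = tagged_division_ofD[OF p1]
    have int: "f integrable_on cbox a b" using integrable_continuous_interval[OF f] by simp
    have "norm ((\<Sum>(\<tau>, k)\<in>p. measure lborel k *\<^sub>R f \<tau>) - integral {a..b} f)
        = norm (\<Sum>(\<tau>, k)\<in>p. measure lborel k *\<^sub>R f \<tau> - integral k f)"
      using integral_combine_tagged_division_topdown[OF int p1]
      by (simp add: sum_subtractf split_def)
    also have "\<dots> \<le> (\<Sum>(\<tau>, k)\<in>p. e' * measure lborel k)"
    proof (rule sum_norm_le, clarify)
      fix \<tau> k assume tk: "(\<tau>, k) \<in> p"
      obtain c d' where k: "k = cbox c d'" using pD(4)[OF tk] by blast
      have sub: "k \<subseteq> {a..b}" using pD(3)[OF tk] by simp
      have tau: "\<tau> \<in> {a..b}" using pD(2)[OF tk] sub by blast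
      have kb: "k \<subseteq> ball \<tau> d" using fine tk by (auto simp: fine_def)
      have "f integrable_on k" using integrable_on_subcbox[OF int] sub k by simp
      then have "((\<lambda>x. f \<tau> - f x) has_integral (measure lborel k *\<^sub>R f \<tau> - integral k f)) (cbox c d')"
        unfolding k by (intro has_integral_diff integrable_integral has_integral_const)
      then have "norm (measure lborel k *\<^sub>R f \<tau> - integral k f) \<le> e' * measure lborel (cbox c d')"
      proof (rule has_integral_bound[rotated])
        fix x assume "x \<in> cbox c d'"
        then have "x \<in> {a..b}" "dist x \<tau> < d" using sub kb k by (auto simp: dist_commute)
        then show "norm (f \<tau> - f x) \<le> e'"
          using d(2)[OF tau, of x] by (simp add: dist_norm norm_minus_commute)
      qed (use e' in simp)
      then show "norm (measure lborel k *\<^sub>R f \<tau> - integral k f) \<le> e' * measure lborel k" by (simp add: k)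
    qed
    also have "\<dots> = e' * (b - a)"
      using additive_content_tagged_division[OF p1] ab by (simp add: sum_distrib_left[symmetric] split_def)
    also have "\<dots> < e"
      unfolding e'_def using e ab by (simp add: field_simps)
    finally show "norm ((\<Sum>(\<tau>, k)\<in>p. measure lborel k *\<^sub>R f \<tau>) - integral {a..b} f) < e" .
  qed (rule d)
qed

lemma Riemann_imp_has_integral:
  fixes f :: "real \<Rightarrow> 'a::banach"
  assumes "\<And>e. e > 0 \<Longrightarrow> \<exists>\<delta>>0. \<forall>p. p tagged_division_of {a..b} \<and> (\<lambda>\<tau>. ball \<tau> \<delta>) fine p \<longrightarrow>
    norm ((\<Sum>(\<tau>, k)\<in>p. measure lborel k *\<^sub>R f \<tau>) - I) < e"
  shows "(f has_integral I) {a..b}"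
  unfolding box_real(2)[symmetric] has_integral
proof (intro allI impI)
  fix e :: real assume "e > 0"
  from assms[OF this] obtain d where "d > 0" and d: "\<And>p. p tagged_division_of {a..b} \<Longrightarrow> (\<lambda>\<tau>. ball \<tau> d) fine p \<Longrightarrow>
    norm ((\<Sum>(\<tau>, k)\<in>p. measure lborel k *\<^sub>R f \<tau>) - I) < e" by blast
  then show "\<exists>\<gamma>. gauge \<gamma> \<and> (\<forall>\<D>. \<D> tagged_division_of cbox a b \<and> \<gamma> fine \<D> \<longrightarrow>
      norm ((\<Sum>(x, k)\<in>\<D>. measure lborel k *\<^sub>R f x) - I) < e)"
    by (intro exI[of _ "\<lambda>\<tau>. ball \<tau> d"]) (auto intro: gauge_ball)
qed

lemma Gronwall_integral:
  fixes d :: "real \<Rightarrow> real"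
  assumes d: "continuous_on {0..T} d" and L: "L \<ge> 0"
    and le: "\<And>t. t \<in> {0..T} \<Longrightarrow> d t \<le> a + L * integral {0..t} d"
    and t: "t \<in> {0..T}"
  shows "d t \<le> a * exp (L * t)"
proof -
  \<comment> \<open>the integrating factor makes the bound nonincreasing\<close>
  define g where "g r = exp (- L * r) * (a + L * integral {0..r} d)" for r
  have "g 0 \<ge> g t"
  proof (rule DERIV_nonpos_imp_decreasing_open[where f = g])
    show "continuous_on {0..t} g"
      unfolding g_def using t
      by (intro continuous_intros indefinite_integral_continuous_1 integrable_continuous_interval continuous_on_subset[OF d]) auto
    fix r assume r: "0 < r" "r < t"
    have "((\<lambda>x. integral {0..x} d) has_real_derivative d r) (at r within {0..T})"
      using r t by (intro integral_has_real_derivative d) auto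
    then have der: "((\<lambda>x. integral {0..x} d) has_real_derivative d r) (at r)"
      using r t by (simp add: at_within_Icc_at)
    have "(g has_real_derivative (exp (- L * r) * (- L) * (a + L * integral {0..r} d) + (L * d r) * exp (- L * r))) (at r)"
      unfolding g_def by (auto intro!: derivative_eq_intros der)
    moreover have "exp (- L * r) * (- L) * (a + L * integral {0..r} d) + (L * d r) * exp (- L * r)
        = L * exp (- L * r) * (d r - (a + L * integral {0..r} d))"
      by (simp add: algebra_simps)
    moreover have "\<dots> \<le> 0"
      using le[of r] r t L by (intro mult_nonneg_nonpos mult_nonneg_nonneg) auto
    ultimately show "\<exists>y. (g has_real_derivative y) (at r) \<and> y \<le> 0" by metis
  qed (use t in auto)
  then have "a + L * integral {0..t} d \<le> a * exp (L * t)"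
    unfolding g_def by (simp add: exp_minus field_simps)
  then show ?thesis using le[OF t] by linarith
qed

definition integral_solution :: "(real \<Rightarrow> 'a::banach \<Rightarrow> 'a) \<Rightarrow> real \<Rightarrow> 'a \<Rightarrow> (real \<Rightarrow> 'a) \<Rightarrow> bool" where
  "integral_solution f T x w \<longleftrightarrow> continuous_on {0..T} w \<and>
     (\<forall>t\<in>{0..T}. w t = x + integral {0..t} (\<lambda>\<tau>. f \<tau> (w \<tau>)))"

text \<open>
  A time-dependent vector field that is Lipschitz on balls, with a constant proportional to the radius.
  Continuity is required only along continuous curves, which is what makes the integral equation
  meaningful.
\<close>
locale quadratic_vector_field =
  fixes f :: "real \<Rightarrow> 'a::banach \<Rightarrow> 'a" and K :: real
  assumes K_pos: "K > 0"
    and zero: "f \<tau> 0 = 0"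
    and lipschitz: "norm (f \<tau> x - f \<tau> y) \<le> K * (norm x + norm y) * norm (x - y)"
    and continuous: "continuous_on {0..T} w \<Longrightarrow> continuous_on {0..T} (\<lambda>\<tau>. f \<tau> (w \<tau>))"
begin

lemma vector_field_integrable: "continuous_on {0..T} w \<Longrightarrow> t \<in> {0..T} \<Longrightarrow> (\<lambda>\<tau>. f \<tau> (w \<tau>)) integrable_on {0..t}"
  by (rule integrable_continuous_interval, rule continuous_on_subset[OF continuous[of T]]) auto

text \<open>
  Gronwall's inequality with the Lipschitz constant $2KM$ of the field on the ball of radius $M$.
\<close>
lemma integral_solution_stability:
  assumes w: "integral_solution f T x w" and v: "integral_solution f T y v"
    and M: "\<And>t. t \<in> {0..T} \<Longrightarrow> norm (w t) \<le> M" "\<And>t. t \<in> {0..T} \<Longrightarrow> norm (v t) \<le> M"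
    and t: "t \<in> {0..T}"
  shows "norm (w t - v t) \<le> norm (x - y) * exp (2 * K * M * t)"
proof (rule Gronwall_integral[OF _ _ _ t])
  have M0: "0 \<le> M" using M(1)[OF t] norm_ge_zero order_trans by blast
  have cw: "continuous_on {0..T} w" and cv: "continuous_on {0..T} v"
    using w v by (auto simp: integral_solution_def)
  show cd: "continuous_on {0..T} (\<lambda>t. norm (w t - v t))"
    by (intro continuous_intros cw cv)
  show "0 \<le> 2 * K * M" using M0 K_pos by simp
  fix r assume r: "r \<in> {0..T}"
  have "w r - v r = (x - y) + integral {0..r} (\<lambda>\<tau>. f \<tau> (w \<tau>) - f \<tau> (v \<tau>))"
    using w v r vector_field_integrable[OF cw r] vector_field_integrable[OF cv r]
    by (simp add: integral_solution_def integral_diff)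
  then have "norm (w r - v r) \<le> norm (x - y) + norm (integral {0..r} (\<lambda>\<tau>. f \<tau> (w \<tau>) - f \<tau> (v \<tau>)))"
    by (simp add: norm_triangle_ineq)
  also have "norm (integral {0..r} (\<lambda>\<tau>. f \<tau> (w \<tau>) - f \<tau> (v \<tau>))) \<le> integral {0..r} (\<lambda>\<tau>. 2 * K * M * norm (w \<tau> - v \<tau>))"
  proof (rule integral_norm_bound_integral)
    show "(\<lambda>\<tau>. f \<tau> (w \<tau>) - f \<tau> (v \<tau>)) integrable_on {0..r}"
      by (intro integrable_diff vector_field_integrable[OF cw r] vector_field_integrable[OF cv r])
    show "(\<lambda>\<tau>. 2 * K * M * norm (w \<tau> - v \<tau>)) integrable_on {0..r}"
      using r by (intro integrable_continuous_interval continuous_intros continuous_on_subset[OF cw] continuous_on_subset[OF cv]) auto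
    fix \<tau> assume "\<tau> \<in> {0..r}"
    then have "\<tau> \<in> {0..T}" using r by auto
    then have "K * (norm (w \<tau>) + norm (v \<tau>)) * norm (w \<tau> - v \<tau>) \<le> K * (M + M) * norm (w \<tau> - v \<tau>)"
      using M K_pos by (intro mult_right_mono mult_left_mono add_mono) auto
    then show "norm (f \<tau> (w \<tau>) - f \<tau> (v \<tau>)) \<le> 2 * K * M * norm (w \<tau> - v \<tau>)"
      using lipschitz[of \<tau> "w \<tau>" "v \<tau>"] by (simp add: mult_ac)
  qed
  also have "integral {0..r} (\<lambda>\<tau>. 2 * K * M * norm (w \<tau> - v \<tau>)) = 2 * K * M * integral {0..r} (\<lambda>\<tau>. norm (w \<tau> - v \<tau>))"
    by simp
  finally show "norm (w r - v r) \<le> norm (x - y) + 2 * K * M * integral {0..r} (\<lambda>\<tau>. norm (w \<tau> - v \<tau>))"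
    by simp
qed

text \<open>
  Two continuous curves on a compact interval lie in a common ball, so the estimate above applies
  without any smallness of the solutions.
\<close>
lemma integral_solution_unique:
  assumes w: "integral_solution f T x w" and v: "integral_solution f T x v" and t: "t \<in> {0..T}"
  shows "w t = v t"
proof -
  have "compact (w ` {0..T})" "compact (v ` {0..T})"
    using w v unfolding integral_solution_def by (blast intro: compact_continuous_image compact_Icc)+
  then have "bounded (w ` {0..T} \<union> v ` {0..T})" by (simp add: compact_imp_bounded)
  then obtain M where "\<And>t. t \<in> {0..T} \<Longrightarrow> norm (w t) \<le> M" "\<And>t. t \<in> {0..T} \<Longrightarrow> norm (v t) \<le> M"
    unfolding bounded_iff by blast
  from integral_solution_stability[OF w v this t] show ?thesis by simp
qed

text \<open>
  Picard iteration in the ball of radius $2\rho$: on it the field is bounded by $4K\rho^2$ and has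
  Lipschitz constant $4K\rho$. So if $8KT\rho \le 1$, the iteration moves the initial value by at
  most $\rho/2$ and contracts by $1/2$.
\<close>
lemma integral_solution_exists:
  assumes rho: "\<rho> > 0" "norm x \<le> \<rho>" and T: "T > 0" "T * (8 * K * \<rho>) \<le> 1"
  shows "\<exists>w. integral_solution f T x w \<and> (\<forall>t\<in>{0..T}. norm (w t) \<le> 2 * \<rho>)"
proof -
  \<comment> \<open>curves on the interval are extended by constants to bounded continuous functions on the line\<close>
  define clamp where "clamp t = max 0 (min T t)" for t :: real
  have clamp: "clamp t \<in> {0..T}" "t \<in> {0..T} \<Longrightarrow> clamp t = t" for t using T by (auto simp: clamp_def)
  define \<Phi> where "\<Phi> w t = x + integral {0..clamp t} (\<lambda>\<tau>. f \<tau> (w \<tau>))" for w t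
  define S where "S = {w :: real \<Rightarrow>\<^sub>C 'a. \<forall>t. norm (w t) \<le> 2 * \<rho>}"
  have integrable: "(\<lambda>\<tau>. f \<tau> (apply_bcontfun w \<tau>)) integrable_on {0..clamp t}" for w t
    by (rule vector_field_integrable[of T]) (use clamp in auto)
  have bound: "norm (integral {0..clamp t} g) \<le> T * B"
    if "\<And>\<tau>. norm (g \<tau>) \<le> B" "0 \<le> B" "g integrable_on {0..clamp t}" for g :: "real \<Rightarrow> 'a" and B t
  proof -
    have "norm (integral {0..clamp t} g) \<le> B * measure lborel (cbox 0 (clamp t))"
      using that by (intro has_integral_bound[where f = g] integrable_integral) auto
    also have "\<dots> \<le> B * T" using clamp[of t] that(2) by (intro mult_left_mono) auto
    finally show ?thesis by (simp add: mult.commute)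
  qed
  have cont: "continuous_on UNIV (\<Phi> (apply_bcontfun w))" for w
  proof -
    have "continuous_on {0..T} (\<lambda>t. integral {0..t} (\<lambda>\<tau>. f \<tau> (apply_bcontfun w \<tau>)))"
      using vector_field_integrable[of T "apply_bcontfun w" T] T by (intro indefinite_integral_continuous_1) auto
    moreover have "continuous_on UNIV clamp" unfolding clamp_def by (intro continuous_intros)
    ultimately have "continuous_on UNIV (\<lambda>t. integral {0..clamp t} (\<lambda>\<tau>. f \<tau> (apply_bcontfun w \<tau>)))"
      by (rule continuous_on_compose2) (use clamp in auto)
    then show ?thesis unfolding \<Phi>_def by (intro continuous_intros)
  qed
  have small: "norm (\<Phi> (apply_bcontfun w) t) \<le> 2 * \<rho>" if "w \<in> S" for w t
  proof -
    have "norm (f \<tau> (w \<tau>)) \<le> K * (2 * \<rho>) * (2 * \<rho>)" for \<tau>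
    proof -
      have "norm (f \<tau> (w \<tau>)) \<le> K * norm (w \<tau>) * norm (w \<tau>)"
        using lipschitz[of \<tau> "w \<tau>" 0] by (simp add: zero)
      also have "\<dots> \<le> K * (2 * \<rho>) * (2 * \<rho>)"
        using that K_pos rho by (intro mult_mono) (auto simp: S_def)
      finally show ?thesis .
    qed
    then have "norm (integral {0..clamp t} (\<lambda>\<tau>. f \<tau> (w \<tau>))) \<le> T * (K * (2 * \<rho>) * (2 * \<rho>))"
      using K_pos rho integrable by (intro bound) auto
    also have "\<dots> = (T * (8 * K * \<rho>)) * (\<rho> / 2)" by simp
    also have "\<dots> \<le> 1 * (\<rho> / 2)" using T rho by (intro mult_right_mono) auto
    finally show ?thesis
      unfolding \<Phi>_def using norm_triangle_ineq[of x "integral {0..clamp t} (\<lambda>\<tau>. f \<tau> (w \<tau>))"] rho by linarith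
  qed
  define \<Psi> where "\<Psi> w = Bcontfun (\<Phi> (apply_bcontfun w))" for w
  have app: "apply_bcontfun (\<Psi> w) = \<Phi> (apply_bcontfun w)" if "w \<in> S" for w
    unfolding \<Psi>_def using cont small[OF that] by (intro Bcontfun_inverse bcontfun_normI)
  have S_eq: "S = PiC UNIV (\<lambda>_. cball 0 (2 * \<rho>))"
    by (auto simp: S_def mem_PiC_iff Pi_iff)
  have closed_S: "closed S" unfolding S_eq by (rule closed_PiC) auto
  have "\<exists>!w\<in>S. \<Psi> w = w"
  proof (rule Banach_fix[OF iffD2[OF complete_eq_closed closed_S]])
    have "const_bcontfun 0 \<in> S" using rho by (simp add: S_def const_bcontfun.rep_eq)
    then show "S \<noteq> {}" by blast
    show "\<Psi> ` S \<subseteq> S"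
    proof clarify
      fix w assume w: "w \<in> S"
      show "\<Psi> w \<in> S" unfolding S_def using small[OF w] by (simp add: app[OF w])
    qed
    fix w v assume w: "w \<in> S" and v: "v \<in> S"
    show "dist (\<Psi> w) (\<Psi> v) \<le> 1/2 * dist w v"
    proof (rule dist_bound)
      fix t
      have "norm (f \<tau> (w \<tau>) - f \<tau> (v \<tau>)) \<le> K * (4 * \<rho>) * dist w v" for \<tau>
      proof -
        have "norm (w \<tau>) + norm (v \<tau>) \<le> 4 * \<rho>"
          using w v unfolding S_def by (smt (verit) mem_Collect_eq)
        moreover have "norm (w \<tau> - v \<tau>) \<le> dist w v"
          using dist_bounded[of w \<tau> v] by (simp add: dist_norm)
        ultimately have "K * (norm (w \<tau>) + norm (v \<tau>)) * norm (w \<tau> - v \<tau>) \<le> K * (4 * \<rho>) * dist w v"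
          using K_pos rho by (intro mult_mono) auto
        then show ?thesis using lipschitz[of \<tau> "w \<tau>" "v \<tau>"] by linarith
      qed
      then have "norm (integral {0..clamp t} (\<lambda>\<tau>. f \<tau> (w \<tau>) - f \<tau> (v \<tau>))) \<le> T * (K * (4 * \<rho>) * dist w v)"
        using K_pos rho by (intro bound integrable_diff integrable) auto
      also have "\<dots> = (T * (8 * K * \<rho>)) * (1/2 * dist w v)" by simp
      also have "\<dots> \<le> 1 * (1/2 * dist w v)" using T by (intro mult_right_mono) auto
      finally show "dist (\<Psi> w t) (\<Psi> v t) \<le> 1/2 * dist w v"
        unfolding app[OF w] app[OF v] \<Phi>_def dist_norm
        using integrable[of w t] integrable[of v t] by (simp add: integral_diff)
    qed
  qed auto
  then obtain w where w: "w \<in> S" "\<Psi> w = w" by blast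
  have "integral_solution f T x w"
    unfolding integral_solution_def
  proof (intro conjI ballI)
    fix t assume t: "t \<in> {0..T}"
    have "w t = \<Psi> w t" using w(2) by simp
    also have "\<dots> = x + integral {0..t} (\<lambda>\<tau>. f \<tau> (w \<tau>))"
      unfolding app[OF w(1)] \<Phi>_def clamp(2)[OF t] ..
    finally show "w t = x + integral {0..t} (\<lambda>\<tau>. f \<tau> (w \<tau>))" .
  qed simp
  then show ?thesis using w(1) by (auto simp: S_def)
qed

end

section \<open>The initial value problem in the interaction picture\<close>

locale bbm_equation =
  fixes \<nu> s :: real
  assumes nu: "\<nu> < 1/6" and s: "s \<ge> 1"
begin

definition flow_symbol :: "real \<Rightarrow> real \<Rightarrow> complex" where
  "flow_symbol t \<xi> = exp (- (\<i> * complex_of_real (phi \<nu> \<xi> * t)))"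

definition flow :: "real \<Rightarrow> l2 \<Rightarrow> l2" where
  "flow t = symbol_op (flow_symbol t)"

text \<open>
  The factor $-i$ of Duhamel's formula is absorbed here. This makes the symbol Hermitian, since
  \<open>psi\<close> is odd.
\<close>
definition source_symbol :: "real \<Rightarrow> complex" where
  "source_symbol \<xi> = - \<i> * complex_of_real (psi \<nu> \<xi>)"

definition representative :: "l2 \<Rightarrow> real \<Rightarrow> complex" where
  "representative U = (SOME f. f \<in> sobolev s \<and> sobolev_l2 s f = U)"

definition source :: "l2 \<Rightarrow> l2" where
  "source U = symbol_op source_symbol (sobolev_l2 s (\<lambda>x. representative U x * representative U x))"

text \<open>
  The field of the interaction picture $w(t) = S(-t)u(t)$.
\<close>
definition interaction :: "real \<Rightarrow> l2 \<Rightarrow> l2" where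
  "interaction \<tau> W = flow (- \<tau>) (source (flow \<tau> W))"

lemma s0: "s \<ge> 0" using s by simp

lemma representative_sobolev: "representative U \<in> sobolev s" and sobolev_l2_representative: "sobolev_l2 s (representative U) = U"
  using someI_ex[OF sobolev_l2_surj[OF s0, of U]] unfolding representative_def by auto

lemma denominator_ge_1: "(1/6 - \<nu>) * \<xi>\<^sup>2 + 1 \<ge> 1"
  using nu by simp

lemma norm_flow_symbol: "cmod (flow_symbol t \<xi>) = 1"
  unfolding flow_symbol_def by (simp add: norm_exp_eq_Re)

lemma flow_symbol_bounded: "bounded_symbol (flow_symbol t)"
proof -
  have "phi \<nu> \<in> borel_measurable borel" unfolding phi_def by measurable
  then have "flow_symbol t \<in> borel_measurable borel"
    unfolding flow_symbol_def by measurable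
  then show ?thesis unfolding bounded_symbol_def using norm_flow_symbol by (auto intro!: exI[of _ 1])
qed

text \<open>
  Since $|\xi| \le 1+\xi^2$, and $\min(\frac16-\nu,1)(1+\xi^2)$ is at most the denominator.
\<close>
lemma psi_bounded: "\<bar>psi \<nu> \<xi>\<bar> \<le> 3 / (4 * min (1/6 - \<nu>) 1)"
proof -
  let ?a = "1/6 - \<nu>" and ?m = "min (1/6 - \<nu>) 1"
  have m: "?m > 0" using nu by simp
  have "\<bar>\<xi>\<bar> \<le> 1 + \<xi>\<^sup>2"
    using zero_le_power2[of "\<bar>\<xi>\<bar> - 1"] by (simp add: power2_eq_square algebra_simps)
  then have "?m * \<bar>\<xi>\<bar> \<le> ?m * (1 + \<xi>\<^sup>2)" using m by (intro mult_left_mono) auto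
  also have "\<dots> = ?m * 1 + ?m * \<xi>\<^sup>2" by (simp add: distrib_left)
  also have "\<dots> \<le> 1 + ?a * \<xi>\<^sup>2" by (intro add_mono mult_right_mono) auto
  finally have le: "?m * \<bar>\<xi>\<bar> \<le> ?a * \<xi>\<^sup>2 + 1" by simp
  have d: "?a * \<xi>\<^sup>2 + 1 > 0" using denominator_ge_1[of \<xi>] by linarith
  have "\<bar>psi \<nu> \<xi>\<bar> = (3/4) * (\<bar>\<xi>\<bar> / (?a * \<xi>\<^sup>2 + 1))"
    unfolding psi_def using d by (simp add: abs_mult)
  also have "\<bar>\<xi>\<bar> / (?a * \<xi>\<^sup>2 + 1) \<le> 1 / ?m"
    using le d m by (simp add: divide_simps mult.commute)
  finally show ?thesis by simp
qed

lemma psi_symbol_bounded: "bounded_symbol (\<lambda>\<xi>. complex_of_real (psi \<nu> \<xi>))"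
proof -
  have "psi \<nu> \<in> borel_measurable borel" unfolding psi_def by measurable
  then show ?thesis using psi_bounded unfolding bounded_symbol_def by auto
qed

lemma source_symbol_bounded: "bounded_symbol source_symbol"
  unfolding source_symbol_def by (intro bounded_symbol_times bounded_symbol_const psi_symbol_bounded)

lemma flow_add: "flow t (x + y) = flow t x + flow t y"
  unfolding flow_def by (rule symbol_op_add[OF flow_symbol_bounded])

lemma flow_bounded_linear: "bounded_linear (flow t)"
  unfolding flow_def by (rule bounded_linear_symbol_op[OF flow_symbol_bounded])

lemma flow_diff: "flow t (x - y) = flow t x - flow t y"
  by (rule linear_diff[OF bounded_linear.axioms(1)[OF flow_bounded_linear]])

lemma flow_flow: "flow t (flow r x) = flow (t + r) x"
proof -
  have "(\<lambda>\<xi>. flow_symbol t \<xi> * flow_symbol r \<xi>) = flow_symbol (t + r)"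
    unfolding flow_symbol_def by (auto simp: fun_eq_iff exp_add[symmetric] algebra_simps)
  then show ?thesis unfolding flow_def by (simp add: symbol_op_compose flow_symbol_bounded)
qed

lemma flow_0: "flow 0 x = x"
proof (rule L2_exhaust[of x])
  fix f assume "square_integrable f" "x = L2 f"
  then show ?thesis
    unfolding flow_def by (simp add: symbol_op_L2 flow_symbol_bounded) (simp add: flow_symbol_def)
qed

lemma flow_inverse [simp]: "flow (- t) (flow t x) = x" "flow t (flow (- t) x) = x"
  by (simp_all add: flow_flow flow_0)

lemma norm_flow_le: "norm (flow t x) \<le> norm x"
  unfolding flow_def using norm_symbol_op_le[OF flow_symbol_bounded, of 1 t x] norm_flow_symbol by simp

lemma norm_flow: "norm (flow t x) = norm x"
  using norm_flow_le[of t x] norm_flow_le[of "- t" "flow t x"] by simp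

text \<open>
  The flow is continuous in time only strongly: unless $\nu = 0$, the symbol \<open>phi\<close> is unbounded.
\<close>
lemma flow_strongly_continuous:
  assumes t: "t \<longlonglongrightarrow> r"
  shows "(\<lambda>n. flow (t n) x) \<longlonglongrightarrow> flow r x"
proof (rule L2_exhaust[of x])
  fix f assume f: "square_integrable f" "x = L2 f"
  note [measurable] = square_integrableD[OF f(1)]
  have [measurable]: "flow_symbol t \<in> borel_measurable borel" for t
    using flow_symbol_bounded by (simp add: bounded_symbol_def)
  have "(\<lambda>n. L2 (\<lambda>\<xi>. flow_symbol (t n) \<xi> * f \<xi>)) \<longlonglongrightarrow> L2 (\<lambda>\<xi>. flow_symbol r \<xi> * f \<xi>)"
  proof (rule L2_dominated_convergence(3)[where w = "\<lambda>\<xi>. cmod (f \<xi>)"])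
    show "AE \<xi> in lborel. (\<lambda>n. flow_symbol (t n) \<xi> * f \<xi>) \<longlonglongrightarrow> flow_symbol r \<xi> * f \<xi>"
      unfolding flow_symbol_def by (intro AE_I2 tendsto_intros t)
  qed (use square_integrable_integrable[OF f(1)] norm_flow_symbol in \<open>auto simp: norm_mult\<close>)
  then show ?thesis
    unfolding flow_def f(2) by (simp add: symbol_op_L2 flow_symbol_bounded f(1))
qed

text \<open>
  Strong continuity and the isometry property together give joint continuity.
\<close>
lemma continuous_on_flow:
  fixes A :: "real set"
  assumes c: "continuous_on A c" and w: "continuous_on A w"
  shows "continuous_on A (\<lambda>\<tau>. flow (c \<tau>) (w \<tau>))"
  unfolding continuous_on_sequentially
proof (intro allI ballI impI, elim conjE)
  fix y a assume a: "a \<in> A" and y: "\<forall>n. y n \<in> A" "y \<longlonglongrightarrow> a"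
  have cy: "(\<lambda>n. c (y n)) \<longlonglongrightarrow> c a" and wy: "(\<lambda>n. w (y n)) \<longlonglongrightarrow> w a"
    using c w a y unfolding continuous_on_sequentially by (auto simp: o_def)
  have "(\<lambda>n. norm (w (y n) - w a) + norm (flow (c (y n)) (w a) - flow (c a) (w a))) \<longlonglongrightarrow> 0"
    by (intro tendsto_add_zero tendsto_norm_zero LIM_zero wy flow_strongly_continuous cy)
  then have "(\<lambda>n. flow (c (y n)) (w (y n)) - flow (c a) (w a)) \<longlonglongrightarrow> 0"
  proof (rule Lim_null_comparison[rotated], intro always_eventually allI)
    fix n
    have "flow (c (y n)) (w (y n)) - flow (c a) (w a)
        = flow (c (y n)) (w (y n) - w a) + (flow (c (y n)) (w a) - flow (c a) (w a))"
      by (simp add: flow_diff)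
    then show "norm (flow (c (y n)) (w (y n)) - flow (c a) (w a))
        \<le> norm (w (y n) - w a) + norm (flow (c (y n)) (w a) - flow (c a) (w a))"
      using norm_triangle_ineq norm_flow by metis
  qed
  then show "((\<lambda>\<tau>. flow (c \<tau>) (w \<tau>)) \<circ> y) \<longlonglongrightarrow> flow (c a) (w a)"
    unfolding o_def by (rule LIM_zero_cancel)
qed

text \<open>
  The square is independent of the chosen representative.
\<close>
lemma source_sobolev_l2:
  assumes u: "u \<in> sobolev s"
  shows "source (sobolev_l2 s u) = symbol_op source_symbol (sobolev_l2 s (\<lambda>x. u x * u x))"
proof -
  obtain K where alg: "\<And>u v. u \<in> sobolev s \<Longrightarrow> v \<in> sobolev s \<Longrightarrow> (\<lambda>x. u x * v x) \<in> sobolev s"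
    using sobolev_algebra[OF s] by metis
  have "AE x in lborel. representative (sobolev_l2 s u) x = u x"
    using sobolev_l2_inject[OF representative_sobolev u, of "sobolev_l2 s u"] sobolev_l2_representative by blast
  then have "sobolev_l2 s (\<lambda>x. representative (sobolev_l2 s u) x * representative (sobolev_l2 s u) x) = sobolev_l2 s (\<lambda>x. u x * u x)"
    by (subst sobolev_l2_inject[OF alg[OF representative_sobolev representative_sobolev] alg[OF u u]]) (auto elim: eventually_mono)
  then show ?thesis unfolding source_def by simp
qed

lemma source_zero: "source 0 = 0"
proof -
  have "source 0 = symbol_op source_symbol (sobolev_l2 s (\<lambda>x. 0))"
    using source_sobolev_l2[OF sobolev_zero(1)] by (simp add: sobolev_zero(2))
  also have "\<dots> = 0"
    using bounded_linear.axioms(1)[OF bounded_linear_symbol_op[OF source_symbol_bounded]]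
    by (simp add: sobolev_zero(2) linear_0)
  finally show ?thesis .
qed

text \<open>
  The algebra property applied to $u^2 - v^2 = (u+v)(u-v)$.
\<close>
lemma source_Lipschitz:
  obtains K where "K > 0" "\<And>U V. norm (source U - source V) \<le> K * (norm U + norm V) * norm (U - V)"
proof -
  obtain A where A: "A > 0"
    "\<And>u v. u \<in> sobolev s \<Longrightarrow> v \<in> sobolev s \<Longrightarrow> (\<lambda>x. u x * v x) \<in> sobolev s"
    "\<And>u v. u \<in> sobolev s \<Longrightarrow> v \<in> sobolev s \<Longrightarrow> norm (sobolev_l2 s (\<lambda>x. u x * v x)) \<le> A * norm (sobolev_l2 s u) * norm (sobolev_l2 s v)"
    using sobolev_algebra[OF s] by metis
  define C where "C = 3 / (4 * min (1/6 - \<nu>) 1)"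
  have C: "C > 0" unfolding C_def using nu by simp
  have lin: "linear (symbol_op source_symbol)"
    using bounded_linear.axioms(1)[OF bounded_linear_symbol_op[OF source_symbol_bounded]] .
  have "norm (source U - source V) \<le> C * A * (norm U + norm V) * norm (U - V)" for U V
  proof -
    define u where "u = representative U"
    define v where "v = representative V"
    have u: "u \<in> sobolev s" "sobolev_l2 s u = U" and v: "v \<in> sobolev s" "sobolev_l2 s v = V"
      unfolding u_def v_def by (simp_all add: representative_sobolev sobolev_l2_representative)
    let ?p = "\<lambda>x. u x + v x" and ?m = "\<lambda>x. u x - v x"
    note p = sobolev_add[OF u(1) v(1)] and m = sobolev_diff[OF u(1) v(1)]
    have "source U - source V = symbol_op source_symbol (sobolev_l2 s (\<lambda>x. u x * u x) - sobolev_l2 s (\<lambda>x. v x * v x))"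
      unfolding source_def u_def[symmetric] v_def[symmetric] by (simp add: linear_diff[OF lin])
    also have "sobolev_l2 s (\<lambda>x. u x * u x) - sobolev_l2 s (\<lambda>x. v x * v x) = sobolev_l2 s (\<lambda>x. u x * u x - v x * v x)"
      using sobolev_diff(2)[OF A(2)[OF u(1) u(1)] A(2)[OF v(1) v(1)]] by simp
    also have "(\<lambda>x. u x * u x - v x * v x) = (\<lambda>x. ?p x * ?m x)"
      by (simp add: algebra_simps)
    finally have "norm (source U - source V) \<le> C * norm (sobolev_l2 s (\<lambda>x. ?p x * ?m x))"
      using psi_bounded C
      by (simp only:, intro norm_symbol_op_le source_symbol_bounded) (auto simp: source_symbol_def norm_mult C_def)
    also have "\<dots> \<le> C * (A * norm (sobolev_l2 s ?p) * norm (sobolev_l2 s ?m))"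
      using A(3)[OF p(1) m(1)] C by (intro mult_left_mono) auto
    also have "\<dots> \<le> C * (A * (norm U + norm V) * norm (U - V))"
      unfolding p(2) m(2) u(2) v(2) using A(1) C
      by (intro mult_left_mono mult_right_mono norm_triangle_ineq) auto
    finally show ?thesis by (simp add: mult_ac)
  qed
  then show thesis using that[of "C * A"] C A(1) by simp
qed

lemma continuous_on_source:
  fixes A :: "real set"
  assumes w: "continuous_on A w"
  shows "continuous_on A (\<lambda>\<tau>. source (w \<tau>))"
  unfolding continuous_on_sequentially
proof (intro allI ballI impI, elim conjE)
  obtain K where K: "K > 0" "\<And>U V. norm (source U - source V) \<le> K * (norm U + norm V) * norm (U - V)"
    using source_Lipschitz by metis
  fix y a assume a: "a \<in> A" and y: "\<forall>n. y n \<in> A" "y \<longlonglongrightarrow> a"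
  have wy: "(\<lambda>n. w (y n)) \<longlonglongrightarrow> w a"
    using w a y unfolding continuous_on_sequentially by (auto simp: o_def)
  then have "(\<lambda>n. K * (norm (w (y n)) + norm (w a)) * norm (w (y n) - w a)) \<longlonglongrightarrow> K * (norm (w a) + norm (w a)) * norm (w a - w a)"
    by (intro tendsto_intros)
  then have "(\<lambda>n. K * (norm (w (y n)) + norm (w a)) * norm (w (y n) - w a)) \<longlonglongrightarrow> 0" by simp
  then have "(\<lambda>n. source (w (y n)) - source (w a)) \<longlonglongrightarrow> 0"
    by (rule Lim_null_comparison[rotated]) (simp add: K)
  then show "((\<lambda>\<tau>. source (w \<tau>)) \<circ> y) \<longlonglongrightarrow> source (w a)"
    unfolding o_def by (rule LIM_zero_cancel)
qed

lemma interaction_quadratic: "\<exists>K. quadratic_vector_field interaction K"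
proof -
  obtain K where K: "K > 0" "\<And>U V. norm (source U - source V) \<le> K * (norm U + norm V) * norm (U - V)"
    using source_Lipschitz by metis
  have "quadratic_vector_field interaction K"
  proof
    fix \<tau> :: real and x y :: l2
    have "flow t 0 = 0" for t
      using linear_0[OF bounded_linear.axioms(1)[OF flow_bounded_linear]] .
    then show "interaction \<tau> 0 = 0" unfolding interaction_def by (simp add: source_zero)
    show "norm (interaction \<tau> x - interaction \<tau> y) \<le> K * (norm x + norm y) * norm (x - y)"
      using K(2)[of "flow \<tau> x" "flow \<tau> y"]
      unfolding interaction_def flow_diff[symmetric] norm_flow .
  next
    fix T :: real and w :: "real \<Rightarrow> l2" assume "continuous_on {0..T} w"
    then show "continuous_on {0..T} (\<lambda>\<tau>. interaction \<tau> (w \<tau>))"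
      unfolding interaction_def by (intro continuous_on_flow continuous_on_source continuous_intros)
  qed (rule K)
  then show ?thesis ..
qed

lemma conj_reflect_flow: "conj_reflect (flow t x) = flow t (conj_reflect x)"
  unfolding flow_def
proof (rule conj_reflect_symbol_op[OF flow_symbol_bounded])
  fix \<xi>
  have "phi \<nu> (- \<xi>) = - phi \<nu> \<xi>" by (simp add: phi_def)
  then show "cnj (flow_symbol t (- \<xi>)) = flow_symbol t \<xi>"
    unfolding flow_symbol_def by (simp add: exp_cnj)
qed

lemma conj_reflect_source: "conj_reflect (source U) = source (conj_reflect U)"
proof -
  obtain K where alg: "\<And>u v. u \<in> sobolev s \<Longrightarrow> v \<in> sobolev s \<Longrightarrow> (\<lambda>x. u x * v x) \<in> sobolev s"
    using sobolev_algebra[OF s] by metis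
  let ?g = "representative U"
  note g = sobolev_cnj[OF representative_sobolev[of U]]
  have "source (conj_reflect U) = source (sobolev_l2 s (\<lambda>x. cnj (?g x)))"
    by (simp add: g(2) sobolev_l2_representative)
  also have "\<dots> = symbol_op source_symbol (sobolev_l2 s (\<lambda>x. cnj (?g x * ?g x)))"
    by (subst source_sobolev_l2[OF g(1)]) simp
  also have "\<dots> = symbol_op source_symbol (conj_reflect (sobolev_l2 s (\<lambda>x. ?g x * ?g x)))"
    by (simp only: sobolev_cnj(2)[OF alg[OF representative_sobolev representative_sobolev]])
  also have "\<dots> = conj_reflect (symbol_op source_symbol (sobolev_l2 s (\<lambda>x. ?g x * ?g x)))"
    by (rule conj_reflect_symbol_op[OF source_symbol_bounded, symmetric]) (simp add: source_symbol_def psi_def)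
  finally show ?thesis unfolding source_def by simp
qed

lemma conj_reflect_interaction: "conj_reflect (interaction \<tau> W) = interaction \<tau> (conj_reflect W)"
  unfolding interaction_def by (simp add: conj_reflect_flow conj_reflect_source)

definition duhamel_integrand :: "(real \<Rightarrow> real \<Rightarrow> real) \<Rightarrow> real \<Rightarrow> real \<Rightarrow> real \<Rightarrow> complex" where
  "duhamel_integrand u t \<tau> = propagator \<nu> (t - \<tau>) (psi_op \<nu> (cplx (\<lambda>x. (u \<tau> x)\<^sup>2)))"

lemma sobolev_propagator:
  assumes "f \<in> sobolev s"
  shows "propagator \<nu> t f \<in> sobolev s" "sobolev_l2 s (propagator \<nu> t f) = flow t (sobolev_l2 s f)"
  using sobolev_fourier_multiplier[OF flow_symbol_bounded assms, of t]
  unfolding propagator_def flow_def flow_symbol_def[abs_def] by auto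

text \<open>
  The factor $i$ undoes the factor $-i$ in \<open>source\<close>.
\<close>
lemma duhamel_integrand_sobolev:
  assumes u: "cplx (u \<tau>) \<in> sobolev s"
  shows "duhamel_integrand u t \<tau> \<in> sobolev s"
    and "sobolev_l2 s (duhamel_integrand u t \<tau>) = symbol_op (\<lambda>_. \<i>) (flow (t - \<tau>) (source (sobolev_l2 s (cplx (u \<tau>)))))"
proof -
  obtain K where alg: "\<And>u v. u \<in> sobolev s \<Longrightarrow> v \<in> sobolev s \<Longrightarrow> (\<lambda>x. u x * v x) \<in> sobolev s"
    using sobolev_algebra[OF s] by metis
  have sq: "cplx (\<lambda>x. (u \<tau> x)\<^sup>2) = (\<lambda>x. cplx (u \<tau>) x * cplx (u \<tau>) x)"
    by (simp add: power2_eq_square)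
  note P = sobolev_fourier_multiplier[OF psi_symbol_bounded alg[OF u u], folded psi_op_def sq]
  show "duhamel_integrand u t \<tau> \<in> sobolev s"
    unfolding duhamel_integrand_def by (rule sobolev_propagator[OF P(1)])
  have "sobolev_l2 s (duhamel_integrand u t \<tau>) = flow (t - \<tau>) (symbol_op (\<lambda>\<xi>. complex_of_real (psi \<nu> \<xi>)) (sobolev_l2 s (\<lambda>x. cplx (u \<tau>) x * cplx (u \<tau>) x)))"
    unfolding duhamel_integrand_def sobolev_propagator(2)[OF P(1)] P(2) unfolding sq ..
  also have "\<dots> = symbol_op (\<lambda>_. \<i>) (flow (t - \<tau>) (source (sobolev_l2 s (cplx (u \<tau>)))))"
    unfolding source_sobolev_l2[OF u] flow_def
    by (simp add: symbol_op_compose flow_symbol_bounded source_symbol_bounded psi_symbol_bounded bounded_symbol_const bounded_symbol_times)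
      (simp add: source_symbol_def mult_ac)
  finally show "sobolev_l2 s (duhamel_integrand u t \<tau>) = symbol_op (\<lambda>_. \<i>) (flow (t - \<tau>) (source (sobolev_l2 s (cplx (u \<tau>)))))" .
qed

text \<open>
  Under the identification with \<open>l2\<close>, Riemann integrals in $H^s$ become Riemann integrals in a Banach
  space.
\<close>
lemma has_sobolev_integral_iff:
  "has_sobolev_integral s f I a b \<longleftrightarrow> (\<forall>\<tau>\<in>{a..b}. f \<tau> \<in> sobolev s) \<and> I \<in> sobolev s \<and>
     (\<forall>\<epsilon>>0. \<exists>\<delta>>0. \<forall>p. p tagged_division_of {a..b} \<and> (\<lambda>\<tau>. ball \<tau> \<delta>) fine p \<longrightarrow>
        norm ((\<Sum>(\<tau>, k)\<in>p. measure lborel k *\<^sub>R sobolev_l2 s (f \<tau>)) - sobolev_l2 s I) < \<epsilon>)"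
proof (cases "(\<forall>\<tau>\<in>{a..b}. f \<tau> \<in> sobolev s) \<and> I \<in> sobolev s")
  case True
  have "sobolev_norm s (\<lambda>x. (\<Sum>(\<tau>, k)\<in>p. measure lborel k *\<^sub>R f \<tau> x) - I x)
      = norm ((\<Sum>(\<tau>, k)\<in>p. measure lborel k *\<^sub>R sobolev_l2 s (f \<tau>)) - sobolev_l2 s I)"
    if p: "p tagged_division_of {a..b}" for p
  proof -
    have "finite p" using p by auto
    moreover have "f (fst i) \<in> sobolev s" if i: "i \<in> p" for i
    proof -
      obtain \<tau> k where "i = (\<tau>, k)" by (cases i)
      then have "\<tau> \<in> {a..b}" using p i tagged_division_ofD(2,3)[OF p] by blast
      then show ?thesis using True \<open>i = (\<tau>, k)\<close> by simp
    qed
    ultimately have "(\<lambda>x. \<Sum>i\<in>p. measure lborel (snd i) *\<^sub>R f (fst i) x) \<in> sobolev s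
        \<and> sobolev_l2 s (\<lambda>x. \<Sum>i\<in>p. measure lborel (snd i) *\<^sub>R f (fst i) x) = (\<Sum>i\<in>p. measure lborel (snd i) *\<^sub>R sobolev_l2 s (f (fst i)))"
      by (rule sobolev_sum[where f = "\<lambda>i. f (fst i)"])
    then show ?thesis
      using sobolev_diff[OF _ conjunct2[OF True]] by (simp add: sobolev_norm_eq split_def)
  qed
  then show ?thesis unfolding has_sobolev_integral_def by (simp cong: conj_cong imp_cong)
qed (auto simp: has_sobolev_integral_def)

lemma duhamel_equation_iff:
  assumes u0: "cplx u0 \<in> sobolev s" and u: "cplx (u t) \<in> sobolev s" and I: "I \<in> sobolev s"
  shows "(AE x in lborel. complex_of_real (u t x) = propagator \<nu> t (cplx u0) x - \<i> * I x) \<longleftrightarrow>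
    flow (- t) (sobolev_l2 s (cplx (u t))) = sobolev_l2 s (cplx u0) + flow (- t) (symbol_op (\<lambda>_. - \<i>) (sobolev_l2 s I))"
proof -
  note P = sobolev_propagator[OF u0, of t] and M = sobolev_cmult[OF I, of "-\<i>"]
  note R = sobolev_add[OF P(1) M(1)]
  have "(AE x in lborel. complex_of_real (u t x) = propagator \<nu> t (cplx u0) x - \<i> * I x) \<longleftrightarrow>
      sobolev_l2 s (cplx (u t)) = sobolev_l2 s (\<lambda>x. propagator \<nu> t (cplx u0) x + - \<i> * I x)"
    by (subst sobolev_l2_inject[OF u R(1)]) simp
  also have "\<dots> \<longleftrightarrow> flow (- t) (sobolev_l2 s (cplx (u t))) = flow (- t) (sobolev_l2 s (\<lambda>x. propagator \<nu> t (cplx u0) x + - \<i> * I x))"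
    by (metis flow_inverse(2))
  also have "sobolev_l2 s (\<lambda>x. propagator \<nu> t (cplx u0) x + - \<i> * I x) = flow t (sobolev_l2 s (cplx u0)) + symbol_op (\<lambda>_. - \<i>) (sobolev_l2 s I)"
    unfolding R(2) P(2) M(2) ..
  finally show ?thesis by (simp add: flow_add)
qed

text \<open>
  Applying $S(-t)$ to Duhamel's integral turns $S(t-\tau)$ into $S(-\tau)$, so that the integrand no longer
  depends on $t$.
\<close>
lemma duhamel_integral_interaction:
  assumes int: "((\<lambda>\<tau>. sobolev_l2 s (duhamel_integrand u t \<tau>)) has_integral Y) {0..t}"
    and u: "\<And>\<tau>. \<tau> \<in> {0..t} \<Longrightarrow> cplx (u \<tau>) \<in> sobolev s"
  shows "integral {0..t} (\<lambda>\<tau>. interaction \<tau> (flow (- \<tau>) (sobolev_l2 s (cplx (u \<tau>))))) = flow (- t) (symbol_op (\<lambda>_. - \<i>) Y)"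
proof (rule integral_unique)
  have "bounded_linear (\<lambda>x. flow (- t) (symbol_op (\<lambda>_. - \<i>) x))"
    by (rule bounded_linear_compose[OF flow_bounded_linear bounded_linear_symbol_op[OF bounded_symbol_const]])
  from has_integral_linear[OF int this]
  have "((\<lambda>\<tau>. flow (- t) (symbol_op (\<lambda>_. - \<i>) (sobolev_l2 s (duhamel_integrand u t \<tau>)))) has_integral flow (- t) (symbol_op (\<lambda>_. - \<i>) Y)) {0..t}"
    by (simp add: o_def)
  moreover have "flow (- t) (symbol_op (\<lambda>_. - \<i>) (sobolev_l2 s (duhamel_integrand u t \<tau>))) = interaction \<tau> (flow (- \<tau>) (sobolev_l2 s (cplx (u \<tau>))))"
    if "\<tau> \<in> {0..t}" for \<tau>
  proof -
    have "symbol_op (\<lambda>_. - \<i>) (symbol_op (\<lambda>_. \<i>) x) = x" for x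
      using flow_0[of x] unfolding symbol_op_compose[OF bounded_symbol_const bounded_symbol_const] flow_def flow_symbol_def
      by simp
    then show ?thesis
      unfolding interaction_def duhamel_integrand_sobolev(2)[where u = u, OF u[OF that]] by (simp add: flow_flow flow_0)
  qed
  ultimately show "((\<lambda>\<tau>. interaction \<tau> (flow (- \<tau>) (sobolev_l2 s (cplx (u \<tau>))))) has_integral flow (- t) (symbol_op (\<lambda>_. - \<i>) Y)) {0..t}"
    using has_integral_cong by (metis (no_types, lifting))
qed

lemma sobolev_curve_iff:
  "sobolev_curve s T u \<longleftrightarrow> (\<forall>t\<in>{0..T}. cplx (u t) \<in> sobolev s) \<and> continuous_on {0..T} (\<lambda>t. sobolev_l2 s (cplx (u t)))"
proof (cases "\<forall>t\<in>{0..T}. cplx (u t) \<in> sobolev s")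
  case True
  have "((\<lambda>\<tau>. sobolev_norm s (cplx (\<lambda>x. u \<tau> x - u t x))) \<longlongrightarrow> 0) (at t within {0..T})
     \<longleftrightarrow> ((\<lambda>\<tau>. sobolev_l2 s (cplx (u \<tau>))) \<longlongrightarrow> sobolev_l2 s (cplx (u t))) (at t within {0..T})" if t: "t \<in> {0..T}" for t
  proof -
    have eq: "sobolev_norm s (cplx (\<lambda>x. u \<tau> x - u t x)) = norm (sobolev_l2 s (cplx (u \<tau>)) - sobolev_l2 s (cplx (u t)))"
      if "\<tau> \<in> {0..T}" for \<tau>
      using sobolev_diff[OF True[rule_format, OF that] True[rule_format, OF t]] by (simp add: sobolev_norm_eq)
    have "((\<lambda>\<tau>. sobolev_norm s (cplx (\<lambda>x. u \<tau> x - u t x))) \<longlongrightarrow> 0) (at t within {0..T})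
      \<longleftrightarrow> ((\<lambda>\<tau>. norm (sobolev_l2 s (cplx (u \<tau>)) - sobolev_l2 s (cplx (u t)))) \<longlongrightarrow> 0) (at t within {0..T})"
      by (rule tendsto_cong) (unfold eventually_at_filter, intro always_eventually allI impI eq)
    then show ?thesis by (simp add: tendsto_norm_zero_iff LIM_zero_iff)
  qed
  then show ?thesis using True unfolding sobolev_curve_def continuous_on_def by simp
qed (auto simp: sobolev_curve_def)

text \<open>
  Duhamel's formula for real-valued curves in $H^s$ is the integral equation of the interaction
  picture in \<open>l2\<close>; everything about solutions is transferred along this equivalence.
\<close>
lemma ivp_solution_iff:
  assumes u0: "cplx u0 \<in> sobolev s"
  shows "ivp_solution \<nu> s T u0 u \<longleftrightarrow> (\<forall>t\<in>{0..T}. cplx (u t) \<in> sobolev s) \<and>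
    integral_solution interaction T (sobolev_l2 s (cplx u0)) (\<lambda>t. flow (- t) (sobolev_l2 s (cplx (u t))))"
    (is "?L \<longleftrightarrow> ?R")
proof
  assume L: ?L
  then have curve: "sobolev_curve s T u" by (simp add: ivp_solution_def)
  then have u: "\<And>t. t \<in> {0..T} \<Longrightarrow> cplx (u t) \<in> sobolev s"
    and c: "continuous_on {0..T} (\<lambda>t. sobolev_l2 s (cplx (u t)))" by (auto simp: sobolev_curve_iff)
  have "flow (- t) (sobolev_l2 s (cplx (u t))) = sobolev_l2 s (cplx u0)
      + integral {0..t} (\<lambda>\<tau>. interaction \<tau> (flow (- \<tau>) (sobolev_l2 s (cplx (u \<tau>)))))" if t: "t \<in> {0..T}" for t
  proof -
    from L t obtain I where I: "has_sobolev_integral s (duhamel_integrand u t) I 0 t"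
      and eq: "AE x in lborel. complex_of_real (u t x) = propagator \<nu> t (cplx u0) x - \<i> * I x"
      unfolding ivp_solution_def duhamel_integrand_def[abs_def] by blast
    have "((\<lambda>\<tau>. sobolev_l2 s (duhamel_integrand u t \<tau>)) has_integral sobolev_l2 s I) {0..t}"
      using I unfolding has_sobolev_integral_iff by (intro Riemann_imp_has_integral) blast
    from duhamel_integral_interaction[OF this u]
    have "integral {0..t} (\<lambda>\<tau>. interaction \<tau> (flow (- \<tau>) (sobolev_l2 s (cplx (u \<tau>))))) = flow (- t) (symbol_op (\<lambda>_. - \<i>) (sobolev_l2 s I))"
      using t by auto
    moreover have "I \<in> sobolev s" using I by (simp add: has_sobolev_integral_def)
    ultimately show ?thesis using eq duhamel_equation_iff[where u = u, OF u0 u[OF t]] by simp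
  qed
  moreover have "continuous_on {0..T} (\<lambda>t. flow (- t) (sobolev_l2 s (cplx (u t))))"
    by (intro continuous_on_flow continuous_intros c)
  ultimately show ?R using u unfolding integral_solution_def by blast
next
  assume R: ?R
  then have u: "\<And>t. t \<in> {0..T} \<Longrightarrow> cplx (u t) \<in> sobolev s" by blast
  from R have W: "continuous_on {0..T} (\<lambda>t. flow (- t) (sobolev_l2 s (cplx (u t))))"
    and eq: "\<And>t. t \<in> {0..T} \<Longrightarrow> flow (- t) (sobolev_l2 s (cplx (u t))) = sobolev_l2 s (cplx u0)
      + integral {0..t} (\<lambda>\<tau>. interaction \<tau> (flow (- \<tau>) (sobolev_l2 s (cplx (u \<tau>)))))"
    unfolding integral_solution_def by blast+
  have "continuous_on {0..T} (\<lambda>t. flow t (flow (- t) (sobolev_l2 s (cplx (u t)))))"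
    by (intro continuous_on_flow continuous_intros W)
  then have c: "continuous_on {0..T} (\<lambda>t. sobolev_l2 s (cplx (u t)))" by simp
  show ?L
    unfolding ivp_solution_def sobolev_curve_iff
  proof (intro conjI ballI u c)
    fix t assume t: "t \<in> {0..T}"
    then have ut: "\<And>\<tau>. \<tau> \<in> {0..t} \<Longrightarrow> cplx (u \<tau>) \<in> sobolev s" using u by auto
    let ?G = "\<lambda>\<tau>. sobolev_l2 s (duhamel_integrand u t \<tau>)"
    have "continuous_on {0..t} (\<lambda>\<tau>. symbol_op (\<lambda>_. \<i>) (flow (t - \<tau>) (source (sobolev_l2 s (cplx (u \<tau>))))))"
      using t by (intro bounded_linear.continuous_on[OF bounded_linear_symbol_op[OF bounded_symbol_const]]
          continuous_on_flow continuous_on_source continuous_intros continuous_on_subset[OF c]) auto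
    then have cG: "continuous_on {0..t} ?G"
      by (rule continuous_on_eq) (simp add: duhamel_integrand_sobolev(2) ut)
    define I where "I = representative (integral {0..t} ?G)"
    have I: "I \<in> sobolev s" "sobolev_l2 s I = integral {0..t} ?G"
      unfolding I_def by (simp_all add: representative_sobolev sobolev_l2_representative)
    have "has_sobolev_integral s (duhamel_integrand u t) I 0 t"
      unfolding has_sobolev_integral_iff I(2)
      using continuous_Riemann_integral[OF cG] t I(1) duhamel_integrand_sobolev(1)[where u = u, OF ut] by auto
    moreover have "(?G has_integral sobolev_l2 s I) {0..t}"
      unfolding I(2) using cG by (intro integrable_integral integrable_continuous_interval)
    then have "AE x in lborel. complex_of_real (u t x) = propagator \<nu> t (cplx u0) x - \<i> * I x"
      unfolding duhamel_equation_iff[where u = u, OF u0 u[OF t] I(1)] eq[OF t]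
      using duhamel_integral_interaction[OF _ ut] by simp
    ultimately show "\<exists>I. has_sobolev_integral s (\<lambda>\<tau>. propagator \<nu> (t - \<tau>) (psi_op \<nu> (cplx (\<lambda>x. (u \<tau> x)\<^sup>2)))) I 0 t \<and>
        (AE x in lborel. complex_of_real (u t x) = propagator \<nu> t (cplx u0) x - \<i> * I x)"
      unfolding duhamel_integrand_def[abs_def] by blast
  qed
qed

lemma real_representative:
  assumes "conj_reflect U = U"
  shows "\<exists>u :: real \<Rightarrow> real. cplx u \<in> sobolev s \<and> sobolev_l2 s (cplx u) = U"
proof -
  let ?g = "representative U"
  note g = representative_sobolev[of U] and gc = sobolev_cnj[OF representative_sobolev[of U]]
  have "sobolev_l2 s (\<lambda>x. cnj (?g x)) = sobolev_l2 s ?g" unfolding gc(2) sobolev_l2_representative by (rule assms)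
  then have "AE x in lborel. cnj (?g x) = ?g x" using sobolev_l2_inject[OF gc(1) g] by blast
  then have "AE x in lborel. ?g x = cplx (\<lambda>x. Re (?g x)) x"
    by eventually_elim (simp add: complex_eq_iff)
  moreover have "cplx (\<lambda>x. Re (?g x)) \<in> borel_measurable borel"
    using square_integrableD[OF sobolev_square_integrable[OF g]] by measurable
  ultimately show ?thesis using sobolev_l2_cong_AE[OF g] sobolev_l2_representative by (intro exI[of _ "\<lambda>x. Re (?g x)"]) simp
qed

text \<open>
  The solution $w$ supplied by the fixed point theorem corresponds to complex-valued functions a priori.
  Its image under \<open>conj_reflect\<close> solves the same equation with the same real data, hence equals $w$.
\<close>
lemma real_ivp_solution_exists:
  assumes K: "quadratic_vector_field interaction K"
    and u0: "cplx u0 \<in> sobolev s" and rho: "\<rho> > 0" "norm (sobolev_l2 s (cplx u0)) \<le> \<rho>"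
    and T: "T > 0" "T * (8 * K * \<rho>) \<le> 1"
  shows "\<exists>u. ivp_solution \<nu> s T u0 u \<and> (\<forall>t\<in>{0..T}. norm (sobolev_l2 s (cplx (u t))) \<le> 2 * \<rho>)"
proof -
  interpret quadratic_vector_field interaction K by (rule K)
  let ?U0 = "sobolev_l2 s (cplx u0)"
  obtain w where w: "integral_solution interaction T ?U0 w" and bd: "\<And>t. t \<in> {0..T} \<Longrightarrow> norm (w t) \<le> 2 * \<rho>"
    using integral_solution_exists[OF rho T] by blast
  have J0: "conj_reflect ?U0 = ?U0" using sobolev_cnj(2)[OF u0] by simp
  have "integral_solution interaction T ?U0 (\<lambda>t. conj_reflect (w t))"
    unfolding integral_solution_def
  proof (intro conjI ballI)
    have cw: "continuous_on {0..T} w" using w by (simp add: integral_solution_def)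
    then show "continuous_on {0..T} (\<lambda>t. conj_reflect (w t))"
      by (rule bounded_linear.continuous_on[OF bounded_linear_conj_reflect])
    fix t assume t: "t \<in> {0..T}"
    have "conj_reflect (integral {0..t} (\<lambda>\<tau>. interaction \<tau> (w \<tau>))) = integral {0..t} (\<lambda>\<tau>. conj_reflect (interaction \<tau> (w \<tau>)))"
      using integral_linear[OF vector_field_integrable[OF cw t] bounded_linear_conj_reflect] by (simp add: o_def)
    moreover have "w t = ?U0 + integral {0..t} (\<lambda>\<tau>. interaction \<tau> (w \<tau>))"
      using w t unfolding integral_solution_def by blast
    ultimately show "conj_reflect (w t) = ?U0 + integral {0..t} (\<lambda>\<tau>. interaction \<tau> (conj_reflect (w \<tau>)))"
      by (metis (no_types, lifting) conj_reflect_add J0 conj_reflect_interaction integral_cong)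
  qed
  then have J: "conj_reflect (w t) = w t" if "t \<in> {0..T}" for t
    using integral_solution_unique[OF _ w that] by blast
  have "\<exists>u :: real \<Rightarrow> real. cplx u \<in> sobolev s \<and> sobolev_l2 s (cplx u) = flow t (w t)" if "t \<in> {0..T}" for t
    by (rule real_representative) (simp add: conj_reflect_flow J[OF that])
  then obtain u :: "real \<Rightarrow> real \<Rightarrow> real" where u: "\<And>t. t \<in> {0..T} \<Longrightarrow> cplx (u t) \<in> sobolev s"
      "\<And>t. t \<in> {0..T} \<Longrightarrow> sobolev_l2 s (cplx (u t)) = flow t (w t)"
    by metis
  have wu: "flow (- t) (sobolev_l2 s (cplx (u t))) = w t" if "t \<in> {0..T}" for t
    using u(2)[OF that] by simp
  have "integral_solution interaction T ?U0 (\<lambda>t. flow (- t) (sobolev_l2 s (cplx (u t))))"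
    unfolding integral_solution_def
  proof (intro conjI ballI)
    show "continuous_on {0..T} (\<lambda>t. flow (- t) (sobolev_l2 s (cplx (u t))))"
      by (rule continuous_on_eq[of _ w]) (use w wu in \<open>simp_all only: integral_solution_def\<close>)
    fix t assume t: "t \<in> {0..T}"
    have "integral {0..t} (\<lambda>\<tau>. interaction \<tau> (flow (- \<tau>) (sobolev_l2 s (cplx (u \<tau>))))) = integral {0..t} (\<lambda>\<tau>. interaction \<tau> (w \<tau>))"
      using t wu by (intro integral_cong) auto
    then show "flow (- t) (sobolev_l2 s (cplx (u t))) = ?U0 + integral {0..t} (\<lambda>\<tau>. interaction \<tau> (flow (- \<tau>) (sobolev_l2 s (cplx (u \<tau>)))))"
      using w t wu[OF t] unfolding integral_solution_def by simp
  qed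
  then have "ivp_solution \<nu> s T u0 u" unfolding ivp_solution_iff[OF u0] using u(1) by blast
  moreover have "\<forall>t\<in>{0..T}. norm (sobolev_l2 s (cplx (u t))) \<le> 2 * \<rho>"
    using bd by (simp add: u(2) norm_flow)
  ultimately show ?thesis by blast
qed

lemma ivp_solution_unique:
  assumes u0: "cplx u0 \<in> sobolev s"
    and u: "ivp_solution \<nu> s T u0 u" and v: "ivp_solution \<nu> s T u0 v" and t: "t \<in> {0..T}"
  shows "sobolev_l2 s (cplx (u t)) = sobolev_l2 s (cplx (v t))" "AE x in lborel. u t x = v t x"
proof -
  obtain K where "quadratic_vector_field interaction K" using interaction_quadratic by blast
  then interpret quadratic_vector_field interaction K .
  have "flow (- t) (sobolev_l2 s (cplx (u t))) = flow (- t) (sobolev_l2 s (cplx (v t)))"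
    using u v unfolding ivp_solution_iff[OF u0] by (intro integral_solution_unique[OF _ _ t]) auto
  then show eq: "sobolev_l2 s (cplx (u t)) = sobolev_l2 s (cplx (v t))" by (metis flow_inverse(2))
  have "cplx (u t) \<in> sobolev s" "cplx (v t) \<in> sobolev s"
    using u v t unfolding ivp_solution_iff[OF u0] by auto
  from sobolev_l2_inject[OF this] eq show "AE x in lborel. u t x = v t x" by simp
qed

lemma ivp_solution_stability:
  assumes K: "quadratic_vector_field interaction K"
    and u0: "cplx u0 \<in> sobolev s" and v0: "cplx v0 \<in> sobolev s"
    and u: "ivp_solution \<nu> s T u0 u" and v: "ivp_solution \<nu> s T v0 v"
    and M: "\<And>t. t \<in> {0..T} \<Longrightarrow> norm (sobolev_l2 s (cplx (u t))) \<le> M" "\<And>t. t \<in> {0..T} \<Longrightarrow> norm (sobolev_l2 s (cplx (v t))) \<le> M"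
    and t: "t \<in> {0..T}"
  shows "sobolev_norm s (cplx (\<lambda>x. v t x - u t x)) \<le> sobolev_norm s (cplx (\<lambda>x. v0 x - u0 x)) * exp (2 * K * M * t)"
proof -
  interpret quadratic_vector_field interaction K by (rule K)
  have "cplx (u t) \<in> sobolev s" "cplx (v t) \<in> sobolev s"
    using u v t unfolding ivp_solution_iff[OF u0] ivp_solution_iff[OF v0] by auto
  then have "sobolev_norm s (cplx (\<lambda>x. v t x - u t x)) = norm (sobolev_l2 s (cplx (v t)) - sobolev_l2 s (cplx (u t)))"
    using sobolev_diff[of "cplx (v t)" s "cplx (u t)"] by (simp add: sobolev_norm_eq)
  also have "\<dots> = norm (flow (- t) (sobolev_l2 s (cplx (v t))) - flow (- t) (sobolev_l2 s (cplx (u t))))"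
    by (simp add: norm_flow flip: flow_diff)
  also have "\<dots> \<le> norm (sobolev_l2 s (cplx v0) - sobolev_l2 s (cplx u0)) * exp (2 * K * M * t)"
    using u v M unfolding ivp_solution_iff[OF u0] ivp_solution_iff[OF v0]
    by (intro integral_solution_stability[OF _ _ _ _ t]) (auto simp: norm_flow)
  also have "norm (sobolev_l2 s (cplx v0) - sobolev_l2 s (cplx u0)) = sobolev_norm s (cplx (\<lambda>x. v0 x - u0 x))"
    using sobolev_diff[OF v0 u0] by (simp add: sobolev_norm_eq)
  finally show ?thesis .
qed

end

theorem theorem1:
  fixes \<nu> s :: real
  assumes "\<nu> < 1/6" and "s \<ge> 1"
  shows "\<exists>T :: real \<Rightarrow> real. (\<forall>r\<ge>0. T r > 0) \<and>
    (\<forall>u0 :: real \<Rightarrow> real. cplx u0 \<in> sobolev s \<longrightarrow>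
      (let T0 = T (sobolev_norm s (cplx u0)) in
        (\<exists>u. ivp_solution \<nu> s T0 u0 u) \<and>
        (\<forall>u v. ivp_solution \<nu> s T0 u0 u \<and> ivp_solution \<nu> s T0 u0 v \<longrightarrow>
           (\<forall>t\<in>{0..T0}. AE x in lborel. u t x = v t x)) \<and>
        (\<forall>\<epsilon>>0. \<exists>\<delta>>0. \<forall>v0 :: real \<Rightarrow> real.
           cplx v0 \<in> sobolev s \<and> sobolev_norm s (cplx (\<lambda>x. v0 x - u0 x)) < \<delta> \<longrightarrow>
             (\<exists>v. ivp_solution \<nu> s T0 v0 v) \<and>
             (\<forall>u v. ivp_solution \<nu> s T0 u0 u \<and> ivp_solution \<nu> s T0 v0 v \<longrightarrow>
                (\<forall>t\<in>{0..T0}. sobolev_norm s (cplx (\<lambda>x. v t x - u t x)) < \<epsilon>)))))"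
proof -
  interpret bbm_equation \<nu> s by standard (use assms in auto)
  obtain K where K: "quadratic_vector_field interaction K" using interaction_quadratic by blast
  then have K0: "K > 0" by (rule quadratic_vector_field.K_pos)
  \<comment> \<open>the lifespan is chosen for data of norm at most $r + 1$\<close>
  define T where "T r = 1 / (8 * K * (r + 1))" for r
  show ?thesis
  proof (intro exI[of _ T] conjI allI impI)
    fix r :: real assume "r \<ge> 0"
    then show "T r > 0" unfolding T_def using K0 by simp
  next
    fix u0 :: "real \<Rightarrow> real" assume u0: "cplx u0 \<in> sobolev s"
    define r where "r = norm (sobolev_l2 s (cplx u0))"
    define T0 where "T0 = T r"
    have r0: "r \<ge> 0" by (simp add: r_def)
    have T0: "T0 > 0" "T0 * (8 * K * (r + 1)) \<le> 1"
      unfolding T0_def T_def using r0 K0 by auto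
    have exist: "\<exists>v. ivp_solution \<nu> s T0 v0 v \<and> (\<forall>t\<in>{0..T0}. norm (sobolev_l2 s (cplx (v t))) \<le> 2 * (r + 1))"
      if "cplx v0 \<in> sobolev s" "norm (sobolev_l2 s (cplx v0)) \<le> r + 1" for v0
      using r0 that by (intro real_ivp_solution_exists[OF K _ _ _ T0]) auto
    \<comment> \<open>uniqueness carries the bound over from the constructed solution to every solution\<close>
    have bounded: "norm (sobolev_l2 s (cplx (v t))) \<le> 2 * (r + 1)"
      if v0: "cplx v0 \<in> sobolev s" "norm (sobolev_l2 s (cplx v0)) \<le> r + 1"
        and v: "ivp_solution \<nu> s T0 v0 v" and t: "t \<in> {0..T0}" for v0 v t
      using exist[OF v0] ivp_solution_unique(1)[OF v0(1) v _ t] t by metis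
    have ur: "norm (sobolev_l2 s (cplx u0)) \<le> r + 1" by (simp add: r_def)
    have T0_eq: "T (sobolev_norm s (cplx u0)) = T0"
      by (simp add: T0_def r_def sobolev_norm_eq[OF u0])
    define A where "A = exp (2 * K * (2 * (r + 1)) * T0)"
    have dependence: "\<exists>\<delta>>0. \<forall>v0 :: real \<Rightarrow> real.
           cplx v0 \<in> sobolev s \<and> sobolev_norm s (cplx (\<lambda>x. v0 x - u0 x)) < \<delta> \<longrightarrow>
             (\<exists>v. ivp_solution \<nu> s T0 v0 v) \<and>
             (\<forall>u v. ivp_solution \<nu> s T0 u0 u \<and> ivp_solution \<nu> s T0 v0 v \<longrightarrow>
                (\<forall>t\<in>{0..T0}. sobolev_norm s (cplx (\<lambda>x. v t x - u t x)) < \<epsilon>))"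
      if e: "\<epsilon> > 0" for \<epsilon>
    proof (intro exI[of _ "min 1 (\<epsilon> / A)"] conjI allI impI ballI; (elim conjE)?)
      show "min 1 (\<epsilon> / A) > 0" using e by (simp add: A_def)
      fix v0 :: "real \<Rightarrow> real"
      assume v0: "cplx v0 \<in> sobolev s" and d: "sobolev_norm s (cplx (\<lambda>x. v0 x - u0 x)) < min 1 (\<epsilon> / A)"
      have dn: "sobolev_norm s (cplx (\<lambda>x. v0 x - u0 x)) = norm (sobolev_l2 s (cplx v0) - sobolev_l2 s (cplx u0))"
        using sobolev_diff[OF v0 u0] by (simp add: sobolev_norm_eq)
      have vr: "norm (sobolev_l2 s (cplx v0)) \<le> r + 1"
        using d norm_triangle_ineq2[of "sobolev_l2 s (cplx v0)" "sobolev_l2 s (cplx u0)"] unfolding dn r_def by linarith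
      show "\<exists>v. ivp_solution \<nu> s T0 v0 v" using exist[OF v0 vr] by blast
      fix u v t assume u: "ivp_solution \<nu> s T0 u0 u" and v: "ivp_solution \<nu> s T0 v0 v" and t: "t \<in> {0..T0}"
      have "sobolev_norm s (cplx (\<lambda>x. v t x - u t x))
          \<le> sobolev_norm s (cplx (\<lambda>x. v0 x - u0 x)) * exp (2 * K * (2 * (r + 1)) * t)"
        by (rule ivp_solution_stability[OF K u0 v0 u v bounded[OF u0 ur u] bounded[OF v0 vr v] t])
      also have "\<dots> \<le> sobolev_norm s (cplx (\<lambda>x. v0 x - u0 x)) * A"
        unfolding A_def dn using t K0 r0 by (intro mult_left_mono) (auto intro!: mult_left_mono)
      also have "\<dots> < \<epsilon>"
        using d by (simp add: A_def field_simps)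
      finally show "sobolev_norm s (cplx (\<lambda>x. v t x - u t x)) < \<epsilon>" .
    qed
    show "let T0 = T (sobolev_norm s (cplx u0)) in
        (\<exists>u. ivp_solution \<nu> s T0 u0 u) \<and>
        (\<forall>u v. ivp_solution \<nu> s T0 u0 u \<and> ivp_solution \<nu> s T0 u0 v \<longrightarrow>
           (\<forall>t\<in>{0..T0}. AE x in lborel. u t x = v t x)) \<and>
        (\<forall>\<epsilon>>0. \<exists>\<delta>>0. \<forall>v0 :: real \<Rightarrow> real.
           cplx v0 \<in> sobolev s \<and> sobolev_norm s (cplx (\<lambda>x. v0 x - u0 x)) < \<delta> \<longrightarrow>
             (\<exists>v. ivp_solution \<nu> s T0 v0 v) \<and>
             (\<forall>u v. ivp_solution \<nu> s T0 u0 u \<and> ivp_solution \<nu> s T0 v0 v \<longrightarrow>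
                (\<forall>t\<in>{0..T0}. sobolev_norm s (cplx (\<lambda>x. v t x - u t x)) < \<epsilon>)))"
      unfolding Let_def T0_eq using exist[OF u0 ur] ivp_solution_unique(2)[OF u0] dependence by blast
  qed
qed

end
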